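(* Let $n\ge 2$ and $U_{\rm id}=\{u={\rm diag}(u_1,\dots,u_n): u_i\in\mathbb R,\ u_1<\cdots<u_n\}$. For any $\mathrm{Herm}(n)$-valued solution $\Phi(u)$ of the isomonodromy equation $$\frac{\partial \Phi}{\partial u_k}=\frac{1}{2\pi \mathrm i}\big[\Phi,\ {\rm ad}_u^{-1}{\rm ad}_{E_k}\Phi\big],\qquad k=1,\dots,n,$$ on $U_{\rm id}$, there exists a unique constant $\Phi_0\in \mathrm{Herm}(n)$ such that, as $\frac{u_{k+1}-u_k}{u_k-u_{k-1}}\to+\infty$ for all $k=2,\dots,n-1$, $$\Phi(u)={\rm Ad}\left((u_2-u_1)^{\frac{\delta_1(\Phi_0)}{2\pi \mathrm i}}\cdot\overrightarrow{\prod_{k=2,\dots,n-1}}\left(\frac{u_{k+1}-u_k}{u_k-u_{k-1}}\right)^{\frac{\delta_k(\Phi_0)}{2\pi \mathrm i}}\right)\Phi_0+\sum_{k=2}^{n-1}\mathcal O\left(\frac{u_k-u_{k-1}}{u_{k+1}-u_k}\right).\qquad( * )$$ Furthermore, given any $\Phi_0\in\mathrm{Herm}(n)$ there exists a unique real analytic solution $\Phi(u)$ of the isomonodromy equation on $U_{\rm id}$ with the asymptotics $( * )$.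
   Context: $\mathrm i=\sqrt{-1}$; $\mathrm{Herm}(n)$ is the space of $n\times n$ Hermitian matrices. $E_k$ is the diagonal matrix with $(k,k)$-entry $1$ and all other entries $0$. ${\rm ad}_XY=[X,Y]$; ${\rm ad}_{E_k}\Phi$ is off-diagonal and ${\rm ad}_u$ (with $u={\rm diag}(u_1,\dots,u_n)$ having distinct entries) is invertible on off-diagonal matrices, which defines ${\rm ad}_u^{-1}{\rm ad}_{E_k}\Phi$. ${\rm Ad}(g)X=gXg^{-1}$. For $x>0$ and a matrix $M$, $x^M=e^{M\log x}$. In the ordered product $\overrightarrow{\prod}$ the factor of index $i$ stands to the right of the factor of index $j$ if $i>j$. For an $n\times n$ matrix $M$, $\delta_k(M)$ is the matrix with $\delta_k(M)_{ij}=M_{ij}$ if $1\le i,j\le k$ or $i=j$, and $\delta_k(M)_{ij}=0$ otherwise. Each $\mathcal O\big(\frac{u_k-u_{k-1}}{u_{k+1}-u_k}\big)$ denotes a remainder whose norm is at most $M\cdot\frac{u_k-u_{k-1}}{u_{k+1}-u_k}$ for some constant $M>0$ once $\frac{u_{k+1}-u_k}{u_k-u_{k-1}}$ is large enough. *)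

theory Defs
  imports "HOL-Analysis.Analysis"
begin

text \<open>
  Matrices of size \<open>n\<close> are indexed by a finite linearly ordered type \<open>'n\<close> with \<open>CARD('n) = n\<close>,
  whose \<open>k\<close>-th element (counting from 1) plays the role of the index \<open>k\<close>. A real diagonal matrix
  \<open>u = diag(u\<^sub>1, \<dots>, u\<^sub>n)\<close> is represented by its vector of diagonal entries.
\<close>

type_synonym 'n cmat = "complex^'n^'n"

definition idx_pos :: "'n::{finite,linorder} \<Rightarrow> nat" where
  "idx_pos i = card {..i}"

definition idx :: "nat \<Rightarrow> 'n::{finite,linorder}" where
  "idx k = (THE i. idx_pos i = k)"

lemma idx_pos_bij: "bij_betw (idx_pos :: 'n::{finite,linorder} \<Rightarrow> nat) UNIV {1..CARD('n)}"
proof -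
  have mono: "idx_pos i < idx_pos j" if "i < j" for i j :: 'n
    unfolding idx_pos_def by (rule psubset_card_mono) (use that in auto)
  have inj: "inj (idx_pos :: 'n \<Rightarrow> nat)"
    by (rule injI) (metis mono less_irrefl linorder_less_linear)
  have "1 \<le> idx_pos i" "idx_pos i \<le> CARD('n)" for i :: 'n
    by (auto simp: idx_pos_def card_mono Suc_le_eq card_gt_0_iff)
  then have "range (idx_pos :: 'n \<Rightarrow> nat) \<subseteq> {1..CARD('n)}"
    by auto
  then have "range (idx_pos :: 'n \<Rightarrow> nat) = {1..CARD('n)}"
    by (intro card_subset_eq) (auto simp: card_image inj)
  with inj show ?thesis
    by (simp add: bij_betw_def)
qed

lemma idx_pos_idx: "k \<in> {1..CARD('n)} \<Longrightarrow> idx_pos (idx k :: 'n::{finite,linorder}) = k"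
  unfolding idx_def
  by (rule theI') (metis (no_types) idx_pos_bij bij_betw_def imageE injD)

lemma idx_idx_pos: "idx (idx_pos i) = (i :: 'n::{finite,linorder})"
  unfolding idx_def using idx_pos_bij[where 'n='n] by (auto simp: bij_betw_def inj_def)

abbreviation coord :: "real^'n::{finite,linorder} \<Rightarrow> nat \<Rightarrow> real" where
  "coord u k \<equiv> u $ (idx k :: 'n)"

definition U_id :: "(real^'n::{finite,linorder}) set" where
  "U_id = {u. strict_mono (vec_nth u)}"

definition hermitian :: "'n::finite cmat \<Rightarrow> bool" where
  "hermitian A \<longleftrightarrow> map_matrix cnj (transpose A) = A"

definition diag_mat :: "real^'n::finite \<Rightarrow> 'n cmat" where
  "diag_mat u = (\<chi> i j. if i = j then of_real (u $ i) else 0)"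

definition E_mat :: "'n::finite \<Rightarrow> 'n cmat" where
  "E_mat k = diag_mat (axis k 1)"

definition ad :: "'n::finite cmat \<Rightarrow> 'n cmat \<Rightarrow> 'n cmat" where
  "ad X Y = X ** Y - Y ** X"

definition off_diagonal :: "'n::finite cmat set" where
  "off_diagonal = {X. \<forall>i. X $ i $ i = 0}"

definition ad_inv :: "real^'n::finite \<Rightarrow> 'n cmat \<Rightarrow> 'n cmat" where
  "ad_inv u = the_inv_into off_diagonal (ad (diag_mat u))"

lemma ad_diag_mat_nth: "ad (diag_mat u) X $ i $ j = of_real (u $ i - u $ j) * X $ i $ j"
proof -
  have "(diag_mat u ** X) $ i $ j = of_real (u $ i) * X $ i $ j"
    by (simp add: matrix_matrix_mult_def diag_mat_def if_distrib[of "\<lambda>z. z * _"] cong: if_cong)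
  moreover have "(X ** diag_mat u) $ i $ j = of_real (u $ j) * X $ i $ j"
    by (simp add: matrix_matrix_mult_def diag_mat_def if_distrib[of "\<lambda>z. _ * z"] cong: if_cong)
  ultimately show ?thesis
    by (simp add: ad_def algebra_simps)
qed

lemma ad_E_mat_off_diagonal: "ad (E_mat k) X \<in> off_diagonal"
  by (simp add: off_diagonal_def E_mat_def ad_diag_mat_nth)

lemma bij_ad_off_diagonal:
  assumes "inj (vec_nth u)"
  shows "bij_betw (ad (diag_mat u)) off_diagonal off_diagonal"
proof (rule bij_betw_byWitness[where f' = "\<lambda>X. \<chi> i j. X $ i $ j / of_real (u $ i - u $ j)"])
  have ne: "of_real (u $ i - u $ j) \<noteq> (0::complex)" if "i \<noteq> j" for i j
    using injD[OF assms, of i j] that by (metis eq_iff_diff_eq_0 of_real_eq_0_iff)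
  show "\<forall>X\<in>off_diagonal. (\<chi> i j. ad (diag_mat u) X $ i $ j / of_real (u $ i - u $ j)) = X"
  proof
    fix X :: "'a cmat" assume X: "X \<in> off_diagonal"
    have "ad (diag_mat u) X $ i $ j / of_real (u $ i - u $ j) = X $ i $ j" for i j
      using X ne[of i j] unfolding ad_diag_mat_nth
      by (cases "i = j") (auto simp: off_diagonal_def)
    then show "(\<chi> i j. ad (diag_mat u) X $ i $ j / of_real (u $ i - u $ j)) = X"
      by (simp add: vec_eq_iff)
  qed
  show "\<forall>X\<in>off_diagonal. ad (diag_mat u) (\<chi> i j. X $ i $ j / of_real (u $ i - u $ j)) = X"
  proof
    fix X :: "'a cmat" assume X: "X \<in> off_diagonal"
    have "ad (diag_mat u) (\<chi> i j. X $ i $ j / of_real (u $ i - u $ j)) $ i $ j = X $ i $ j" for i j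
      using X ne[of i j] unfolding ad_diag_mat_nth
      by (cases "i = j") (auto simp: off_diagonal_def)
    then show "ad (diag_mat u) (\<chi> i j. X $ i $ j / of_real (u $ i - u $ j)) = X"
      by (simp add: vec_eq_iff)
  qed
qed (auto simp: off_diagonal_def ad_diag_mat_nth)

definition cscale :: "complex \<Rightarrow> 'n::finite cmat \<Rightarrow> 'n cmat" where
  "cscale c = map_matrix (\<lambda>z. c * z)"

definition Ad :: "'n::finite cmat \<Rightarrow> 'n cmat \<Rightarrow> 'n cmat" where
  "Ad g X = g ** X ** matrix_inv g"

text \<open>
  The library's \<open>*\<close> and \<open>^\<close> on vectors act componentwise, so the matrix exponential is written out
  with powers taken with respect to \<open>**\<close>.
\<close>

definition mat_exp :: "'n::finite cmat \<Rightarrow> 'n cmat" where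
  "mat_exp A = (\<Sum>m. (1 / fact m) *\<^sub>R ((\<lambda>X. A ** X) ^^ m) (mat 1))"

definition real_mat_powr :: "real \<Rightarrow> 'n::finite cmat \<Rightarrow> 'n cmat" where
  "real_mat_powr x M = mat_exp (ln x *\<^sub>R M)"

definition delta :: "nat \<Rightarrow> 'n::{finite,linorder} cmat \<Rightarrow> 'n cmat" where
  "delta k M = (\<chi> i j. if (idx_pos i \<le> k \<and> idx_pos j \<le> k) \<or> i = j then M $ i $ j else 0)"

text \<open>
  Only the partial derivatives are required to exist; no continuity of \<open>\<Phi>\<close> is imposed.
  The value of \<open>\<Phi>\<close> outside \<open>U_id\<close> is irrelevant, since \<open>U_id\<close> is open.
\<close>

definition isomonodromy_solution :: "(real^'n::{finite,linorder} \<Rightarrow> 'n cmat) \<Rightarrow> bool" where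
  "isomonodromy_solution \<Phi> \<longleftrightarrow>
     (\<forall>u\<in>U_id. \<forall>k.
        ((\<lambda>t. \<Phi> (u + t *\<^sub>R axis k 1)) has_vector_derivative
           cscale (1 / (2 * of_real pi * \<i>)) (ad (\<Phi> u) (ad_inv u (ad (E_mat k) (\<Phi> u))))) (at 0))"

definition herm_isomonodromy_solution :: "(real^'n::{finite,linorder} \<Rightarrow> 'n cmat) \<Rightarrow> bool" where
  "herm_isomonodromy_solution \<Phi> \<longleftrightarrow> isomonodromy_solution \<Phi> \<and> (\<forall>u\<in>U_id. hermitian (\<Phi> u))"

text \<open>The ratio \<open>(u\<^sub>k\<^sub>+\<^sub>1 - u\<^sub>k) / (u\<^sub>k - u\<^sub>k\<^sub>-\<^sub>1)\<close>, used for \<open>2 \<le> k \<le> n - 1\<close>.\<close>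

definition gap_ratio :: "nat \<Rightarrow> real^'n::{finite,linorder} \<Rightarrow> real" where
  "gap_ratio k u = (coord u (k + 1) - coord u k) / (coord u k - coord u (k - 1))"

text \<open>
  The ordered product is \<open>F 2 ** (F 3 ** (\<dots> ** F (n - 1)))\<close>: larger indices stand to the right.
\<close>

definition leading_conj :: "'n::{finite,linorder} cmat \<Rightarrow> real^'n::{finite,linorder} \<Rightarrow> 'n cmat" where
  "leading_conj \<Phi>\<^sub>0 u =
     real_mat_powr (coord u 2 - coord u 1) (cscale (1 / (2 * of_real pi * \<i>)) (delta 1 \<Phi>\<^sub>0)) **
     foldr (\<lambda>k P. real_mat_powr (gap_ratio k u) (cscale (1 / (2 * of_real pi * \<i>)) (delta k \<Phi>\<^sub>0)) ** P)
       [2..<CARD('n)] (mat 1)"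

text \<open>
  \<open>R\<close> is \<open>O((u\<^sub>k - u\<^sub>k\<^sub>-\<^sub>1) / (u\<^sub>k\<^sub>+\<^sub>1 - u\<^sub>k))\<close>: the bound holds once the \<open>k\<close>-th ratio is large enough,
  irrespective of the other ratios.
\<close>

definition gap_remainder :: "nat \<Rightarrow> (real^'n::{finite,linorder} \<Rightarrow> 'n cmat) \<Rightarrow> bool" where
  "gap_remainder k R \<longleftrightarrow>
     (\<exists>M>0. \<exists>L. \<forall>u\<in>U_id. L \<le> gap_ratio k u \<longrightarrow>
        norm (R u) \<le> M * ((coord u k - coord u (k - 1)) / (coord u (k + 1) - coord u k)))"

text \<open>
  The expansion for \<open>\<Phi>\<close> with constant \<open>\<Phi>\<^sub>0\<close>, holding as all ratios tend to infinity.
  For \<open>n = 2\<close> there are no ratios, and the expansion is an identity on all of \<open>U_id\<close>.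
\<close>

definition has_gap_asymptotics ::
  "(real^'n::{finite,linorder} \<Rightarrow> 'n cmat) \<Rightarrow> 'n cmat \<Rightarrow> bool" where
  "has_gap_asymptotics \<Phi> \<Phi>\<^sub>0 \<longleftrightarrow>
     (\<exists>R. (\<forall>k\<in>{2..CARD('n) - 1}. gap_remainder k (R k)) \<and>
          (\<exists>L. \<forall>u\<in>U_id. (\<forall>k\<in>{2..CARD('n) - 1}. L \<le> gap_ratio k u) \<longrightarrow>
             \<Phi> u = Ad (leading_conj \<Phi>\<^sub>0 u) \<Phi>\<^sub>0 + (\<Sum>k=2..CARD('n) - 1. R k u)))"

text \<open>
  Real analyticity in several variables: near every point, \<open>f\<close> is the unordered sum of a power
  series over multi-indices \<open>\<alpha> :: 'n \<Rightarrow> nat\<close>.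
\<close>

definition real_analytic_on ::
  "(real^'n::finite \<Rightarrow> 'b::real_normed_vector) \<Rightarrow> (real^'n) set \<Rightarrow> bool" where
  "real_analytic_on f S \<longleftrightarrow>
     (\<forall>a\<in>S. \<exists>r>0. \<exists>c :: ('n \<Rightarrow> nat) \<Rightarrow> 'b. \<forall>x\<in>ball a r.
        ((\<lambda>\<alpha>. (\<Prod>i\<in>UNIV. (x $ i - a $ i) ^ \<alpha> i) *\<^sub>R c \<alpha>) has_sum f x) UNIV)"

end

theory Submission
  imports Defs
begin

text \<open>
  Write \<open>c = 1 / (2 \<pi> \<i>)\<close> and let \<open>*\<close> be the entrywise product of matrices. In an arbitrary direction \<open>\<eta>\<close> the
  isomonodromy equation reads \<open>d\<Phi> = c [\<Phi>, W * \<Phi>]\<close>, where \<open>W\<^sub>i\<^sub>j = (\<eta>\<^sub>i - \<eta>\<^sub>j) / (u\<^sub>i - u\<^sub>j)\<close> is the derivative of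
  \<open>log \<bar>u\<^sub>i - u\<^sub>j\<bar>\<close>. As \<open>W\<close> is real and symmetric, a Hermitian \<open>\<Phi>\<close> moves by commutators with skew-Hermitian
  matrices: it stays Hermitian and keeps its norm. All differential equations below are ordinary ones along
  lines, controlled by \<open>norm_growth\<close> and \<open>gronwall_norm\<close>.

  Existence. The vector fields of two directions commute; this is the Arnold relation between the forms
  \<open>dlog (u\<^sub>i - u\<^sub>j)\<close> (lemmas \<open>arnold\<close>, \<open>flatness\<close>, \<open>dL_commute\<close>). Hence \<open>\<Phi>(u + h) = (exp L\<^sub>h) \<Phi>(u)\<close>, the exponential
  of the Lie derivative, solves the equation near \<open>u\<close>. Its Taylor coefficients are polynomials in \<open>\<Phi>(u)\<close> and in
  the numbers \<open>1 / (u\<^sub>i - u\<^sub>j)\<close> that grow only geometrically, so the series is analytic, with a radius that depends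
  only on bounds for these quantities. The norm being preserved, the local solutions continue along the convex
  set \<open>U_id\<close> to a global one (\<open>global_solution\<close>). A function that is only known to satisfy the equation for
  the partial derivatives agrees with such a solution along paths parallel to the axes, hence everywhere.

  Asymptotics. Let \<open>s\<^sub>1 = log (u\<^sub>2 - u\<^sub>1)\<close> and let \<open>s\<^sub>k\<close> be the logarithm of the \<open>k\<close>-th gap ratio. Changing \<open>s\<^sub>k\<close>
  alone dilates the points above \<open>u\<^sub>k\<close> around \<open>u\<^sub>k\<close>, and the equation becomes
  \<open>\<partial>\<^sub>k \<Phi> = c [\<delta>\<^sub>k \<Phi> + \<epsilon> * \<Phi>, \<Phi>]\<close> with \<open>\<epsilon>\<^sub>i\<^sub>j = (u\<^sub>k - u\<^sub>i) / (u\<^sub>j - u\<^sub>i)\<close> for \<open>i < k < j\<close>, which is of size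
  \<open>exp (- s\<^sub>k)\<close> (\<open>wmat_dvec\<close>, \<open>solution_deriv_s\<close>). Without \<open>\<epsilon>\<close> this system is solved exactly by the leading
  term of the expansion (\<open>model_deriv\<close>), because \<open>\<delta>\<^sub>k\<close> is constant along its \<open>k\<close>-th flow.

  The core is the comparison of a solution with another solution or with the leading term (\<open>comparison\<close>).
  Start at a point \<open>S\<close> far out and lower the coordinates to \<open>s\<close> one after the other, \<open>s\<^sub>n\<^sub>-\<^sub>1\<close> first and \<open>s\<^sub>2\<close> last.
  While \<open>s\<^sub>k\<close> moves, the difference \<open>D\<close> changes at the rate \<open>\<bar>\<delta>\<^sub>k D\<bar> + exp (- s\<^sub>k)\<close> up to rotations. The point is
  that \<open>\<delta>\<^sub>k D\<close> is itself of size \<open>exp (- s\<^sub>k)\<close> there: on the earlier stretches, where \<open>s\<^sub>k\<close> still has its large value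
  \<open>S\<^sub>k\<close>, the block \<open>\<delta>\<^sub>k \<Phi>\<close> sees only differences of entries of \<open>\<epsilon>\<close> within a column, and these carry an additional factor
  \<open>exp (- S\<^sub>k)\<close> (\<open>eps_diff_bound\<close>). So the error is \<open>\<Sum> exp (- s\<^sub>k)\<close>, with no logarithmic loss and uniformly in \<open>S\<close>.

  Everything else is compactness. Matching a given solution with leading terms at points \<open>S\<close> tending to
  infinity, a subsequence of the constants converges to \<open>\<Phi>\<^sub>0\<close>, and the uniform bound passes to the limit; matching
  solutions with a given leading term in the same way gives the solution with prescribed \<open>\<Phi>\<^sub>0\<close>. The constant
  \<open>\<Phi>\<^sub>0\<close> is determined block by block (\<open>model_determines\<close>). Two solutions with the same \<open>\<Phi>\<^sub>0\<close> have a difference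
  whose supremum over \<open>{s. s\<^sub>k \<ge> R}\<close> is, by the comparison, at most half of itself for large \<open>R\<close>; so it is 0.
\<close>

section \<open>Matrices with the Frobenius norm, and two estimates for differential equations\<close>

lemma matrix_mult_nth: "(A ** B) $ i $ j = (\<Sum>l\<in>UNIV. A $ i $ l * B $ l $ j)"
  by (simp add: matrix_matrix_mult_def)

lemma bilinear_matrix_mult: "bilinear ((**) :: 'n::finite cmat \<Rightarrow> 'n cmat \<Rightarrow> 'n cmat)"
  by (auto simp: bilinear_def intro!: linearI
      simp: vec_eq_iff matrix_mult_nth algebra_simps sum.distrib scaleR_sum_right)

interpretation matmul: bounded_bilinear "(**) :: 'n::finite cmat \<Rightarrow> 'n cmat \<Rightarrow> 'n cmat"
  using bilinear_matrix_mult by (simp add: bilinear_conv_bounded_bilinear)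

lemma bilinear_hadamard: "bilinear ((*) :: 'n::finite cmat \<Rightarrow> 'n cmat \<Rightarrow> 'n cmat)"
  by (auto simp: bilinear_def intro!: linearI
      simp: vec_eq_iff algebra_simps)

interpretation had: bounded_bilinear "(*) :: 'n::finite cmat \<Rightarrow> 'n cmat \<Rightarrow> 'n cmat"
  using bilinear_hadamard by (simp add: bilinear_conv_bounded_bilinear)

lemma norm_nth_nth_le: "norm (A $ i $ j) \<le> norm (A :: 'n::finite cmat)"
  by (meson Finite_Cartesian_Product.norm_nth_le order_trans)

lemma norm_cmat_le_sum: "norm (A :: 'n::finite cmat) \<le> (\<Sum>i\<in>UNIV. \<Sum>j\<in>UNIV. norm (A $ i $ j))"
  unfolding norm_vec_def
  by (rule order_trans[OF L2_set_le_sum]) (auto intro!: sum_mono L2_set_le_sum simp: L2_set_nonneg)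

lemma norm_cmat_power2: "(norm (A :: 'n::finite cmat))\<^sup>2 = (\<Sum>i\<in>UNIV. \<Sum>j\<in>UNIV. (norm (A $ i $ j))\<^sup>2)"
  by (simp add: norm_vec_def L2_set_def sum_nonneg)

lemma norm_matrix_mult: "norm ((A :: 'n cmat) ** B) \<le> norm A * norm (B :: 'n::finite cmat)"
proof -
  have "(norm (A ** B))\<^sup>2 \<le> (\<Sum>i\<in>UNIV. \<Sum>j\<in>UNIV. (\<Sum>l\<in>UNIV. (norm (A $ i $ l))\<^sup>2) * (\<Sum>l\<in>UNIV. (norm (B $ l $ j))\<^sup>2))"
    unfolding norm_cmat_power2[of "A ** B"]
  proof (intro sum_mono)
    fix i j
    have "norm ((A ** B) $ i $ j) \<le> (\<Sum>l\<in>UNIV. norm (A $ i $ l) * norm (B $ l $ j))"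
      unfolding matrix_mult_nth by (rule order_trans[OF norm_sum]) (simp add: norm_mult)
    then have "(norm ((A ** B) $ i $ j))\<^sup>2 \<le> (\<Sum>l\<in>UNIV. norm (A $ i $ l) * norm (B $ l $ j))\<^sup>2"
      by (rule power_mono) simp
    also have "\<dots> \<le> (\<Sum>l\<in>UNIV. (norm (A $ i $ l))\<^sup>2) * (\<Sum>l\<in>UNIV. (norm (B $ l $ j))\<^sup>2)"
      by (rule Cauchy_Schwarz_ineq_sum)
    finally show "(norm ((A ** B) $ i $ j))\<^sup>2 \<le> (\<Sum>l\<in>UNIV. (norm (A $ i $ l))\<^sup>2) * (\<Sum>l\<in>UNIV. (norm (B $ l $ j))\<^sup>2)" .
  qed
  also have "\<dots> = (norm A)\<^sup>2 * (\<Sum>j\<in>UNIV. \<Sum>l\<in>UNIV. (norm (B $ l $ j))\<^sup>2)"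
    unfolding norm_cmat_power2[of A] sum_product by (simp add: sum_product sum_distrib_left sum_distrib_right)
  also have "(\<Sum>j\<in>UNIV. \<Sum>l\<in>UNIV. (norm (B $ l $ j))\<^sup>2) = (norm B)\<^sup>2"
    unfolding norm_cmat_power2[of B] by (rule sum.swap)
  finally show ?thesis
    by (simp add: power_mult_distrib[symmetric] power2_le_iff_abs_le)
qed

lemma norm_hadamard: "norm ((A :: 'n cmat) * B) \<le> norm A * norm (B :: 'n::finite cmat)"
proof -
  have "(norm (A * B))\<^sup>2 \<le> (\<Sum>i\<in>UNIV. \<Sum>j\<in>UNIV. (norm A)\<^sup>2 * (norm (B $ i $ j))\<^sup>2)"
    unfolding norm_cmat_power2[of "A * B"]
    by (intro sum_mono) (simp add: norm_mult power_mult_distrib mult_right_mono norm_nth_nth_le power_mono)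
  also have "\<dots> = (norm A * norm B)\<^sup>2"
    unfolding power_mult_distrib norm_cmat_power2[of B] by (simp add: sum_distrib_left)
  finally show ?thesis by (simp add: power2_le_iff_abs_le)
qed

lemma norm_hadamard_bound:
  assumes "\<And>i j. norm (A $ i $ j) \<le> r"
  shows "norm (A * B) \<le> r * norm (B :: 'n::finite cmat)"
proof -
  have r: "0 \<le> r" using assms norm_ge_zero order_trans by blast
  have "(norm (A * B))\<^sup>2 \<le> (\<Sum>i\<in>UNIV. \<Sum>j\<in>UNIV. r\<^sup>2 * (norm (B $ i $ j))\<^sup>2)"
    unfolding norm_cmat_power2[of "A * B"]
    by (intro sum_mono) (simp add: norm_mult power_mult_distrib mult_right_mono assms power_mono)
  also have "\<dots> = (r * norm B)\<^sup>2"
    unfolding power_mult_distrib norm_cmat_power2[of B] by (simp add: sum_distrib_left)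
  finally show ?thesis using r by (simp add: power2_le_iff_abs_le)
qed

definition dagger :: "'n::finite cmat \<Rightarrow> 'n cmat" where
  "dagger A = map_matrix cnj (transpose A)"

lemma dagger_nth [simp]: "dagger A $ i $ j = cnj (A $ j $ i)"
  by (simp add: dagger_def map_matrix_def transpose_def)

lemma hermitian_iff_dagger: "hermitian A \<longleftrightarrow> dagger A = A"
  by (simp add: hermitian_def dagger_def)

lemma cscale_nth [simp]: "cscale c A $ i $ j = c * A $ i $ j"
  by (simp add: cscale_def map_matrix_def)

lemma dagger_mult: "dagger (A ** B) = dagger B ** dagger A"
  by (simp add: vec_eq_iff matrix_mult_nth mult.commute)

lemma dagger_dagger [simp]: "dagger (dagger A) = A"
  by (simp add: vec_eq_iff)

lemma dagger_cscale: "dagger (cscale c A) = cscale (cnj c) (dagger A)"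
  by (simp add: vec_eq_iff)

lemma bounded_linear_dagger: "bounded_linear (dagger :: 'n::finite cmat \<Rightarrow> 'n cmat)"
  by (rule linear_conv_bounded_linear[THEN iffD1]) (auto intro!: linearI simp: vec_eq_iff)

lemma bounded_linear_cscale: "bounded_linear (cscale c :: 'n::finite cmat \<Rightarrow> 'n cmat)"
  by (rule linear_conv_bounded_linear[THEN iffD1]) (auto intro!: linearI simp: vec_eq_iff algebra_simps)

lemma cscale_mult_left: "cscale c A ** B = cscale c (A ** B)"
  and cscale_mult_right: "A ** cscale c B = cscale c (A ** B)"
  by (simp_all add: vec_eq_iff matrix_mult_nth sum_distrib_left algebra_simps)

lemma cscale_eq_had: "cscale c A = (\<chi> i j. c) * A"
  by (simp add: vec_eq_iff)

lemma norm_cscale: "norm (cscale c A) = norm c * norm (A :: 'n::finite cmat)"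
proof -
  have "(norm (cscale c A))\<^sup>2 = (norm c * norm A)\<^sup>2"
    unfolding norm_cmat_power2 power_mult_distrib by (simp add: norm_mult power_mult_distrib sum_distrib_left)
  then show ?thesis by (metis norm_ge_zero power2_eq_imp_eq mult_nonneg_nonneg)
qed

lemma inner_cmat: "inner A (B :: 'n::finite cmat) = (\<Sum>i\<in>UNIV. \<Sum>j\<in>UNIV. Re (cnj (A $ i $ j) * B $ i $ j))"
  by (simp add: inner_vec_def inner_complex_def)

lemma inner_mult_left: "inner (A ** (X :: 'n cmat)) Y = inner X (dagger A ** (Y :: 'n::finite cmat))"
proof -
  have "inner (A ** X) Y = (\<Sum>i\<in>UNIV. \<Sum>j\<in>UNIV. \<Sum>l\<in>UNIV. Re (cnj (A $ i $ l * X $ l $ j) * Y $ i $ j))"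
    by (simp only: inner_cmat matrix_mult_nth cnj_sum sum_distrib_right Re_sum)
  also have "\<dots> = (\<Sum>i\<in>UNIV. \<Sum>l\<in>UNIV. \<Sum>j\<in>UNIV. Re (cnj (A $ i $ l * X $ l $ j) * Y $ i $ j))"
    by (intro sum.cong refl sum.swap)
  also have "\<dots> = (\<Sum>l\<in>UNIV. \<Sum>i\<in>UNIV. \<Sum>j\<in>UNIV. Re (cnj (A $ i $ l * X $ l $ j) * Y $ i $ j))"
    by (rule sum.swap)
  also have "\<dots> = (\<Sum>l\<in>UNIV. \<Sum>j\<in>UNIV. \<Sum>i\<in>UNIV. Re (cnj (A $ i $ l * X $ l $ j) * Y $ i $ j))"
    by (intro sum.cong refl sum.swap)
  also have "\<dots> = inner X (dagger A ** Y)"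
    by (simp only: inner_cmat matrix_mult_nth sum_distrib_left Re_sum dagger_nth complex_cnj_mult mult.assoc mult.left_commute)
  finally show ?thesis .
qed

lemma inner_dagger: "inner (dagger A) (dagger B) = inner A (B :: 'n::finite cmat)"
  unfolding inner_cmat by (subst sum.swap) (simp add: algebra_simps)

lemma inner_mult_right: "inner ((X :: 'n cmat) ** A) Y = inner X (Y ** dagger (A :: 'n::finite cmat))"
  using inner_mult_left[of "dagger A" "dagger X" "dagger Y"] inner_dagger[of "X ** A" Y]
    inner_dagger[of X "Y ** dagger A"]
  by (simp add: dagger_mult)

text \<open>
  The skew-Hermitian matrices act by commutators as infinitesimal isometries.
\<close>

lemma inner_ad_skew:
  assumes "dagger K = - K"
  shows "inner D (ad K D) = (0 :: real)"
proof -
  have "inner D (K ** D) = - inner D (K ** D)"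
    using inner_mult_left[of K D D] assms by (simp add: inner_commute matmul.minus_left)
  moreover have "inner D (D ** K) = - inner D (D ** K)"
    using inner_mult_right[of D K D] assms by (simp add: inner_commute matmul.minus_right)
  ultimately show ?thesis by (simp add: ad_def inner_diff_right)
qed

definition c0 :: complex where "c0 = 1 / (2 * of_real pi * \<i>)"

lemma cnj_c0: "cnj c0 = - c0" by (simp add: c0_def)
lemma norm_c0: "norm c0 \<le> 1"
proof -
  have "norm c0 = 1 / (2 * pi)" by (simp add: c0_def norm_divide norm_mult)
  also have "\<dots> \<le> 1" using pi_gt3 by (simp add: divide_simps)
  finally show ?thesis .
qed

lemma inner_c0_ad:
  assumes "hermitian H"
  shows "inner D (cscale c0 (ad H D)) = (0 :: real)"
proof -
  have "cscale c0 (ad H D) = ad (cscale c0 H) D"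
    unfolding ad_def cscale_mult_left cscale_mult_right
    by (simp add: vec_eq_iff algebra_simps)
  moreover have "dagger (cscale c0 H) = - cscale c0 H"
    using assms unfolding dagger_cscale cnj_c0 hermitian_iff_dagger by (simp add: vec_eq_iff)
  ultimately show ?thesis by (simp add: inner_ad_skew)
qed

lemma ad_antisym: "ad Y X = - ad X Y" by (simp add: ad_def)

lemma bilinear_ad: "bilinear (ad :: 'n::finite cmat \<Rightarrow> 'n cmat \<Rightarrow> 'n cmat)"
  by (auto simp: bilinear_def ad_def intro!: linearI
      simp: matmul.add_left matmul.add_right matmul.scaleR_left matmul.scaleR_right algebra_simps)

interpretation ad: bounded_bilinear "ad :: 'n::finite cmat \<Rightarrow> 'n cmat \<Rightarrow> 'n cmat"
  using bilinear_ad by (simp add: bilinear_conv_bounded_bilinear)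

lemma norm_ad: "norm (ad A B) \<le> 2 * norm A * norm (B :: 'n::finite cmat)"
  unfolding ad_def
  using norm_triangle_ineq4[of "A ** B" "B ** A"] norm_matrix_mult[of A B] norm_matrix_mult[of B A]
  by (simp add: algebra_simps)

text \<open>
  The part \<open>A\<close> is orthogonal to \<open>f\<close> and rotates it, so only \<open>r\<close> changes the length. For the equations below, \<open>A\<close> is a
  commutator of \<open>f\<close> with a skew-Hermitian matrix.
\<close>

lemma norm_growth:
  fixes f :: "real \<Rightarrow> 'a::real_inner"
  assumes ab: "a \<le> b"
    and f: "\<And>x. a \<le> x \<Longrightarrow> x \<le> b \<Longrightarrow> (f has_vector_derivative A x + r x) (at x)"
    and orth: "\<And>x. a \<le> x \<Longrightarrow> x \<le> b \<Longrightarrow> inner (f x) (A x) = 0"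
    and \<phi>: "\<And>x. a \<le> x \<Longrightarrow> x \<le> b \<Longrightarrow> (\<phi> has_real_derivative \<phi>' x) (at x)"
    and bnd: "\<And>x. a \<le> x \<Longrightarrow> x \<le> b \<Longrightarrow> norm (r x) \<le> \<phi>' x"
  shows "\<bar>norm (f b) - norm (f a)\<bar> \<le> \<phi> b - \<phi> a"
proof -
  have orth': "inner (A x) (f x) = 0" if "a \<le> x" "x \<le> b" for x
    using orth[OF that] by (simp add: inner_commute)
  (* The norm of f need not be differentiable at zeros of f; the square root is regularized by e > 0. *)
  have main: "\<bar>sqrt ((norm (f b))\<^sup>2 + e\<^sup>2) - sqrt ((norm (f a))\<^sup>2 + e\<^sup>2)\<bar> \<le> \<phi> b - \<phi> a" if e: "e > 0" for e
  proof -
    define g where "g = (\<lambda>x. sqrt (inner (f x) (f x) + e\<^sup>2))"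
    define g' where "g' = (\<lambda>x. inner (f x) (r x) / g x)"
    have pos: "inner (f x) (f x) + e\<^sup>2 > 0" for x
      using e by (simp add: add_nonneg_pos)
    have g': "(g has_real_derivative g' x) (at x)" if x: "a \<le> x" "x \<le> b" for x
    proof -
      have "((\<lambda>x. inner (f x) (f x)) has_vector_derivative (inner (f x) (A x + r x) + inner (A x + r x) (f x))) (at x)"
        by (rule bounded_bilinear.has_vector_derivative[OF bounded_bilinear_inner f[OF x] f[OF x]])
      then have "((\<lambda>x. inner (f x) (f x)) has_real_derivative 2 * inner (f x) (r x)) (at x)"
        by (simp add: has_real_derivative_iff_has_vector_derivative inner_add_left inner_add_right orth[OF x] orth'[OF x] inner_commute[of "r x"])
      then show ?thesis unfolding g_def g'_def
        using pos[of x] by (auto intro!: derivative_eq_intros simp: divide_simps)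
    qed
    have bd: "norm (g' x) \<le> \<phi>' x" if x: "a \<le> x" "x \<le> b" for x
    proof -
      have fg: "norm (f x) \<le> g x"
        unfolding g_def norm_eq_sqrt_inner by simp
      have gpos: "g x > 0" unfolding g_def using pos by simp
      have "\<bar>inner (f x) (r x)\<bar> \<le> norm (f x) * norm (r x)" by (rule Cauchy_Schwarz_ineq2)
      also have "\<dots> \<le> g x * \<phi>' x"
        using fg bnd[OF x] gpos by (intro mult_mono) auto
      finally show ?thesis unfolding g'_def using gpos by (simp add: abs_div divide_simps mult.commute)
    qed
    have "norm (g b - g a) \<le> \<phi> b - \<phi> a"
    proof (cases "a = b")
      case False
      show ?thesis
      proof (rule differentiable_bound_general[where f' = g' and \<phi>' = \<phi>'])
        show "a < b" using ab False by simp
        show "continuous_on {a..b} g"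
          by (intro continuous_at_imp_continuous_on ballI DERIV_isCont[OF g']) auto
        show "continuous_on {a..b} \<phi>"
          by (intro continuous_at_imp_continuous_on ballI DERIV_isCont[OF \<phi>]) auto
      qed (auto simp: has_real_derivative_iff_has_vector_derivative[symmetric] g' \<phi> bd simp del: real_norm_def)
    qed simp
    then show ?thesis by (simp add: g_def power2_norm_eq_inner)
  qed
  have lim: "((\<lambda>e. \<bar>sqrt ((norm (f b))\<^sup>2 + e\<^sup>2) - sqrt ((norm (f a))\<^sup>2 + e\<^sup>2)\<bar>) \<longlongrightarrow>
      \<bar>sqrt ((norm (f b))\<^sup>2 + 0\<^sup>2) - sqrt ((norm (f a))\<^sup>2 + 0\<^sup>2)\<bar>) (at_right 0)"
    by (intro tendsto_intros)
  have "\<bar>sqrt ((norm (f b))\<^sup>2 + 0\<^sup>2) - sqrt ((norm (f a))\<^sup>2 + 0\<^sup>2)\<bar> \<le> \<phi> b - \<phi> a"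
    by (rule tendsto_upperbound[OF lim]) (auto simp: eventually_at_right_less intro!: eventually_mono[OF eventually_at_right_less[of 0]] main)
  then show ?thesis by simp
qed

text \<open>
  The function \<open>exp (- 2 * M * x) * (norm (f x))\<^sup>2\<close> is nonincreasing.
\<close>

lemma gronwall_norm:
  fixes f :: "real \<Rightarrow> 'a::real_inner"
  assumes ab: "a \<le> b"
    and f: "\<And>x. a \<le> x \<Longrightarrow> x \<le> b \<Longrightarrow> (f has_vector_derivative f' x) (at x)"
    and bnd: "\<And>x. a \<le> x \<Longrightarrow> x \<le> b \<Longrightarrow> norm (f' x) \<le> M * norm (f x)"
  shows "norm (f b) \<le> exp (M * (b - a)) * norm (f a)"
proof -
  define g where "g = (\<lambda>x. exp (- 2 * M * x) * inner (f x) (f x))"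
  have g': "(g has_real_derivative exp (- 2 * M * x) * (2 * inner (f x) (f' x)) - 2 * M * exp (- 2 * M * x) * inner (f x) (f x)) (at x)"
    if x: "a \<le> x" "x \<le> b" for x
  proof -
    have "((\<lambda>x. inner (f x) (f x)) has_vector_derivative (inner (f x) (f' x) + inner (f' x) (f x))) (at x)"
      by (rule bounded_bilinear.has_vector_derivative[OF bounded_bilinear_inner f[OF x] f[OF x]])
    then have "((\<lambda>x. inner (f x) (f x)) has_real_derivative 2 * inner (f x) (f' x)) (at x)"
      by (simp add: has_real_derivative_iff_has_vector_derivative inner_commute)
    then show ?thesis unfolding g_def
      by (auto intro!: derivative_eq_intros)
  qed
  have le: "exp (- 2 * M * x) * (2 * inner (f x) (f' x)) - 2 * M * exp (- 2 * M * x) * inner (f x) (f x) \<le> 0"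
    if x: "a \<le> x" "x \<le> b" for x
  proof -
    have "inner (f x) (f' x) \<le> norm (f x) * norm (f' x)" by (rule norm_cauchy_schwarz)
    also have "\<dots> \<le> norm (f x) * (M * norm (f x))" by (intro mult_left_mono bnd x) auto
    also have "\<dots> = M * inner (f x) (f x)" by (simp add: power2_norm_eq_inner[symmetric] power2_eq_square)
    finally have "exp (- 2 * M * x) * inner (f x) (f' x) \<le> exp (- 2 * M * x) * (M * inner (f x) (f x))"
      by (intro mult_left_mono) auto
    then show ?thesis by (simp add: algebra_simps)
  qed
  have "g b \<le> g a"
    by (rule DERIV_nonpos_imp_nonincreasing[OF ab]) (use g' le in blast)
  then have "inner (f b) (f b) \<le> exp (2 * M * b) * (exp (- 2 * M * a) * inner (f a) (f a))"
    unfolding g_def by (simp add: exp_minus field_simps)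
  also have "\<dots> = (exp (M * (b - a)) * norm (f a))\<^sup>2"
  proof -
    have "exp (2 * M * b) * exp (- 2 * M * a) = (exp (M * (b - a)))\<^sup>2"
      by (simp add: power2_eq_square exp_add[symmetric] algebra_simps)
    then show ?thesis by (simp add: power_mult_distrib power2_norm_eq_inner)
  qed
  finally show ?thesis
    by (simp add: power2_norm_eq_inner[symmetric] power2_le_iff_abs_le)
qed

section \<open>The isomonodromy equation along straight lines\<close>

text \<open>
  The product \<open>*\<close> of matrices is the entrywise one. Because \<open>inverse 0 = 0\<close>, the diagonal of \<open>pmat u\<close> is zero, and
  \<open>wmat u \<eta>\<close> is the matrix of the derivatives of \<open>log \<bar>u\<^sub>i - u\<^sub>j\<bar>\<close> in direction \<open>\<eta>\<close>. The partial derivative prescribed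
  by the isomonodromy equation is \<open>iso_field u (axis k 1)\<close>.
\<close>

definition pmat :: "real^'n::finite \<Rightarrow> 'n cmat" where
  "pmat u = (\<chi> i j. inverse (of_real (u $ i - u $ j)))"

definition dmat :: "real^'n::finite \<Rightarrow> 'n cmat" where
  "dmat \<eta> = (\<chi> i j. of_real (\<eta> $ i - \<eta> $ j))"

definition wmat :: "real^'n::finite \<Rightarrow> real^'n \<Rightarrow> 'n cmat" where
  "wmat u \<eta> = dmat \<eta> * pmat u"

definition iso_field :: "real^'n::finite \<Rightarrow> real^'n \<Rightarrow> 'n cmat \<Rightarrow> 'n cmat" where
  "iso_field u \<eta> X = cscale c0 (ad X (wmat u \<eta> * X))"

lemma pmat_nth [simp]: "pmat u $ i $ j = inverse (of_real (u $ i - u $ j))"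
  by (simp add: pmat_def)
lemma dmat_nth [simp]: "dmat u $ i $ j = of_real (u $ i - u $ j)"
  by (simp add: dmat_def)
lemma wmat_nth [simp]: "wmat u \<eta> $ i $ j = of_real ((\<eta> $ i - \<eta> $ j) / (u $ i - u $ j))"
  by (simp add: wmat_def divide_inverse)

lemma U_id_iff: "u \<in> U_id \<longleftrightarrow> (\<forall>i j. i < j \<longrightarrow> u $ i < u $ j)"
  by (auto simp: U_id_def strict_mono_def)

lemma inj_U_id: "u \<in> U_id \<Longrightarrow> inj (vec_nth u)"
  by (simp add: U_id_def strict_mono_imp_inj_on)

lemma open_U_id: "open (U_id :: (real^'n::{finite,linorder}) set)"
proof -
  have "U_id = (\<Inter>i. \<Inter>j\<in>{i<..}. {u :: real^'n::{finite,linorder}. u $ i < u $ j})"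
    by (auto simp: U_id_iff)
  also have "open \<dots>"
    by (intro open_INT finite ballI open_Collect_less continuous_intros)
  finally show ?thesis .
qed

lemma convex_U_id: "convex (U_id :: (real^'n::{finite,linorder}) set)"
proof -
  have "U_id = (\<Inter>i. \<Inter>j\<in>{i<..}. {u :: real^'n::{finite,linorder}. inner (axis i 1 - axis j 1) u < 0})"
    by (auto simp: U_id_iff inner_diff_left inner_axis')
  also have "convex \<dots>"
    by (intro convex_INT convex_halfspace_lt)
  finally show ?thesis .
qed

text \<open>
  Entrywise, the inverse of \<open>ad (diag_mat u)\<close> divides by \<open>u\<^sub>i - u\<^sub>j\<close>.
\<close>

lemma ad_inv_ad_E_mat:
  assumes "u \<in> U_id"
  shows "ad_inv u (ad (E_mat k) X) = wmat u (axis k 1) * X"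
  unfolding ad_inv_def
proof (rule the_inv_into_f_eq)
  show "inj_on (ad (diag_mat u)) off_diagonal"
    using bij_ad_off_diagonal[OF inj_U_id[OF assms]] by (simp add: bij_betw_def)
  show "wmat u (axis k 1) * X \<in> off_diagonal"
    by (simp add: off_diagonal_def)
  show "ad (diag_mat u) (wmat u (axis k 1) * X) = ad (E_mat k) X"
    using inj_U_id[OF assms] by (auto simp: vec_eq_iff E_mat_def ad_diag_mat_nth inj_def)
qed

lemma isomonodromy_solution_iff:
  "isomonodromy_solution \<Phi> \<longleftrightarrow>
    (\<forall>u\<in>U_id. \<forall>k. ((\<lambda>t. \<Phi> (u + t *\<^sub>R axis k 1)) has_vector_derivative iso_field u (axis k 1) (\<Phi> u)) (at 0))"
  by (simp add: isomonodromy_solution_def iso_field_def c0_def[symmetric] ad_inv_ad_E_mat cong: ball_cong)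

lemma dagger_wmat_had: "dagger (wmat u \<eta> * X) = wmat u \<eta> * dagger X"
proof -
  have "(\<eta> $ j - \<eta> $ i) / (u $ j - u $ i) = (\<eta> $ i - \<eta> $ j) / (u $ i - u $ j)" for i j
    by (metis minus_diff_eq minus_divide_divide)
  then show ?thesis by (simp add: vec_eq_iff del: of_real_divide of_real_diff)
qed

lemma dagger_ad: "dagger (ad X Y) = ad (dagger Y) (dagger X)"
  unfolding ad_def by (simp add: linear_diff[OF bounded_linear.linear[OF bounded_linear_dagger]] dagger_mult)

text \<open>
  The matrix \<open>wmat u \<eta>\<close> is real and symmetric and \<open>c0\<close> is imaginary. Consequently the adjoint of a solution is
  again a solution, and by uniqueness a solution that is Hermitian at one point is Hermitian everywhere.
\<close>

lemma dagger_iso_field: "dagger (iso_field u \<eta> X) = iso_field u \<eta> (dagger X)"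
  unfolding iso_field_def dagger_cscale cnj_c0 dagger_ad dagger_wmat_had
  by (subst ad_antisym) (simp add: vec_eq_iff)

text \<open>
  This makes the norm of a Hermitian solution constant.
\<close>

lemma inner_iso_field:
  assumes "hermitian X" shows "inner X (iso_field u \<eta> X) = 0"
proof -
  have "hermitian (wmat u \<eta> * X)"
    using assms by (simp add: hermitian_iff_dagger dagger_wmat_had)
  then have "inner X (cscale c0 (ad (wmat u \<eta> * X) X)) = 0" by (rule inner_c0_ad)
  then show ?thesis unfolding iso_field_def
    by (subst ad_antisym) (simp add: linear_neg[OF bounded_linear.linear[OF bounded_linear_cscale]])
qed

lemma norm_cscale_c0_le: "norm (cscale c0 A) \<le> norm (A :: 'n::finite cmat)"
  using mult_right_mono[OF norm_c0 norm_ge_zero[of A]] by (simp add: norm_cscale del: One_nat_def)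

lemma norm_ad_had_diff:
  "norm (ad X (W * X) - ad Y (W * Y)) \<le> 2 * norm W * (norm X + norm Y) * norm (X - Y :: 'n::finite cmat)"
proof -
  have eq: "ad X (W * X) - ad Y (W * Y) = ad (X - Y) (W * X) + ad Y (W * (X - Y))"
    by (simp add: ad.diff_left ad.diff_right algebra_simps)
  have "norm (ad (X - Y) (W * X)) \<le> 2 * norm (X - Y) * (norm W * norm X)"
    by (rule order_trans[OF norm_ad]) (simp add: mult_left_mono norm_hadamard)
  moreover have "norm (ad Y (W * (X - Y))) \<le> 2 * norm Y * (norm W * norm (X - Y))"
    by (rule order_trans[OF norm_ad]) (simp add: mult_left_mono norm_hadamard)
  ultimately show ?thesis unfolding eq
    by (intro order_trans[OF norm_triangle_ineq]) (simp add: algebra_simps)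
qed

lemma norm_iso_field_diff:
  "norm (iso_field u \<eta> X - iso_field u \<eta> Y) \<le> 2 * norm (wmat u \<eta>) * (norm X + norm Y) * norm (X - Y)"
proof -
  have "iso_field u \<eta> X - iso_field u \<eta> Y = cscale c0 (ad X (wmat u \<eta> * X) - ad Y (wmat u \<eta> * Y))"
    unfolding iso_field_def by (simp add: linear_diff[OF bounded_linear.linear[OF bounded_linear_cscale]])
  then show ?thesis
    using order_trans[OF norm_cscale_c0_le norm_ad_had_diff] by metis
qed

definition solves_along :: "real^'n::finite \<Rightarrow> real^'n \<Rightarrow> (real \<Rightarrow> 'n cmat) \<Rightarrow> bool" where
  "solves_along u \<eta> f \<longleftrightarrow>
     (\<forall>t\<in>{0..1}. (f has_vector_derivative iso_field (u + t *\<^sub>R \<eta>) \<eta> (f t)) (at t))"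

text \<open>
  The bound is explicit because it also gives the continuous dependence on the value at \<open>0\<close> that passes to limits of
  solutions.
\<close>

lemma solves_along_gronwall:
  assumes f: "solves_along u \<eta> f" and g: "solves_along u \<eta> g"
    and M: "\<And>t. t \<in> {0..1} \<Longrightarrow> 2 * norm (wmat (u + t *\<^sub>R \<eta>) \<eta>) * (norm (f t) + norm (g t)) \<le> M"
  shows "norm (f 1 - g 1) \<le> exp M * norm (f 0 - g 0)"
proof -
  have "norm (f 1 - g 1) \<le> exp (M * (1 - 0)) * norm (f 0 - g 0)"
  proof (rule gronwall_norm[where f = "\<lambda>t. f t - g t"])
    fix t :: real assume t: "0 \<le> t" "t \<le> 1"
    show "((\<lambda>t. f t - g t) has_vector_derivative
        iso_field (u + t *\<^sub>R \<eta>) \<eta> (f t) - iso_field (u + t *\<^sub>R \<eta>) \<eta> (g t)) (at t)"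
      using t f g by (auto simp: solves_along_def intro!: has_vector_derivative_diff)
    show "norm (iso_field (u + t *\<^sub>R \<eta>) \<eta> (f t) - iso_field (u + t *\<^sub>R \<eta>) \<eta> (g t)) \<le> M * norm (f t - g t)"
      using M[of t] t by (intro order_trans[OF norm_iso_field_diff] mult_right_mono) auto
  qed simp
  then show ?thesis by simp
qed

lemma continuous_on_wmat:
  assumes "\<And>t. t \<in> T \<Longrightarrow> inj (vec_nth (u + t *\<^sub>R \<eta>))"
  shows "continuous_on T (\<lambda>t. wmat (u + t *\<^sub>R \<eta>) \<eta>)"
proof -
  have "continuous_on T (\<lambda>t. complex_of_real ((\<eta> $ i - \<eta> $ j) / ((u + t *\<^sub>R \<eta>) $ i - (u + t *\<^sub>R \<eta>) $ j)))" for i j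
  proof (cases "i = j")
    case False
    then have "(u + t *\<^sub>R \<eta>) $ i - (u + t *\<^sub>R \<eta>) $ j \<noteq> 0" if "t \<in> T" for t
      using assms[OF that] by (meson injD right_minus_eq)
    then show ?thesis by (intro continuous_intros) auto
  qed auto
  then have "continuous_on T (\<lambda>t. \<chi> i j. complex_of_real ((\<eta> $ i - \<eta> $ j) / ((u + t *\<^sub>R \<eta>) $ i - (u + t *\<^sub>R \<eta>) $ j)))"
    by (intro continuous_on_vec_lambda)
  moreover have "(\<chi> i j. complex_of_real ((\<eta> $ i - \<eta> $ j) / ((u + t *\<^sub>R \<eta>) $ i - (u + t *\<^sub>R \<eta>) $ j))) = wmat (u + t *\<^sub>R \<eta>) \<eta>" for t
    by (simp add: vec_eq_iff)
  ultimately show ?thesis by simp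
qed

lemma segment_U_id:
  assumes "u \<in> U_id" "u + \<eta> \<in> U_id" "t \<in> {0..1}"
  shows "u + t *\<^sub>R \<eta> \<in> U_id"
proof -
  have "(1 - t) *\<^sub>R u + t *\<^sub>R (u + \<eta>) \<in> U_id"
    using assms by (intro convexD[OF convex_U_id]) auto
  then show ?thesis by (simp add: algebra_simps)
qed

lemma solves_along_unique:
  assumes u: "u \<in> U_id" "u + \<eta> \<in> U_id"
    and f: "solves_along u \<eta> f" and g: "solves_along u \<eta> g" and eq: "f 0 = g 0"
  shows "f 1 = g 1"
proof -
  have cf: "continuous_on {0..1} f" and cg: "continuous_on {0..1} g"
    using f g by (auto simp: solves_along_def intro!: continuous_at_imp_continuous_on has_vector_derivative_continuous)
  have "continuous_on {0..1} (\<lambda>t. 2 * norm (wmat (u + t *\<^sub>R \<eta>) \<eta>) * (norm (f t) + norm (g t)))"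
    by (intro continuous_intros continuous_on_wmat cf cg inj_U_id segment_U_id u)
  then have "bounded ((\<lambda>t. 2 * norm (wmat (u + t *\<^sub>R \<eta>) \<eta>) * (norm (f t) + norm (g t))) ` {0..1})"
    by (intro compact_imp_bounded compact_continuous_image) auto
  then obtain M where M: "\<forall>x\<in>(\<lambda>t. 2 * norm (wmat (u + t *\<^sub>R \<eta>) \<eta>) * (norm (f t) + norm (g t))) ` {0..1}. norm x \<le> M"
    unfolding bounded_iff by blast
  have "2 * norm (wmat (u + t *\<^sub>R \<eta>) \<eta>) * (norm (f t) + norm (g t)) \<le> M" if "t \<in> {0..1}" for t
    using bspec[OF M imageI[OF that]] by simp
  from solves_along_gronwall[OF f g this] show ?thesis by (simp add: eq)
qed

lemma solves_along_dagger:
  assumes "solves_along u \<eta> f" shows "solves_along u \<eta> (\<lambda>t. dagger (f t))"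
  using assms bounded_linear.has_vector_derivative[OF bounded_linear_dagger]
  by (fastforce simp: solves_along_def dagger_iso_field[symmetric])

lemma solves_along_hermitian:
  assumes "u \<in> U_id" "u + \<eta> \<in> U_id" "solves_along u \<eta> f" "hermitian (f 0)"
  shows "hermitian (f 1)"
  using solves_along_unique[OF assms(1-2) solves_along_dagger[OF assms(3)] assms(3)] assms(4)
  by (simp add: hermitian_iff_dagger)

text \<open>
  With the derivative prescribed in every direction, two points of a convex set are joined by a segment along
  which the ordinary differential equation applies.
\<close>

definition solution_on :: "(real^'n::finite) set \<Rightarrow> (real^'n \<Rightarrow> 'n cmat) \<Rightarrow> bool" where
  "solution_on C \<Phi> \<longleftrightarrow>
     (\<forall>u\<in>C. \<forall>\<eta>. ((\<lambda>t. \<Phi> (u + t *\<^sub>R \<eta>)) has_vector_derivative iso_field u \<eta> (\<Phi> u)) (at 0))"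

lemma has_vector_derivative_shift:
  fixes f :: "real^'n \<Rightarrow> 'b::real_normed_vector"
  assumes "((\<lambda>s. f ((u + t *\<^sub>R \<eta>) + s *\<^sub>R \<eta>)) has_vector_derivative y) (at 0)"
  shows "((\<lambda>t. f (u + t *\<^sub>R \<eta>)) has_vector_derivative y) (at t)"
proof -
  have "((\<lambda>s. f ((u + t *\<^sub>R \<eta>) + s *\<^sub>R \<eta>)) \<circ> (\<lambda>x. x - t) has_vector_derivative 1 *\<^sub>R y) (at t)"
    by (rule vector_diff_chain_at) (auto intro!: derivative_eq_intros assms simp: )
  moreover have "(\<lambda>s. f ((u + t *\<^sub>R \<eta>) + s *\<^sub>R \<eta>)) \<circ> (\<lambda>x. x - t) = (\<lambda>t. f (u + t *\<^sub>R \<eta>))"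
    by (auto simp: fun_eq_iff algebra_simps)
  ultimately show ?thesis by simp
qed

lemma solution_on_deriv:
  assumes "solution_on C \<Phi>" "u + t *\<^sub>R \<eta> \<in> C"
  shows "((\<lambda>t. \<Phi> (u + t *\<^sub>R \<eta>)) has_vector_derivative iso_field (u + t *\<^sub>R \<eta>) \<eta> (\<Phi> (u + t *\<^sub>R \<eta>))) (at t)"
  by (rule has_vector_derivative_shift) (rule assms(1)[unfolded solution_on_def, rule_format, OF assms(2)])

lemma solution_on_solves_along:
  assumes "solution_on C \<Phi>" "convex C" "u \<in> C" "u + \<eta> \<in> C"
  shows "solves_along u \<eta> (\<lambda>t. \<Phi> (u + t *\<^sub>R \<eta>))"
  unfolding solves_along_def
proof
  fix t :: real assume t: "t \<in> {0..1}"
  have "(1 - t) *\<^sub>R u + t *\<^sub>R (u + \<eta>) \<in> C"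
    using assms t by (intro convexD[OF assms(2)]) auto
  then have "u + t *\<^sub>R \<eta> \<in> C" by (simp add: algebra_simps)
  from solution_on_deriv[OF assms(1) this]
  show "((\<lambda>t. \<Phi> (u + t *\<^sub>R \<eta>)) has_vector_derivative iso_field (u + t *\<^sub>R \<eta>) \<eta> (\<Phi> (u + t *\<^sub>R \<eta>))) (at t)" .
qed

lemma solution_on_unique:
  assumes "solution_on C \<Phi>" "solution_on C \<Psi>" "convex C" "C \<subseteq> U_id"
    and "u \<in> C" "\<Phi> u = \<Psi> u" "v \<in> C"
  shows "\<Phi> v = \<Psi> v"
  using solves_along_unique[of u "v - u" "\<lambda>t. \<Phi> (u + t *\<^sub>R (v - u))" "\<lambda>t. \<Psi> (u + t *\<^sub>R (v - u))"]
    solution_on_solves_along[of C _ u "v - u"] assms by auto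

lemma solution_on_hermitian:
  assumes "solution_on C \<Phi>" "convex C" "C \<subseteq> U_id" "u \<in> C" "hermitian (\<Phi> u)" "v \<in> C"
  shows "hermitian (\<Phi> v)"
  using solves_along_hermitian[of u "v - u" "\<lambda>t. \<Phi> (u + t *\<^sub>R (v - u))"]
    solution_on_solves_along[of C \<Phi> u "v - u"] assms by auto

lemma solution_on_norm:
  assumes "solution_on C \<Phi>" "convex C" "C \<subseteq> U_id" "u \<in> C" "hermitian (\<Phi> u)" "v \<in> C"
  shows "norm (\<Phi> v) = norm (\<Phi> u)"
proof -
  have seg: "u + t *\<^sub>R (v - u) \<in> C" if "t \<in> {0..1}" for t
  proof -
    have "(1 - t) *\<^sub>R u + t *\<^sub>R v \<in> C"
      using assms that by (intro convexD[OF assms(2)]) auto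
    then show ?thesis by (simp add: algebra_simps)
  qed
  have "\<bar>norm (\<Phi> (u + 1 *\<^sub>R (v - u))) - norm (\<Phi> (u + 0 *\<^sub>R (v - u)))\<bar> \<le> 0 - 0"
  proof (rule norm_growth[where r = "\<lambda>_. 0" and \<phi>' = "\<lambda>_. 0"
        and A = "\<lambda>t. iso_field (u + t *\<^sub>R (v - u)) (v - u) (\<Phi> (u + t *\<^sub>R (v - u)))"])
    fix t :: real assume t: "0 \<le> t" "t \<le> 1"
    show "inner (\<Phi> (u + t *\<^sub>R (v - u))) (iso_field (u + t *\<^sub>R (v - u)) (v - u) (\<Phi> (u + t *\<^sub>R (v - u)))) = 0"
      using t by (intro inner_iso_field solution_on_hermitian[OF assms(1-5)] seg) auto
    show "((\<lambda>t. \<Phi> (u + t *\<^sub>R (v - u))) has_vector_derivative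
        iso_field (u + t *\<^sub>R (v - u)) (v - u) (\<Phi> (u + t *\<^sub>R (v - u))) + 0) (at t)"
      using solution_on_deriv[OF assms(1) seg[of t]] t by simp
  qed auto
  then show ?thesis by simp
qed

lemma solution_on_subset: "solution_on C \<Phi> \<Longrightarrow> D \<subseteq> C \<Longrightarrow> solution_on D \<Phi>"
  by (auto simp: solution_on_def)

text \<open>
  Being a solution is a local property, which allows local solutions to be glued.
\<close>

lemma solution_on_cong_open:
  assumes "open C" "\<And>u. u \<in> C \<Longrightarrow> \<Phi> u = \<Psi> u" "solution_on C \<Phi>"
  shows "solution_on C \<Psi>"
  unfolding solution_on_def
proof (intro ballI allI)
  fix u \<eta> assume u: "u \<in> C"
  have op: "open ((\<lambda>t. u + t *\<^sub>R \<eta>) -` C)"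
    by (intro open_vimage assms(1) continuous_intros)
  have z: "0 \<in> (\<lambda>t. u + t *\<^sub>R \<eta>) -` C" using u by simp
  have eqd: "\<Phi> (u + t *\<^sub>R \<eta>) = \<Psi> (u + t *\<^sub>R \<eta>)" if "t \<in> (\<lambda>t. u + t *\<^sub>R \<eta>) -` C" for t
    using that assms(2) by simp
  have der: "((\<lambda>t. \<Phi> (u + t *\<^sub>R \<eta>)) has_vector_derivative iso_field u \<eta> (\<Phi> u)) (at 0)"
    using assms(3) u unfolding solution_on_def by blast
  show "((\<lambda>t. \<Psi> (u + t *\<^sub>R \<eta>)) has_vector_derivative iso_field u \<eta> (\<Psi> u)) (at 0)"
    using has_vector_derivative_transform_within_open[OF der op z eqd] assms(2)[OF u] by simp
qed

section \<open>Lie derivatives along the isomonodromy vector field, and flatness\<close>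

text \<open>
  Polynomial expressions in the value of the unknown (\<open>EPhi\<close>), in \<open>pmat u\<close> (\<open>EInv\<close>) and in \<open>dmat u\<close> (\<open>EDiff\<close>), built with the
  matrix product and the entrywise product. The Lie derivative \<open>dL \<eta>\<close> along the isomonodromy vector field maps
  such expressions to such expressions, so it can be iterated symbolically and its growth can be read off from
  degrees and coefficients.
\<close>

datatype 'm lie_ex = EConst 'm | EPhi | EInv | EDiff | EAdd "'m lie_ex" "'m lie_ex" | EMul "'m lie_ex" "'m lie_ex" | EHad "'m lie_ex" "'m lie_ex"

primrec interp :: "real^'n::finite \<Rightarrow> 'n cmat \<Rightarrow> 'n cmat lie_ex \<Rightarrow> 'n cmat" where
  "interp u Y (EConst M) = M"
| "interp u Y EPhi = Y"
| "interp u Y EInv = pmat u"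
| "interp u Y EDiff = dmat u"
| "interp u Y (EAdd a b) = interp u Y a + interp u Y b"
| "interp u Y (EMul a b) = interp u Y a ** interp u Y b"
| "interp u Y (EHad a b) = interp u Y a * interp u Y b"

primrec dL :: "real^'n::finite \<Rightarrow> 'n cmat lie_ex \<Rightarrow> 'n cmat lie_ex" where
  "dL \<eta> (EConst M) = EConst 0"
| "dL \<eta> EPhi = EAdd (EMul EPhi (EHad (EHad (EConst (cscale c0 (dmat \<eta>))) EInv) EPhi))
             (EMul (EHad (EHad (EConst (- cscale c0 (dmat \<eta>))) EInv) EPhi) EPhi)"
| "dL \<eta> EInv = EHad (EConst (- dmat \<eta>)) (EHad EInv EInv)"
| "dL \<eta> EDiff = EConst (dmat \<eta>)"
| "dL \<eta> (EAdd a b) = EAdd (dL \<eta> a) (dL \<eta> b)"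
| "dL \<eta> (EMul a b) = EAdd (EMul (dL \<eta> a) b) (EMul a (dL \<eta> b))"
| "dL \<eta> (EHad a b) = EAdd (EHad (dL \<eta> a) b) (EHad a (dL \<eta> b))"

lemma ad_cscale_right: "ad Y (cscale c Z) = cscale c (ad Y Z)"
  by (simp add: ad_def cscale_mult_left cscale_mult_right) (simp add: vec_eq_iff algebra_simps)

lemma interp_dL_EPhi: "interp u Y (dL \<eta> EPhi) = iso_field u \<eta> Y"
proof -
  have "cscale c0 (dmat \<eta>) * pmat u * Y = cscale c0 (wmat u \<eta> * Y)"
    by (simp add: vec_eq_iff divide_inverse mult_ac)
  then show ?thesis
    unfolding iso_field_def ad_cscale_right[symmetric] by (simp add: ad_def matmul.minus_left)
qed

lemma dmat_add: "dmat (u + v) = dmat u + dmat v" and dmat_scaleR: "dmat (r *\<^sub>R u) = r *\<^sub>R dmat u"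
  by (simp_all add: vec_eq_iff algebra_simps scaleR_conv_of_real[where 'a = complex])

lemma has_vector_derivative_vec:
  fixes f :: "real \<Rightarrow> 'a::real_normed_vector^'n"
  assumes "\<And>i. ((\<lambda>t. f t $ i) has_vector_derivative f' $ i) (at x)"
  shows "(f has_vector_derivative f') (at x)"
  unfolding has_vector_derivative_def has_derivative_def
proof (intro conjI bounded_linear_scaleR_left)
  show "((\<lambda>y. ((f y - f (Lim (at x) (\<lambda>x. x))) - (y - Lim (at x) (\<lambda>x. x)) *\<^sub>R f') /\<^sub>R norm (y - Lim (at x) (\<lambda>x. x))) \<longlongrightarrow> 0) (at x)"
    by (rule vec_tendstoI) (use assms in \<open>simp add: has_vector_derivative_def has_derivative_def\<close>)
qed

lemma open_inj_line:
  assumes "inj (vec_nth (u :: real^'n))"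
  obtains d where "d > 0" "\<And>t. \<bar>t\<bar> < d \<Longrightarrow> inj (vec_nth (u + t *\<^sub>R \<eta>))"
proof -
  have "open (\<Inter>i. \<Inter>j\<in>-{i}. {t::real. (u + t *\<^sub>R \<eta>) $ i \<noteq> (u + t *\<^sub>R \<eta>) $ j})"
    by (intro open_INT finite ballI open_Collect_neq continuous_intros)
  moreover have "0 \<in> (\<Inter>i. \<Inter>j\<in>-{i}. {t::real. (u + t *\<^sub>R \<eta>) $ i \<noteq> (u + t *\<^sub>R \<eta>) $ j})"
    using assms by (auto simp: inj_def)
  ultimately obtain d where "d > 0" "ball 0 d \<subseteq> (\<Inter>i. \<Inter>j\<in>-{i}. {t::real. (u + t *\<^sub>R \<eta>) $ i \<noteq> (u + t *\<^sub>R \<eta>) $ j})"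
    by (rule openE)
  then show ?thesis
    by (intro that[of d]) (auto simp: inj_def subset_iff dist_norm)
qed

text \<open>
  The symbolic derivation is the derivative along the vector field. It is this description that makes \<open>dL\<close> depend only
  on the function which an expression denotes.
\<close>

lemma interp_dL:
  assumes u: "inj (vec_nth u)"
  shows "((\<lambda>t. interp (u + t *\<^sub>R \<eta>) (Y + t *\<^sub>R iso_field u \<eta> Y) e) has_vector_derivative interp u Y (dL \<eta> e)) (at 0)"
proof (induction e)
  case EPhi
  show ?case unfolding interp_dL_EPhi by (auto intro!: derivative_eq_intros)
next
  case EInv
  have "((\<lambda>t. pmat (u + t *\<^sub>R \<eta>) $ i $ j) has_vector_derivative (- (dmat \<eta> * (pmat u * pmat u))) $ i $ j) (at 0)" for i j
  proof (cases "i = j")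
    case False
    then have ne: "u $ i - u $ j \<noteq> 0" using u by (auto simp: inj_def)
    have "((\<lambda>t. inverse (u $ i + t * \<eta> $ i - (u $ j + t * \<eta> $ j))) has_real_derivative
        - ((\<eta> $ i - \<eta> $ j) * (inverse (u $ i - u $ j) * inverse (u $ i - u $ j)))) (at 0)"
      using ne by (auto intro!: derivative_eq_intros)
    from has_vector_derivative_of_real[OF this, where 'a = complex]
    show ?thesis by (simp flip: of_real_inverse of_real_mult of_real_minus of_real_diff of_real_add)
  qed simp
  then show ?case
    by (auto intro!: has_vector_derivative_vec)
next
  case EDiff
  show ?case unfolding interp.simps dL.simps dmat_add dmat_scaleR by (auto intro!: derivative_eq_intros)
next
  case (EMul a b)
  from matmul.has_vector_derivative[OF this] show ?case by (simp add: add.commute)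
next
  case (EHad a b)
  from had.has_vector_derivative[OF this] show ?case by (simp add: add.commute)
qed (auto intro!: derivative_eq_intros)

text \<open>
  Expressions are compared as functions on the set where the vector field is smooth: the relations between the
  entries of \<open>pmat u\<close>, on which flatness rests, hold for the functions but not for the expressions.
\<close>

definition lie_eq :: "'n::finite cmat lie_ex \<Rightarrow> 'n cmat lie_ex \<Rightarrow> bool" where
  "lie_eq a b \<longleftrightarrow> (\<forall>u Y. inj (vec_nth u) \<longrightarrow> interp u Y a = interp u Y b)"

lemma lie_eq_refl: "lie_eq a a" by (simp add: lie_eq_def)
lemma lie_eq_sym: "lie_eq a b \<Longrightarrow> lie_eq b a" by (simp add: lie_eq_def)
lemma lie_eq_trans: "lie_eq a b \<Longrightarrow> lie_eq b c \<Longrightarrow> lie_eq a c" by (simp add: lie_eq_def)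

lemma lie_eq_dL:
  assumes "lie_eq a b" shows "lie_eq (dL \<eta> a) (dL \<eta> b)"
  unfolding lie_eq_def
proof (intro allI impI)
  fix u :: "real^'a" and Y assume u: "inj (vec_nth u)"
  obtain d where d: "d > 0" "\<And>t. \<bar>t\<bar> < d \<Longrightarrow> inj (vec_nth (u + t *\<^sub>R \<eta>))"
    using open_inj_line[OF u] by blast
  have "((\<lambda>t. interp (u + t *\<^sub>R \<eta>) (Y + t *\<^sub>R iso_field u \<eta> Y) b) has_vector_derivative interp u Y (dL \<eta> a)) (at 0)"
    by (rule has_vector_derivative_transform_within_open[OF interp_dL[OF u], where S = "ball 0 d"])
      (use d assms in \<open>auto simp: lie_eq_def dist_norm\<close>)
  from vector_derivative_unique_at[OF this interp_dL[OF u]]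
  show "interp u Y (dL \<eta> a) = interp u Y (dL \<eta> b)" .
qed

lemma lie_eq_dL_iter: "lie_eq a b \<Longrightarrow> lie_eq ((dL v ^^ m) a) ((dL v ^^ m) b)"
  by (induction m) (auto intro: lie_eq_dL)

text \<open>
  The Arnold relation \<open>\<omega>\<^sub>i\<^sub>l \<and> \<omega>\<^sub>l\<^sub>j + \<omega>\<^sub>l\<^sub>j \<and> \<omega>\<^sub>j\<^sub>i + \<omega>\<^sub>j\<^sub>i \<and> \<omega>\<^sub>i\<^sub>l = 0\<close> for \<open>\<omega>\<^sub>i\<^sub>j = dlog (u\<^sub>i - u\<^sub>j)\<close>, evaluated at the two directions
  \<open>\<eta>\<close> and \<open>\<zeta>\<close>. When two of the indices coincide, it follows from \<open>\<omega>\<^sub>i\<^sub>j = \<omega>\<^sub>j\<^sub>i\<close> and the convention \<open>\<omega>\<^sub>i\<^sub>i = 0\<close>.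
\<close>

lemma arnold:
  fixes \<eta> \<zeta> u :: "'n \<Rightarrow> complex"
  assumes "inj u"
  defines "\<alpha> \<equiv> \<lambda>i j. (\<eta> i - \<eta> j) * inverse (u i - u j)" and "\<beta> \<equiv> \<lambda>i j. (\<zeta> i - \<zeta> j) * inverse (u i - u j)"
  shows "\<alpha> i l * \<beta> l j - \<beta> i l * \<alpha> l j + \<beta> i j * (\<alpha> l j - \<alpha> i l) - \<alpha> i j * (\<beta> l j - \<beta> i l) = 0"
proof -
  have sym: "\<alpha> l i = \<alpha> i l" "\<beta> l i = \<beta> i l" for i l
    unfolding \<alpha>_def \<beta>_def by (metis minus_diff_eq inverse_minus_eq minus_mult_minus)+
  have z: "\<alpha> i i = 0" "\<beta> i i = 0" for i by (simp_all add: \<alpha>_def \<beta>_def)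
  consider "i = l" | "l = j" | "i = j" | "i \<noteq> l" "l \<noteq> j" "i \<noteq> j" by blast
  then show ?thesis
  proof cases
    case 4
    define x y where "x = u i - u l" and "y = u l - u j"
    have xy: "u i - u j = x + y" by (simp add: x_def y_def)
    have ne: "x \<noteq> 0" "y \<noteq> 0" "x + y \<noteq> 0"
      using 4 assms(1) unfolding xy[symmetric] by (auto simp: x_def y_def inj_def)
    define e1 e2 z1 z2 where "e1 = \<eta> i - \<eta> l" "e2 = \<eta> l - \<eta> j" "z1 = \<zeta> i - \<zeta> l" "z2 = \<zeta> l - \<zeta> j"
    have e: "\<eta> i - \<eta> j = e1 + e2" "\<zeta> i - \<zeta> j = z1 + z2" by (simp_all add: e1_e2_z1_z2_def)
    show ?thesis
      unfolding \<alpha>_def \<beta>_def xy e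
      unfolding e1_e2_z1_z2_def[symmetric] x_def[symmetric] y_def[symmetric]
      using ne by (simp add: divide_inverse[symmetric]) (simp add: divide_simps, algebra)
  qed (auto simp: z sym[of l j] sym[of l i] sym algebra_simps)
qed

text \<open>
  The bracket of the vector fields in the directions \<open>\<eta>\<close> and \<open>\<zeta>\<close> is \<open>ad Y\<close> of this matrix; each of its entries is a sum of
  left-hand sides of the Arnold relation.
\<close>

lemma flatness:
  fixes u \<eta> \<zeta> :: "real^'n::finite" and Y :: "'n cmat"
  assumes u: "inj (vec_nth u)"
  defines "A \<equiv> cscale c0 (dmat \<eta>) * pmat u" and "B \<equiv> cscale c0 (dmat \<zeta>) * pmat u"
  shows "ad (A * Y) (B * Y) + B * ad Y (A * Y) - A * ad Y (B * Y) = 0"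
proof -
  define \<alpha> where "\<alpha> = (\<lambda>i j. (c0 * of_real (\<eta> $ i) - c0 * of_real (\<eta> $ j)) * inverse (of_real (u $ i) - of_real (u $ j)))"
  define \<beta> where "\<beta> = (\<lambda>i j. (c0 * of_real (\<zeta> $ i) - c0 * of_real (\<zeta> $ j)) * inverse (of_real (u $ i) - of_real (u $ j)))"
  have A: "A $ i $ j = \<alpha> i j" and B: "B $ i $ j = \<beta> i j" for i j
    by (simp_all add: A_def B_def \<alpha>_def \<beta>_def algebra_simps)
  have inj: "inj (\<lambda>i. of_real (u $ i) :: complex)" using u by (auto simp: inj_def)
  have "(ad (A * Y) (B * Y) + B * ad Y (A * Y) - A * ad Y (B * Y)) $ i $ j =
     (\<Sum>l\<in>UNIV. Y $ i $ l * Y $ l $ j * (\<alpha> i l * \<beta> l j - \<beta> i l * \<alpha> l j + \<beta> i j * (\<alpha> l j - \<alpha> i l) - \<alpha> i j * (\<beta> l j - \<beta> i l)))" for i j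
    by (simp add: ad_def matrix_mult_nth A B sum_distrib_left sum_subtractf[symmetric] sum.distrib[symmetric])
      (simp add: algebra_simps)
  also have "\<dots> i j = 0" for i j
    using arnold[OF inj, of "\<lambda>i. c0 * of_real (\<eta> $ i)" _ _ "\<lambda>i. c0 * of_real (\<zeta> $ i)"]
    unfolding \<alpha>_def \<beta>_def by (intro sum.neutral) auto
  finally show ?thesis by (simp add: vec_eq_iff)
qed

lemma jacobi: "ad (ad Y A) B - ad (ad Y B) A = ad Y (ad A (B :: 'n::finite cmat))"
  by (simp add: ad_def matmul.diff_left matmul.diff_right matrix_mul_assoc)

text \<open>
  The commutator of two derivations is a derivation, so it vanishes if it vanishes on the generators. On \<open>EPhi\<close>
  this is flatness together with the Jacobi identity.
\<close>

lemma dL_commute: "lie_eq (dL \<eta> (dL \<zeta> e)) (dL \<zeta> (dL \<eta> e))"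
proof (induction e)
  case EPhi
  show ?case unfolding lie_eq_def
  proof (intro allI impI)
    fix u :: "real^'a" and Y assume u: "inj (vec_nth u)"
    define A where "A = cscale c0 (dmat \<eta>) * pmat u"
    define B where "B = cscale c0 (dmat \<zeta>) * pmat u"
    (* W collects the terms in which pmat is differentiated; they are symmetric in the two directions. *)
    define W where "W = cscale c0 (dmat \<zeta>) * (- dmat \<eta> * (pmat u * pmat u)) * Y"
    have W: "W = cscale c0 (dmat \<eta>) * (- dmat \<zeta> * (pmat u * pmat u)) * Y"
      by (simp add: W_def vec_eq_iff)
    have R: "iso_field u \<eta> Y = ad Y (A * Y)" "iso_field u \<zeta> Y = ad Y (B * Y)"
      unfolding interp_dL_EPhi[symmetric] A_def B_def by (simp_all add: ad_def matmul.minus_left mult.assoc[symmetric])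
    have T: "interp u Y (dL v (EHad (EHad (EConst K) EInv) EPhi)) = K * (- dmat v * (pmat u * pmat u)) * Y + K * pmat u * iso_field u v Y" for v K
      by (simp add: interp_dL_EPhi algebra_simps del: dL.simps(2))
    have l: "interp u Y (dL \<eta> (dL \<zeta> EPhi)) = ad (ad Y (A * Y)) (B * Y) + ad Y (W + B * ad Y (A * Y))"
      unfolding dL.simps(2)[of \<zeta>] dL.simps(5,6) interp.simps T R interp_dL_EPhi
      unfolding ad_def A_def[symmetric] B_def[symmetric] W_def[symmetric]
      by (simp add: matmul.minus_left matmul.diff_left W_def B_def)
    have r: "interp u Y (dL \<zeta> (dL \<eta> EPhi)) = ad (ad Y (B * Y)) (A * Y) + ad Y (W + A * ad Y (B * Y))"
      unfolding dL.simps(2)[of \<eta>] dL.simps(5,6) interp.simps T R interp_dL_EPhi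
      unfolding ad_def A_def[symmetric] B_def[symmetric] W[symmetric]
      by (simp add: matmul.minus_left matmul.diff_left W A_def)
    have "interp u Y (dL \<eta> (dL \<zeta> EPhi)) - interp u Y (dL \<zeta> (dL \<eta> EPhi)) =
        ad Y (ad (A * Y) (B * Y) + B * ad Y (A * Y) - A * ad Y (B * Y))"
      unfolding l r using jacobi[of Y "A * Y" "B * Y"] by (simp add: ad.add_right ad.diff_right)
    also have "\<dots> = 0" unfolding A_def B_def flatness[OF u] by (simp add: ad.zero_right)
    finally show "interp u Y (dL \<eta> (dL \<zeta> EPhi)) = interp u Y (dL \<zeta> (dL \<eta> EPhi))" by simp
  qed
qed (auto simp: lie_eq_def matmul.add_left matmul.add_right matmul.zero_left matmul.zero_right algebra_simps)

lemma dL_iter_commute: "lie_eq ((dL v ^^ m) (dL \<eta> e)) (dL \<eta> ((dL v ^^ m) e))"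
proof (induction m)
  case (Suc m)
  from lie_eq_trans[OF lie_eq_dL[OF this, of v] dL_commute] show ?case by simp
qed (simp add: lie_eq_refl)

lemma iso_field_linear: "iso_field u (h + t *\<^sub>R \<eta>) Y = iso_field u h Y + t *\<^sub>R iso_field u \<eta> Y"
proof -
  have "wmat u (h + t *\<^sub>R \<eta>) * Y = wmat u h * Y + t *\<^sub>R (wmat u \<eta> * Y)"
    by (simp add: wmat_def dmat_add dmat_scaleR ring_distribs mult.assoc)
  then show ?thesis
    by (simp add: iso_field_def ad.add_right ad.scaleR_right linear_add[OF bounded_linear.linear[OF bounded_linear_cscale]]
     linear_scale[OF bounded_linear.linear[OF bounded_linear_cscale]])
qed

lemma interp_dL_linear: "interp u Y (dL (h + t *\<^sub>R \<eta>) e) = interp u Y (dL h e) + t *\<^sub>R interp u Y (dL \<eta> e)"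
proof (induction e)
  case EPhi
  then show ?case by (simp only: interp_dL_EPhi iso_field_linear)
qed (simp_all add: dmat_add dmat_scaleR
     matmul.add_left matmul.add_right matmul.scaleR_left matmul.scaleR_right scaleR_add_right ring_distribs)

section \<open>Growth of iterated Lie derivatives\<close>

text \<open>
  If the generators are bounded by \<open>b \<ge> 1\<close>, an expression is bounded by \<open>weight e * b ^ deg e\<close>: the weight majorizes
  the sum of the norms of the coefficients.
\<close>

primrec deg :: "'n::finite cmat lie_ex \<Rightarrow> nat" where
  "deg (EConst M) = 0" | "deg EPhi = 1" | "deg EInv = 1" | "deg EDiff = 1"
| "deg (EAdd a b) = max (deg a) (deg b)" | "deg (EMul a b) = deg a + deg b" | "deg (EHad a b) = deg a + deg b"

primrec weight :: "'n::finite cmat lie_ex \<Rightarrow> real" where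
  "weight (EConst M) = norm M" | "weight EPhi = 1" | "weight EInv = 1" | "weight EDiff = 1"
| "weight (EAdd a b) = weight a + weight b" | "weight (EMul a b) = weight a * weight b" | "weight (EHad a b) = weight a * weight b"

lemma weight_nonneg: "weight e \<ge> 0" by (induction e) auto

lemma norm_interp_le:
  assumes "1 \<le> b" "norm Y \<le> b" "norm (pmat u) \<le> b" "norm (dmat u) \<le> b"
  shows "norm (interp u Y e) \<le> weight e * b ^ deg e"
proof (induction e)
  case (EAdd a c)
  have "weight a * b ^ deg a \<le> weight a * b ^ max (deg a) (deg c)" "weight c * b ^ deg c \<le> weight c * b ^ max (deg a) (deg c)"
    using assms(1) by (auto intro!: mult_left_mono power_increasing weight_nonneg)
  with EAdd show ?case by (simp add: distrib_right) (intro order_trans[OF norm_triangle_ineq], linarith)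
next
  case (EMul a c)
  have "norm (interp u Y a) * norm (interp u Y c) \<le> (weight a * b ^ deg a) * (weight c * b ^ deg c)"
    using assms(1) by (intro mult_mono EMul) (auto simp: weight_nonneg)
  then show ?case by (simp add: power_add mult_ac) (rule order_trans[OF norm_matrix_mult])
next
  case (EHad a c)
  have "norm (interp u Y a) * norm (interp u Y c) \<le> (weight a * b ^ deg a) * (weight c * b ^ deg c)"
    using assms(1) by (intro mult_mono EHad) (auto simp: weight_nonneg)
  then show ?case by (simp add: power_add mult_ac) (rule order_trans[OF norm_hadamard])
qed (use assms in auto)

lemma deg_dL: "deg (dL \<eta> e) \<le> deg e + 2"
  by (induction e) auto

text \<open>
  A monomial of degree \<open>d\<close> has \<open>d\<close> factors to which the derivation applies, and each derivative of a generator is a polynomial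
  of degree at most three with coefficients of total size \<open>2 * norm (dmat \<eta>)\<close>.
\<close>

lemma weight_dL: "weight (dL \<eta> e) \<le> 2 * norm (dmat \<eta>) * deg e * weight e"
proof (induction e)
  case EPhi
  then show ?case using norm_cscale_c0_le[of "dmat \<eta>"] by simp
next
  case (EAdd a b)
  have "2 * norm (dmat \<eta>) * deg a * weight a \<le> 2 * norm (dmat \<eta>) * max (deg a) (deg b) * weight a"
       "2 * norm (dmat \<eta>) * deg b * weight b \<le> 2 * norm (dmat \<eta>) * max (deg a) (deg b) * weight b"
    by (intro mult_right_mono mult_left_mono weight_nonneg; simp)+
  with EAdd show ?case by (simp add: distrib_left)
next
  case (EMul a b)
  have "weight (dL \<eta> a) * weight b \<le> (2 * norm (dmat \<eta>) * deg a * weight a) * weight b"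
       "weight a * weight (dL \<eta> b) \<le> weight a * (2 * norm (dmat \<eta>) * deg b * weight b)"
    by (intro mult_right_mono mult_left_mono weight_nonneg EMul)+
  then show ?case by (simp add: algebra_simps)
next
  case (EHad a b)
  have "weight (dL \<eta> a) * weight b \<le> (2 * norm (dmat \<eta>) * deg a * weight a) * weight b"
       "weight a * weight (dL \<eta> b) \<le> weight a * (2 * norm (dmat \<eta>) * deg b * weight b)"
    by (intro mult_right_mono mult_left_mono weight_nonneg EHad)+
  then show ?case by (simp add: algebra_simps)
qed simp_all

primrec dLs :: "(real^'n::finite) list \<Rightarrow> 'n cmat lie_ex \<Rightarrow> 'n cmat lie_ex" where
  "dLs [] e = e" | "dLs (v # vs) e = dLs vs (dL v e)"

lemma dLs_replicate: "dLs (replicate m v) e = (dL v ^^ m) e"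
  by (induction m arbitrary: e) (auto simp: funpow_swap1)

lemma deg_dLs: "deg (dLs vs e) \<le> deg e + 2 * length vs"
proof (induction vs arbitrary: e)
  case (Cons v vs)
  show ?case using Cons[of "dL v e"] deg_dL[of v e] by simp
qed simp

lemma weight_dLs:
  assumes "\<And>v. v \<in> set vs \<Longrightarrow> norm (dmat v) \<le> N" "deg e \<le> d"
  shows "weight (dLs vs e) \<le> weight e * (\<Prod>j<length vs. 2 * N * (d + 2 * j))"
  using assms
proof (induction vs arbitrary: e d)
  case (Cons v vs)
  have N: "norm (dmat v) \<le> N" using Cons.prems(1)[of v] by simp
  note N = N order_trans[OF norm_ge_zero N]
  have "weight (dLs vs (dL v e)) \<le> weight (dL v e) * (\<Prod>j<length vs. 2 * N * real (d + 2 + 2 * j))"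
    using Cons.IH[of "dL v e" "d + 2"] Cons.prems deg_dL[of v e] by auto
  also have "\<dots> \<le> (2 * N * d * weight e) * (\<Prod>j<length vs. 2 * N * real (d + 2 + 2 * j))"
  proof (intro mult_right_mono prod_nonneg)
    have "2 * norm (dmat v) * deg e * weight e \<le> 2 * N * d * weight e"
      using N Cons.prems by (intro mult_right_mono mult_mono) (auto simp: weight_nonneg)
    then show "weight (dL v e) \<le> 2 * N * d * weight e" using weight_dL order_trans by blast
  qed (use N in auto)
  also have "\<dots> = weight e * (\<Prod>j<length (v # vs). 2 * N * real (d + 2 * j))"
    by (simp add: prod.lessThan_Suc_shift add.left_commute del: prod.lessThan_Suc)
  finally show ?case by simp
qed simp

text \<open>
  Iterating \<open>deg_dL\<close> and \<open>weight_dL\<close> produces the product \<open>d (d + 2) (d + 4) \<cdots>\<close>. It is of the order of a factorial, which the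
  factor \<open>1 / fact m\<close> of the exponential series compensates.
\<close>

lemma prod_arith_progression_le: "(\<Prod>j<m. 2 * N * real (d + 2 * j)) \<le> 2 ^ d * (8 * N) ^ m * fact m" if "0 \<le> N"
proof -
  have "(\<Prod>j<m. real (d + j + 1)) * fact d = fact (d + m)"
  proof (induction m)
    case (Suc m)
    have "(\<Prod>j<Suc m. real (d + j + 1)) * fact d = real (d + m + 1) * ((\<Prod>j<m. real (d + j + 1)) * fact d)"
      by simp
    also have "\<dots> = fact (d + Suc m)" unfolding Suc by simp
    finally show ?case .
  qed simp
  also have "\<dots> = fact d * fact m * real ((d + m) choose d)"
    using binomial_fact_lemma[of d "d + m"] by (metis add_diff_cancel_left' le_add1 of_nat_fact of_nat_mult)
  also have "\<dots> \<le> fact d * fact m * 2 ^ (d + m)"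
    using binomial_le_pow2[of "d + m" d] by (metis fact_ge_zero mult_left_mono mult_nonneg_nonneg numeral_power_eq_of_nat_cancel_iff of_nat_le_iff of_nat_numeral of_nat_power)
  finally have "(\<Prod>j<m. real (d + j + 1)) * fact d \<le> (fact m * 2 ^ (d + m)) * fact d"
    by (simp add: mult_ac)
  then have *: "(\<Prod>j<m. real (d + j + 1)) \<le> fact m * 2 ^ (d + m)" by simp
  have "(\<Prod>j<m. 2 * N * real (d + 2 * j)) \<le> (\<Prod>j<m. 4 * N * real (d + j + 1))"
    using that by (intro prod_mono conjI) (auto simp: algebra_simps intro!: add_mono mult_nonneg_nonneg add_increasing)
  also have "\<dots> = (4 * N) ^ m * (\<Prod>j<m. real (d + j + 1))" by (simp add: prod.distrib prod_constant)
  also have "\<dots> \<le> (4 * N) ^ m * (fact m * 2 ^ (d + m))"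
    using that by (intro mult_left_mono *) auto
  also have "\<dots> = 2 ^ d * (8 * N) ^ m * fact m"
  proof -
    have "(8 * N) ^ m = (4 * N) ^ m * 2 ^ m" unfolding power_mult_distrib[of "4 * N" 2 m, symmetric] by (simp add: mult.commute)
    then show ?thesis by (simp only: power_add mult_ac)
  qed
  finally show ?thesis .
qed

lemma norm_interp_dLs:
  assumes b: "1 \<le> b" "norm Y \<le> b" "norm (pmat u) \<le> b" "norm (dmat u) \<le> b"
    and N: "\<And>v. v \<in> set vs \<Longrightarrow> norm (dmat v) \<le> N" "0 \<le> N"
  shows "norm (interp u Y (dLs vs e)) \<le> (weight e * (2 * b) ^ deg e) * (8 * N * b\<^sup>2) ^ length vs * fact (length vs)"
proof -
  have "norm (interp u Y (dLs vs e)) \<le> weight (dLs vs e) * b ^ deg (dLs vs e)"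
    by (rule norm_interp_le[OF b])
  also have "\<dots> \<le> (weight e * (2 ^ deg e * (8 * N) ^ length vs * fact (length vs))) * b ^ (deg e + 2 * length vs)"
    using b(1) N deg_dLs
    by (intro mult_mono order_trans[OF weight_dLs[OF N(1) order_refl]] mult_left_mono prod_arith_progression_le power_increasing)
      (auto simp: weight_nonneg intro!: mult_nonneg_nonneg)
  also have "\<dots> = (weight e * (2 * b) ^ deg e) * (8 * N * b\<^sup>2) ^ length vs * fact (length vs)"
    unfolding power_add power_mult power_mult_distrib by (simp add: mult_ac)
  finally show ?thesis .
qed

text \<open>
  The series \<open>exp L\<^sub>v\<close> applied to the function denoted by \<open>e\<close>, evaluated at the point \<open>(u, Y)\<close>.
\<close>

definition lie_term :: "real^'n::finite \<Rightarrow> 'n cmat \<Rightarrow> real^'n \<Rightarrow> 'n cmat lie_ex \<Rightarrow> nat \<Rightarrow> 'n cmat" where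
  "lie_term u Y v e m = (1 / fact m) *\<^sub>R interp u Y ((dL v ^^ m) e)"

definition lie_series :: "real^'n::finite \<Rightarrow> 'n cmat \<Rightarrow> real^'n \<Rightarrow> 'n cmat lie_ex \<Rightarrow> 'n cmat" where
  "lie_series u Y v e = (\<Sum>m. lie_term u Y v e m)"

lemma norm_lie_term:
  assumes b: "1 \<le> b" "norm Y \<le> b" "norm (pmat u) \<le> b" "norm (dmat u) \<le> b"
    and v: "8 * norm (dmat v) * b\<^sup>2 \<le> q"
  shows "norm (lie_term u Y v e m) \<le> (weight e * (2 * b) ^ deg e) * q ^ m"
proof -
  have "norm (lie_term u Y v e m) \<le> (weight e * (2 * b) ^ deg e) * (8 * norm (dmat v) * b\<^sup>2) ^ m"
  proof -
    have "norm (interp u Y (dLs (replicate m v) e)) \<le> (weight e * (2 * b) ^ deg e) * (8 * norm (dmat v) * b\<^sup>2) ^ m * fact m"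
      using norm_interp_dLs[OF b, of "replicate m v" "norm (dmat v)" e] by simp
    then have "(1 / fact m) * norm (interp u Y ((dL v ^^ m) e)) \<le> (1 / fact m) * ((weight e * (2 * b) ^ deg e) * (8 * norm (dmat v) * b\<^sup>2) ^ m * fact m)"
      unfolding dLs_replicate by (rule mult_left_mono) simp
    then show ?thesis by (simp add: lie_term_def)
  qed
  also have "\<dots> \<le> (weight e * (2 * b) ^ deg e) * q ^ m"
    using b(1) v by (intro mult_left_mono power_mono) (auto intro!: mult_nonneg_nonneg weight_nonneg)
  finally show ?thesis .
qed

lemma lie_term_Suc: "real (Suc m) *\<^sub>R lie_term u Y v e (Suc m) = lie_term u Y v (dL v e) m"
  by (simp add: lie_term_def funpow_swap1 divide_simps del: of_nat_Suc funpow.simps)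
    (simp add: funpow_swap1)

lemma lie_term_EAdd: "lie_term u Y v (EAdd a b) m = lie_term u Y v a m + lie_term u Y v b m"
proof -
  have "(dL v ^^ m) (EAdd a b) = EAdd ((dL v ^^ m) a) ((dL v ^^ m) b)" by (induction m) auto
  then show ?thesis by (simp add: lie_term_def scaleR_add_right)
qed

text \<open>
  The Leibniz rule for iterated derivations, in the normalization that makes it a Cauchy product. As a consequence
  the exponential of a derivation is multiplicative.
\<close>

lemma lie_term_bilinear:
  assumes bl: "bounded_bilinear op2"
    and dL: "\<And>v a b. dL v (C a b) = EAdd (C (dL v a) b) (C a (dL v b))"
    and ev: "\<And>a b. interp u Y (C a b) = op2 (interp u Y a) (interp u Y b)"
  shows "lie_term u Y v (C a b) m = (\<Sum>i\<le>m. op2 (lie_term u Y v a i) (lie_term u Y v b (m - i)))"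
proof (induction m arbitrary: a b)
  case 0
  show ?case by (simp add: lie_term_def ev)
next
  case (Suc m)
  interpret bounded_bilinear op2 by fact
  let ?t = "lie_term u Y v"
  have "real (Suc m) *\<^sub>R ?t (C a b) (Suc m) =
      (\<Sum>i\<le>m. op2 (?t (dL v a) i) (?t b (m - i))) + (\<Sum>i\<le>m. op2 (?t a i) (?t (dL v b) (m - i)))"
    by (simp add: lie_term_Suc dL lie_term_EAdd Suc.IH del: of_nat_Suc)
  also have "(\<Sum>i\<le>m. op2 (?t (dL v a) i) (?t b (m - i))) = (\<Sum>i\<le>m. real (Suc i) *\<^sub>R op2 (?t a (Suc i)) (?t b (m - i)))"
    by (simp add: lie_term_Suc[symmetric] scaleR_left del: of_nat_Suc)
  also have "\<dots> = (\<Sum>i\<le>Suc m. real i *\<^sub>R op2 (?t a i) (?t b (Suc m - i)))"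
    by (subst sum.atMost_Suc_shift) simp
  also have "(\<Sum>i\<le>m. op2 (?t a i) (?t (dL v b) (m - i))) = (\<Sum>i\<le>m. real (Suc m - i) *\<^sub>R op2 (?t a i) (?t b (Suc m - i)))"
    by (intro sum.cong refl) (simp add: lie_term_Suc[symmetric] scaleR_right Suc_diff_le del: of_nat_Suc)
  also have "\<dots> = (\<Sum>i\<le>Suc m. real (Suc m - i) *\<^sub>R op2 (?t a i) (?t b (Suc m - i)))"
    by simp
  also have "(\<Sum>i\<le>Suc m. real i *\<^sub>R op2 (?t a i) (?t b (Suc m - i))) + \<dots> =
      real (Suc m) *\<^sub>R (\<Sum>i\<le>Suc m. op2 (?t a i) (?t b (Suc m - i)))"
    unfolding scaleR_sum_right sum.distrib[symmetric]
    by (intro sum.cong refl) (simp add: scaleR_add_left[symmetric] of_nat_diff del: of_nat_Suc)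
  finally show ?case by simp
qed

lemma sums_cmat_iff: "f sums s \<longleftrightarrow> (\<forall>i j. (\<lambda>m. f m $ i $ j) sums (s $ i $ j :: complex))" for s :: "'n::finite cmat"
proof
  assume "f sums s" then show "\<forall>i j. (\<lambda>m. f m $ i $ j) sums (s $ i $ j)"
    by (auto intro!: bounded_linear.sums[OF bounded_linear_vec_nth])
next
  assume *: "\<forall>i j. (\<lambda>m. f m $ i $ j) sums (s $ i $ j)"
  show "f sums s" unfolding sums_def
    by (intro vec_tendstoI) (use * in \<open>simp add: sums_def\<close>)
qed

lemma Cauchy_product_matrix:
  fixes a b :: "nat \<Rightarrow> 'n::finite cmat"
  assumes a: "summable (\<lambda>m. norm (a m))" and b: "summable (\<lambda>m. norm (b m))"
  shows "(\<lambda>m. \<Sum>i\<le>m. a i ** b (m - i)) sums (suminf a ** suminf b)"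
    and "(\<lambda>m. \<Sum>i\<le>m. a i * b (m - i)) sums (suminf a * suminf b)"
proof -
  have sn: "summable (\<lambda>m. norm (c m $ i $ j))" if "summable (\<lambda>m. norm (c m))" for c :: "nat \<Rightarrow> 'n cmat" and i j
    by (rule summable_comparison_test'[OF that]) (simp add: norm_nth_nth_le)
  have sm: "suminf c $ i $ j = (\<Sum>m. c m $ i $ j)" if "summable (\<lambda>m. norm (c m))" for c :: "nat \<Rightarrow> 'n cmat" and i j
    using sums_cmat_iff[of c "suminf c"] summable_sums[OF summable_norm_cancel[OF that]] by (simp add: sums_iff)
  have cp: "(\<lambda>m. \<Sum>p\<le>m. a p $ i $ j * b (m - p) $ k $ l) sums (suminf a $ i $ j * suminf b $ k $ l)" for i j k l
    unfolding sm[OF a] sm[OF b] by (rule Cauchy_product_sums[OF sn[OF a] sn[OF b]])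
  show "(\<lambda>m. \<Sum>i\<le>m. a i ** b (m - i)) sums (suminf a ** suminf b)"
    unfolding sums_cmat_iff
  proof (intro allI)
    fix i j
    have "(\<lambda>m. \<Sum>l\<in>UNIV. \<Sum>p\<le>m. a p $ i $ l * b (m - p) $ l $ j) sums ((suminf a ** suminf b) $ i $ j)"
      unfolding matrix_mult_nth by (intro sums_sum cp)
    then show "(\<lambda>m. (\<Sum>i\<le>m. a i ** b (m - i)) $ i $ j) sums ((suminf a ** suminf b) $ i $ j)"
      by (subst (asm) sum.swap) (simp add: matrix_mult_nth)
  qed
  show "(\<lambda>m. \<Sum>i\<le>m. a i * b (m - i)) sums (suminf a * suminf b)"
    unfolding sums_cmat_iff using cp by simp
qed

lemma has_vector_derivative_suminf:
  fixes f :: "nat \<Rightarrow> real \<Rightarrow> 'b::banach"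
  assumes T: "convex T" "open T" "t \<in> T"
    and d: "\<And>n t. t \<in> T \<Longrightarrow> (f n has_vector_derivative f' n t) (at t)"
    and bd: "\<And>n t. t \<in> T \<Longrightarrow> norm (f' n t) \<le> M n" and M: "summable M"
    and s: "summable (\<lambda>n. f n t)"
  shows "((\<lambda>t. \<Sum>n. f n t) has_vector_derivative (\<Sum>n. f' n t)) (at t)"
proof -
  have u: "uniform_limit T (\<lambda>n t. \<Sum>i<n. f' i t) (\<lambda>t. \<Sum>i. f' i t) sequentially"
    by (rule Weierstrass_m_test[OF bd M])
  have "\<exists>g. \<forall>x\<in>T. (\<lambda>n. f n x) sums (g x) \<and> (g has_derivative (\<lambda>h. h *\<^sub>R (\<Sum>n. f' n x))) (at x within T)"
  proof (rule has_derivative_series[where f' = "\<lambda>n x h. h *\<^sub>R f' n x"])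
    show "((f n) has_derivative (\<lambda>h. h *\<^sub>R f' n x)) (at x within T)" if "x \<in> T" for n x
      using d[OF that] by (simp add: has_vector_derivative_def has_derivative_at_withinI)
    fix e :: real assume "e > 0"
    from uniform_limitD[OF u this]
    show "\<forall>\<^sub>F n in sequentially. \<forall>x\<in>T. \<forall>h. norm ((\<Sum>i<n. h *\<^sub>R f' i x) - h *\<^sub>R (\<Sum>n. f' n x)) \<le> e * norm h"
    proof (rule eventually_mono, intro ballI allI)
      fix n x and h :: real assume "\<forall>x\<in>T. dist (\<Sum>i<n. f' i x) (\<Sum>i. f' i x) < e" "x \<in> T"
      then have "norm h * norm ((\<Sum>i<n. f' i x) - (\<Sum>i. f' i x)) \<le> norm h * e"
        by (intro mult_left_mono) (auto simp: dist_norm less_imp_le)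
      then show "norm ((\<Sum>i<n. h *\<^sub>R f' i x) - h *\<^sub>R (\<Sum>n. f' n x)) \<le> e * norm h"
        by (simp add: scaleR_sum_right[symmetric] scaleR_diff_right[symmetric] mult.commute)
    qed
  qed (use T s in \<open>auto intro: summable_sums\<close>)
  then obtain g where g: "\<And>x. x \<in> T \<Longrightarrow> (\<lambda>n. f n x) sums (g x)"
      "(g has_derivative (\<lambda>h. h *\<^sub>R (\<Sum>n. f' n t))) (at t within T)" using T(3) by blast
  have "(g has_vector_derivative (\<Sum>n. f' n t)) (at t)"
    using g(2) at_within_open[OF T(3,2)] by (simp add: has_vector_derivative_def)
  then show ?thesis
    by (rule has_vector_derivative_transform_within_open[OF _ T(2,3)]) (use g(1) in \<open>auto simp: sums_iff\<close>)
qed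

text \<open>
  Differentiating the \<open>m\<close>-fold derivative \<open>L\<^sub>v \<cdots> L\<^sub>v\<close> in \<open>v\<close> gives \<open>m\<close> terms with one factor \<open>L\<^sub>\<eta>\<close> each; by
  commutativity they are equal.
\<close>

lemma lie_term_deriv:
  assumes u: "inj (vec_nth u)"
  shows "((\<lambda>t. lie_term u Y (h + t *\<^sub>R \<eta>) e m) has_vector_derivative
     (case m of 0 \<Rightarrow> 0 | Suc k \<Rightarrow> lie_term u Y (h + t *\<^sub>R \<eta>) (dL \<eta> e) k)) (at t)"
proof -
  let ?A = "\<lambda>m e t. interp u Y ((dL (h + t *\<^sub>R \<eta>) ^^ m) e)"
  have ev: "interp u Y a = interp u Y b" if "lie_eq a b" for a b using that u by (simp add: lie_eq_def)
  have step: "?A (Suc m) e t = ?A m (dL h e) t + t *\<^sub>R ?A m (dL \<eta> e) t" for m e t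
    using ev[OF dL_iter_commute[of m "h + t *\<^sub>R \<eta>" h e]] ev[OF dL_iter_commute[of m "h + t *\<^sub>R \<eta>" \<eta> e]]
    by (simp add: interp_dL_linear)
  have main: "((\<lambda>t. ?A (Suc m) e t) has_vector_derivative real (Suc m) *\<^sub>R ?A m (dL \<eta> e) t) (at t)" for m
  proof (induction m arbitrary: e)
    case 0
    show ?case by (auto simp: interp_dL_linear intro!: derivative_eq_intros)
  next
    case (Suc m)
    have com: "?A m (dL \<eta> (dL h e)) t = ?A m (dL h (dL \<eta> e)) t"
      by (intro ev lie_eq_dL_iter dL_commute)
    have "((\<lambda>t. ?A (Suc m) (dL h e) t + t *\<^sub>R ?A (Suc m) (dL \<eta> e) t) has_vector_derivative
       real (Suc m) *\<^sub>R ?A m (dL \<eta> (dL h e)) t + (t *\<^sub>R real (Suc m) *\<^sub>R ?A m (dL \<eta> (dL \<eta> e)) t + 1 *\<^sub>R ?A (Suc m) (dL \<eta> e) t)) (at t)"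
      by (intro has_vector_derivative_add has_vector_derivative_scaleR Suc.IH) (auto intro!: derivative_eq_intros)
    moreover have "real (Suc m) *\<^sub>R ?A m (dL \<eta> (dL h e)) t + (t *\<^sub>R real (Suc m) *\<^sub>R ?A m (dL \<eta> (dL \<eta> e)) t + 1 *\<^sub>R ?A (Suc m) (dL \<eta> e) t)
       = real (Suc m) *\<^sub>R (?A m (dL h (dL \<eta> e)) t + t *\<^sub>R ?A m (dL \<eta> (dL \<eta> e)) t) + ?A (Suc m) (dL \<eta> e) t"
      unfolding com by (simp add: algebra_simps del: of_nat_Suc funpow.simps)
    also have "\<dots> = real (Suc (Suc m)) *\<^sub>R ?A (Suc m) (dL \<eta> e) t"
      unfolding step[where m = m and e = "dL \<eta> e" and t = t, symmetric] of_nat_Suc[of "Suc m"]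
      by (simp only: scaleR_left_distrib scaleR_one add.commute)
    ultimately show ?case unfolding step[where m = "Suc m"] by (simp del: of_nat_Suc funpow.simps)
  qed
  show ?thesis
  proof (cases m)
    case (Suc k)
    have "((\<lambda>t. (1 / fact (Suc k)) *\<^sub>R ?A (Suc k) e t) has_vector_derivative (1 / fact (Suc k)) *\<^sub>R (real (Suc k) *\<^sub>R ?A k (dL \<eta> e) t)) (at t)"
      by (intro bounded_linear.has_vector_derivative[OF bounded_linear_scaleR_right main])
    then show ?thesis by (simp add: Suc lie_term_def divide_simps del: of_nat_Suc funpow.simps)
  qed (simp add: lie_term_def)
qed

section \<open>Local analytic solutions as Lie series\<close>

text \<open>
  An absolutely convergent family may be summed by levels; for power series in several variables the levels consist of
  the monomials of the same degree.
\<close>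

lemma has_sum_graded:
  fixes g :: "'i \<Rightarrow> 'b::banach" and d :: "'i \<Rightarrow> nat"
  assumes fin: "\<And>m. finite {i. d i = m}"
    and bd: "\<And>m. (\<Sum>i | d i = m. norm (g i)) \<le> B * q ^ m" and q: "0 \<le> q" "q < 1"
    and s: "(\<lambda>m. \<Sum>i | d i = m. g i) sums S"
  shows "(g has_sum S) UNIV"
proof -
  have fl: "finite {i. d i < M}" for M
  proof -
    have "{i. d i < M} = (\<Union>m<M. {i. d i = m})" by auto
    then show ?thesis using fin by simp
  qed
  have split: "(\<Sum>i | d i < M. h i) = (\<Sum>m<M. \<Sum>i | d i = m. h i)" for M and h :: "'i \<Rightarrow> 'c::comm_monoid_add"
  proof -
    have "{i. d i < M} = (\<Union>m<M. {i. d i = m})" by auto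
    then show ?thesis using fin by (simp, intro sum.UNION_disjoint) auto
  qed
  have "(\<lambda>i. norm (g i)) summable_on UNIV"
  proof (rule nonneg_bdd_above_summable_on)
    have "sum (\<lambda>i. norm (g i)) F \<le> B * (1 / (1 - q))" if F: "finite F" for F
    proof -
      define M where "M = Suc (Max (insert 0 (d ` F)))"
      have "F \<subseteq> {i. d i < M}" using F by (auto simp: M_def less_Suc_eq_le)
      then have "sum (\<lambda>i. norm (g i)) F \<le> (\<Sum>i | d i < M. norm (g i))"
        using fl by (intro sum_mono2) auto
      also have "\<dots> \<le> (\<Sum>m<M. B * q ^ m)" unfolding split by (intro sum_mono bd)
      also have "\<dots> = B * (\<Sum>m<M. q ^ m)" by (simp add: sum_distrib_left)
      also have "\<dots> \<le> B * (1 / (1 - q))"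
      proof (intro mult_left_mono)
        have "(\<Sum>m<M. q ^ m) \<le> (\<Sum>m. q ^ m)" using q by (intro sum_le_suminf summable_geometric) auto
        then show "(\<Sum>m<M. q ^ m) \<le> 1 / (1 - q)" using q by (simp add: suminf_geometric)
        have "0 \<le> (\<Sum>i | d i = 0. norm (g i))" by (intro sum_nonneg) auto
        then show "0 \<le> B" using bd[of 0] by simp
      qed
      finally show ?thesis .
    qed
    then show "bdd_above (sum (\<lambda>i. norm (g i)) ` {F. F \<subseteq> UNIV \<and> finite F})"
      by (intro bdd_aboveI2[where M = "B * (1 / (1 - q))"]) auto
  qed auto
  then have "g summable_on UNIV" by (rule abs_summable_summable)
  then have hs: "(g has_sum infsum g UNIV) UNIV" by (rule has_sum_infsum)
  have "filterlim (\<lambda>M. {i. d i < M}) (finite_subsets_at_top UNIV) sequentially"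
    unfolding filterlim_finite_subsets_at_top
  proof (intro allI impI)
    fix F :: "'i set" assume F: "finite F \<and> F \<subseteq> UNIV"
    have "F \<subseteq> {i. d i < M}" if "M \<ge> Suc (Max (insert 0 (d ` F)))" for M
    proof
      fix i assume "i \<in> F"
      then have "d i \<le> Max (insert 0 (d ` F))" using F by (intro Max_ge) auto
      then show "i \<in> {i. d i < M}" using that by simp
    qed
    then show "\<forall>\<^sub>F M in sequentially. finite {i. d i < M} \<and> F \<subseteq> {i. d i < M} \<and> {i. d i < M} \<subseteq> UNIV"
      using fl by (auto simp: eventually_sequentially)
  qed
  from filterlim_compose[OF hs[unfolded has_sum_def] this]
  have "(\<lambda>M. \<Sum>m<M. \<Sum>i | d i = m. g i) \<longlonglongrightarrow> infsum g UNIV"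
    by (simp add: split)
  then have "S = infsum g UNIV" using s unfolding sums_def by (rule LIMSEQ_unique[rotated])
  then show ?thesis using hs by simp
qed

lemma norm_dmat: "norm (dmat v) \<le> (2 * (real CARD('n))\<^sup>2) * norm (v :: real^'n::finite)"
proof -
  have "norm (dmat v) \<le> (\<Sum>i\<in>(UNIV :: 'n set). \<Sum>j\<in>(UNIV :: 'n set). 2 * norm v)"
  proof (rule order_trans[OF norm_cmat_le_sum], intro sum_mono)
    fix i j
    have "norm (dmat v $ i $ j) = \<bar>v $ i - v $ j\<bar>" unfolding dmat_nth norm_of_real ..
    also have "\<dots> \<le> 2 * norm v" using component_le_norm_cart[of v i] component_le_norm_cart[of v j] by linarith
    finally show "norm (dmat v $ i $ j) \<le> 2 * norm v" .
  qed
  then show ?thesis by (simp add: power2_eq_square mult_ac)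
qed

text \<open>
  Expanding \<open>L\<^sub>h = \<Sum>\<^sub>k h\<^sub>k L\<^sub>k\<close> in the \<open>m\<close>-th power gives one term for each word of length \<open>m\<close> in the coordinate directions.
\<close>

definition word_coeff :: "real^'n::finite \<Rightarrow> 'n cmat \<Rightarrow> 'n list \<Rightarrow> 'n cmat" where
  "word_coeff u Y w = interp u Y (dLs (map (\<lambda>k. axis k 1) w) EPhi)"

lemma interp_dL_sum: "interp u Y (dL (\<Sum>k\<in>K. a k *\<^sub>R v k) e) = (\<Sum>k\<in>K. a k *\<^sub>R interp u Y (dL (v k) e))" if "finite K"
  using that
proof (induction K)
  case empty
  have "interp u Y (dL (0 + 1 *\<^sub>R 0) e) = interp u Y (dL 0 e) + 1 *\<^sub>R interp u Y (dL 0 e)" by (rule interp_dL_linear)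
  then show ?case by simp
next
  case (insert k K)
  then show ?case using interp_dL_linear[of u Y "\<Sum>k\<in>K. a k *\<^sub>R v k" "a k" "v k" e] by (simp add: add.commute)
qed

lemma iter_dL_expand:
  assumes u: "inj (vec_nth (u :: real^'n::finite))"
  shows "interp u Y ((dL h ^^ m) e) =
    (\<Sum>w | length w = m. (\<Prod>k\<leftarrow>w. h $ k) *\<^sub>R interp u Y (dLs (map (\<lambda>k. axis k 1) w) e))"
proof (induction m arbitrary: e)
  case (Suc m)
  have ev: "interp u Y a = interp u Y b" if "lie_eq a b" for a b using that u by (simp add: lie_eq_def)
  have fin: "finite {w :: 'n list. length w = m}" using finite_lists_length_eq[of "UNIV :: 'n set" m] by simp
  have h: "h = (\<Sum>k\<in>UNIV. (h $ k) *\<^sub>R axis k 1)"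
    by (simp add: vec_eq_iff axis_def if_distrib[of "\<lambda>x. _ * x"] cong: if_cong)
  have "interp u Y ((dL h ^^ Suc m) e) = (\<Sum>k\<in>UNIV. h $ k *\<^sub>R interp u Y (dL (axis k 1) ((dL h ^^ m) e)))"
    using interp_dL_sum[of "UNIV :: 'n set" u Y "\<lambda>k. h $ k" "\<lambda>k. axis k 1"] h by simp
  also have "\<dots> = (\<Sum>k\<in>UNIV. h $ k *\<^sub>R interp u Y ((dL h ^^ m) (dL (axis k 1) e)))"
    by (intro sum.cong refl arg_cong2[of _ _ _ _ scaleR] ev lie_eq_sym[OF dL_iter_commute])
  also have "\<dots> = (\<Sum>k\<in>UNIV. \<Sum>w | length w = m. (\<Prod>k\<leftarrow>k # w. h $ k) *\<^sub>R interp u Y (dLs (map (\<lambda>k. axis k 1) (k # w)) e))"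
    unfolding Suc.IH by (simp add: scaleR_sum_right)
  also have "\<dots> = (\<Sum>(k, w)\<in>UNIV \<times> {w. length w = m}. (\<Prod>k\<leftarrow>k # w. h $ k) *\<^sub>R interp u Y (dLs (map (\<lambda>k. axis k 1) (k # w)) e))"
    using fin by (simp add: sum.cartesian_product)
  also have "\<dots> = (\<Sum>w | length w = Suc m. (\<Prod>k\<leftarrow>w. h $ k) *\<^sub>R interp u Y (dLs (map (\<lambda>k. axis k 1) w) e))"
    by (rule sum.reindex_bij_witness[where i = "\<lambda>w. (hd w, tl w)" and j = "\<lambda>(k, w). k # w"])
      (auto simp: length_Suc_conv)
  finally show ?case .
qed simp

lemma prod_list_count:
  fixes h :: "'n::finite \<Rightarrow> real"
  shows "(\<Prod>k\<leftarrow>w. h k) = (\<Prod>k\<in>UNIV. h k ^ count_list w k)"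
proof (induction w)
  case (Cons a w)
  have "(\<Prod>k\<in>UNIV. h k ^ count_list (a # w) k) = (\<Prod>k\<in>UNIV. (if k = a then h k else 1) * h k ^ count_list w k)"
    by (intro prod.cong) auto
  also have "\<dots> = h a * (\<Prod>k\<in>UNIV. h k ^ count_list w k)"
    by (simp add: prod.distrib)
  finally show ?case using Cons by simp
qed simp

lemma sum_count_list: "(\<Sum>k\<in>UNIV. count_list w (k :: 'n::finite)) = length w"
  using sum_count_set[of w UNIV] by simp

text \<open>
  The constants are chosen such that the terms of the Lie series are dominated by a geometric series of ratio \<open>1/2\<close>
  on the ball of radius \<open>\<rho>\<close>, with \<open>\<rho>\<close> depending on the point only through the bound \<open>b\<close>.
\<close>

locale local_series =
  fixes u\<^sub>0 :: "real^'n::finite" and Y :: "'n cmat" and b \<rho> :: real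
  assumes inj: "inj (vec_nth u\<^sub>0)"
    and b: "1 \<le> b" "norm Y \<le> b" "norm (pmat u\<^sub>0) \<le> b" "norm (dmat u\<^sub>0) \<le> b"
    and \<rho>: "0 < \<rho>" "8 * (2 * (real CARD('n))\<^sup>2 * \<rho>) * b\<^sup>2 \<le> 1 / 2"
begin

abbreviation "lterm \<equiv> lie_term u\<^sub>0 Y"
abbreviation "lser \<equiv> lie_series u\<^sub>0 Y"

lemma norm_lterm:
  assumes "norm h < \<rho>"
  shows "norm (lterm h e m) \<le> (weight e * (2 * b) ^ deg e) * (1 / 2) ^ m"
proof (rule norm_lie_term[OF b])
  have "8 * norm (dmat h) * b\<^sup>2 \<le> 8 * (2 * (real CARD('n))\<^sup>2 * \<rho>) * b\<^sup>2"
    using assms by (intro mult_right_mono mult_left_mono order_trans[OF norm_dmat]) auto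
  with \<rho> show "8 * norm (dmat h) * b\<^sup>2 \<le> 1 / 2" by linarith
qed

lemma summable_norm_lterm: "norm h < \<rho> \<Longrightarrow> summable (\<lambda>m. norm (lterm h e m))"
  by (rule summable_comparison_test'[where g = "\<lambda>m. (weight e * (2 * b) ^ deg e) * (1 / 2) ^ m"])
    (use norm_lterm in \<open>auto intro!: summable_mult summable_geometric\<close>)

lemma summable_lterm: "norm h < \<rho> \<Longrightarrow> summable (lterm h e)"
  by (rule summable_norm_cancel[OF summable_norm_lterm])

lemma lser_EAdd: "norm h < \<rho> \<Longrightarrow> lser h (EAdd a c) = lser h a + lser h c"
  by (simp add: lie_series_def lie_term_EAdd suminf_add summable_lterm)

lemma lser_EMul: "norm h < \<rho> \<Longrightarrow> lser h (EMul a c) = lser h a ** lser h c"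
  using Cauchy_product_matrix(1)[OF summable_norm_lterm summable_norm_lterm]
  by (simp add: lie_series_def lie_term_bilinear[OF matmul.bounded_bilinear_axioms] sums_iff)

lemma lser_EHad: "norm h < \<rho> \<Longrightarrow> lser h (EHad a c) = lser h a * lser h c"
  using Cauchy_product_matrix(2)[OF summable_norm_lterm summable_norm_lterm]
  by (simp add: lie_series_def lie_term_bilinear[OF had.bounded_bilinear_axioms] sums_iff)

lemma lser_EConst: "lser h (EConst M) = M"
proof -
  have "(dL h ^^ m) (EConst 0) = EConst 0" for m by (induction m) auto
  then have "lterm h (EConst M) m = (if m = 0 then M else 0)" for m
    by (cases m) (auto simp: lie_term_def funpow_swap1)
  then show ?thesis using sums_single[of 0 "\<lambda>_. M"] by (simp add: lie_series_def sums_iff)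
qed

lemma lser_EDiff: "lser h EDiff = dmat (u\<^sub>0 + h)"
proof -
  have "(dL h ^^ m) (EConst 0) = EConst 0" for m by (induction m) auto
  then have lt: "lterm h EDiff m = (if m = 0 then dmat u\<^sub>0 else if m = 1 then dmat h else 0)" for m
    by (cases m; cases "m - 1") (auto simp: lie_term_def funpow_swap1)
  have "lser h EDiff = (\<Sum>m\<in>{0, 1}. lterm h EDiff m)"
    unfolding lie_series_def by (rule suminf_finite) (auto simp: lt)
  then show ?thesis by (simp add: lt dmat_add)
qed

lemma lser_cong:
  assumes "lie_eq a c" shows "lser h a = lser h c"
proof -
  have "lterm h a m = lterm h c m" for m
    using lie_eq_dL_iter[OF assms, where v = h and m = m] inj by (simp add: lie_term_def lie_eq_def)
  then show ?thesis by (simp add: lie_series_def)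
qed

text \<open>
  Multiplicativity carries the relation between \<open>pmat\<close> and \<open>dmat\<close> at \<open>u\<^sub>0\<close> to \<open>u\<^sub>0 + h\<close>, where \<open>dmat\<close> is known from \<open>lser_EDiff\<close>.
  The factor \<open>dmat \<eta>\<close> removes the diagonal.
\<close>

lemma lser_EInv:
  assumes h: "norm h < \<rho>"
  shows "dmat \<eta> * lser h EInv = dmat \<eta> * pmat (u\<^sub>0 + h)"
proof -
  define J :: "'n cmat" where "J = (\<chi> i j. if i = j then 0 else 1)"
  have "lie_eq (EHad EInv EDiff) (EConst J)"
    unfolding lie_eq_def
  proof (intro allI impI)
    fix u :: "real^'n" and Y :: "'n cmat" assume "inj (vec_nth u)"
    then show "interp u Y (EHad EInv EDiff) = interp u Y (EConst J)"
      by (auto simp: vec_eq_iff J_def inj_def intro!: left_inverse simp del: of_real_diff)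
  qed
  from lser_cong[OF this, of h] have eq: "lser h EInv * dmat (u\<^sub>0 + h) = J"
    unfolding lser_EHad[OF h] lser_EDiff lser_EConst .
  have "dmat \<eta> $ i $ j * lser h EInv $ i $ j = dmat \<eta> $ i $ j * pmat (u\<^sub>0 + h) $ i $ j" for i j
  proof (cases "i = j")
    case False
    then have "lser h EInv $ i $ j * dmat (u\<^sub>0 + h) $ i $ j = 1"
      using arg_cong[OF eq, of "\<lambda>M. M $ i $ j"] by (simp add: J_def)
    then have "lser h EInv $ i $ j = pmat (u\<^sub>0 + h) $ i $ j"
      unfolding pmat_nth dmat_nth by (metis inverse_unique mult.commute)
    then show ?thesis by simp
  qed simp
  then show ?thesis by (simp add: vec_eq_iff)
qed

text \<open>
  The exponential of a derivation is an algebra homomorphism, so it may be applied to the polynomial that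
  defines the vector field factor by factor.
\<close>

lemma lser_dL_EPhi:
  assumes h: "norm h < \<rho>"
  shows "lser h (dL \<eta> EPhi) = iso_field (u\<^sub>0 + h) \<eta> (lser h EPhi)"
proof -
  have K: "cscale c0 (dmat \<eta>) * lser h EInv = cscale c0 (dmat \<eta>) * pmat (u\<^sub>0 + h)"
    using lser_EInv[OF h, of \<eta>] by (simp add: cscale_eq_had mult.assoc)
  then have K': "- cscale c0 (dmat \<eta>) * lser h EInv = - cscale c0 (dmat \<eta>) * pmat (u\<^sub>0 + h)"
    by simp
  show ?thesis
    unfolding interp_dL_EPhi[symmetric] dL.simps interp.simps lser_EAdd[OF h] lser_EMul[OF h] lser_EHad[OF h] lser_EConst K K' ..
qed

lemma lser_0: "lser 0 e = interp u\<^sub>0 Y e"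
proof -
  have z: "lterm 0 e (Suc m) = 0" for m
  proof -
    have "norm (lterm 0 e (Suc m)) \<le> (weight e * (2 * b) ^ deg e) * 0 ^ Suc m"
      by (rule norm_lie_term[OF b]) (simp add: dmat_def vec_eq_iff norm_vec_def L2_set_def)
    then show ?thesis by simp
  qed
  have "lterm 0 e m = (if m = 0 then interp u\<^sub>0 Y e else 0)" for m
    by (cases m) (simp_all add: z lie_term_def[where m = 0])
  then show ?thesis using sums_single[of 0 "\<lambda>_. interp u\<^sub>0 Y e"] by (simp add: lie_series_def sums_iff)
qed

lemma lser_deriv:
  assumes h: "norm h < \<rho>"
  shows "((\<lambda>t. lser (h + t *\<^sub>R \<eta>) e) has_vector_derivative lser h (dL \<eta> e)) (at 0)"
proof -
  (* For times of modulus below \<delta> the line from h in direction \<eta> stays in the ball of radius \<rho>. *)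
  define \<delta> where "\<delta> = (\<rho> - norm h) / (norm \<eta> + 1)"
  have \<delta>: "\<delta> > 0" using h by (simp add: \<delta>_def add_nonneg_pos)
  have small: "norm (h + t *\<^sub>R \<eta>) < \<rho>" if "t \<in> ball 0 \<delta>" for t
  proof -
    have "\<bar>t\<bar> * norm \<eta> \<le> \<bar>t\<bar> * (norm \<eta> + 1)" by (intro mult_left_mono) auto
    also have "\<dots> < \<rho> - norm h" using that by (simp add: \<delta>_def pos_less_divide_eq add_nonneg_pos dist_norm)
    finally show ?thesis using norm_triangle_ineq[of h "t *\<^sub>R \<eta>"] by simp
  qed
  let ?f' = "\<lambda>n t. case n of 0 \<Rightarrow> 0 | Suc k \<Rightarrow> lterm (h + t *\<^sub>R \<eta>) (dL \<eta> e) k"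
  let ?C = "weight (dL \<eta> e) * (2 * b) ^ deg (dL \<eta> e)"
  have C: "0 \<le> ?C" using b by (auto intro!: mult_nonneg_nonneg weight_nonneg)
  have "((\<lambda>t. \<Sum>n. lterm (h + t *\<^sub>R \<eta>) e n) has_vector_derivative (\<Sum>n. ?f' n 0)) (at 0)"
  proof (rule has_vector_derivative_suminf[where T = "ball 0 \<delta>" and M = "\<lambda>n. 2 * ?C * (1 / 2) ^ n"])
    show "norm (?f' n t) \<le> 2 * ?C * (1 / 2) ^ n" if "t \<in> ball 0 \<delta>" for n t
      using norm_lterm[OF small[OF that], of "dL \<eta> e" "n - 1"] C by (cases n) auto
    show "summable (\<lambda>n. 2 * ?C * (1 / 2) ^ n)" by (intro summable_mult summable_geometric) simp
    show "((\<lambda>t. lterm (h + t *\<^sub>R \<eta>) e n) has_vector_derivative ?f' n t) (at t)" for n t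
      by (rule lie_term_deriv[OF inj])
    show "summable (\<lambda>n. lterm (h + 0 *\<^sub>R \<eta>) e n)" using summable_lterm[OF h] by simp
  qed (use \<delta> in auto)
  moreover have "(\<Sum>n. ?f' n 0) = lser h (dL \<eta> e)"
  proof -
    define g where "g = (\<lambda>n. case n of 0 \<Rightarrow> 0 | Suc k \<Rightarrow> lterm h (dL \<eta> e) k)"
    have "?f' n 0 = g n" for n by (cases n) (simp_all add: g_def)
    then have "(\<Sum>n. ?f' n 0) = suminf g" by simp
    have "summable (\<lambda>n. g (Suc n))" using summable_lterm[OF h] by (simp add: g_def)
    then have "summable g" by (rule summable_Suc_iff[THEN iffD1])
    from suminf_split_head[OF this] \<open>(\<Sum>n. ?f' n 0) = suminf g\<close>
    show ?thesis by (simp add: lie_series_def g_def)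
  qed
  ultimately show ?thesis by (simp add: lie_series_def)
qed

definition "lsol u = lser (u - u\<^sub>0) EPhi"

lemma lsol_at: "lsol u\<^sub>0 = Y" by (simp add: lsol_def lser_0)

lemma solution_on_lsol: "solution_on (ball u\<^sub>0 \<rho>) lsol"
  unfolding solution_on_def
proof (intro ballI allI)
  fix u \<eta> assume "u \<in> ball u\<^sub>0 \<rho>"
  then have h: "norm (u - u\<^sub>0) < \<rho>" by (simp add: dist_norm norm_minus_commute)
  from lser_deriv[OF h, of \<eta> EPhi] show "((\<lambda>t. lsol (u + t *\<^sub>R \<eta>)) has_vector_derivative iso_field u \<eta> (lsol u)) (at 0)"
    by (simp add: lsol_def lser_dL_EPhi[OF h] algebra_simps del: dL.simps)
qed

text \<open>
  Words with the same number of occurrences of every letter contribute to the same monomial; the coefficient of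
  \<open>\<alpha>\<close> is the sum over the finitely many words with letter counts \<open>\<alpha>\<close>. There are \<open>n ^ m\<close> words of length \<open>m\<close>, which
  costs a factor \<open>n\<close> in the radius.
\<close>

lemma analytic_lsol:
  "\<exists>r>0. \<exists>c :: ('n \<Rightarrow> nat) \<Rightarrow> 'n cmat. \<forall>x\<in>ball u\<^sub>0 r.
        ((\<lambda>\<alpha>. (\<Prod>i\<in>UNIV. (x $ i - u\<^sub>0 $ i) ^ \<alpha> i) *\<^sub>R c \<alpha>) has_sum lsol x) UNIV"
proof -
  define n where "n = real CARD('n)"
  have n: "n \<ge> 1" unfolding n_def using zero_less_card_finite[where 'a = 'n] by linarith
  define C where "C = 2 * b"
  define K where "K = 8 * (2 * n\<^sup>2) * b\<^sup>2"
  have K: "K > 0" using n b(1) by (simp add: K_def)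
  define r where "r = min \<rho> (1 / (2 * K * n))"
  have r: "r > 0" "r \<le> \<rho>" "K * n * r \<le> 1 / 2" using \<rho>(1) K n by (auto simp: r_def min_def field_simps)
  define W where "W = (\<lambda>m. {w :: 'n list. length w = m})"
  have finW: "finite (W m)" for m using finite_lists_length_eq[of "UNIV :: 'n set" m] by (simp add: W_def)
  define L where "L = (\<lambda>m. {\<alpha> :: 'n \<Rightarrow> nat. sum \<alpha> UNIV = m})"
  have finL: "finite (L m)" for m
  proof (rule finite_subset)
    show "L m \<subseteq> PiE UNIV (\<lambda>_. {..m})"
      by (auto simp: L_def intro!: member_le_sum)
  qed (auto intro!: finite_PiE)
  have cntL: "count_list ` W m \<subseteq> L m" for m by (auto simp: W_def L_def sum_count_list)
  define c where "c = (\<lambda>\<alpha>. (1 / fact (sum \<alpha> UNIV)) *\<^sub>R (\<Sum>w\<in>{w \<in> W (sum \<alpha> UNIV). count_list w = \<alpha>}. word_coeff u\<^sub>0 Y w))"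
  have wc: "norm (word_coeff u\<^sub>0 Y w) \<le> C * K ^ m * fact m" if "w \<in> W m" for w m
  proof -
    have "norm (dmat (axis k 1 :: real^'n)) \<le> 2 * n\<^sup>2" for k
      using norm_dmat[of "axis k 1 :: real^'n"] by (simp add: n_def)
    then show ?thesis
      using norm_interp_dLs[OF b, of "map (\<lambda>k. axis k 1) w" "2 * n\<^sup>2" EPhi] that
      by (auto simp: word_coeff_def W_def C_def K_def)
  qed
  have "((\<lambda>\<alpha>. (\<Prod>i\<in>UNIV. (x $ i - u\<^sub>0 $ i) ^ \<alpha> i) *\<^sub>R c \<alpha>) has_sum lsol x) UNIV" if x: "x \<in> ball u\<^sub>0 r" for x
  proof (rule has_sum_graded[where d = "\<lambda>\<alpha>. sum \<alpha> UNIV" and B = C and q = "1 / 2"])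
    define h where "h = x - u\<^sub>0"
    have h: "norm h < r" using x by (simp add: h_def dist_norm norm_minus_commute)
    have xh: "x $ i - u\<^sub>0 $ i = h $ i" for i by (simp add: h_def)
    define G where "G = (\<lambda>w. (\<Prod>k\<leftarrow>w. h $ k) *\<^sub>R word_coeff u\<^sub>0 Y w)"
    have gc: "(\<Prod>i\<in>UNIV. (x $ i - u\<^sub>0 $ i) ^ \<alpha> i) *\<^sub>R c \<alpha> = (1 / fact m) *\<^sub>R (\<Sum>w\<in>{w \<in> W m. count_list w = \<alpha>}. G w)"
      if "\<alpha> \<in> L m" for \<alpha> m
    proof -
      have m: "sum \<alpha> UNIV = m" using that by (simp add: L_def)
      have "(\<Sum>w\<in>{w \<in> W m. count_list w = \<alpha>}. G w) = (\<Sum>w\<in>{w \<in> W m. count_list w = \<alpha>}. (\<Prod>i\<in>UNIV. h $ i ^ \<alpha> i) *\<^sub>R word_coeff u\<^sub>0 Y w)"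
        by (intro sum.cong refl) (auto simp: G_def prod_list_count)
      then show ?thesis by (simp add: c_def m xh scaleR_sum_right[symmetric] mult.commute)
    qed
    show "finite {\<alpha> :: 'n \<Rightarrow> nat. sum \<alpha> UNIV = m}" for m using finL[of m] by (simp add: L_def)
    show "(\<lambda>m. \<Sum>\<alpha> | sum \<alpha> UNIV = m. (\<Prod>i\<in>UNIV. (x $ i - u\<^sub>0 $ i) ^ \<alpha> i) *\<^sub>R c \<alpha>) sums lsol x"
    proof -
      have "(\<Sum>\<alpha> | sum \<alpha> UNIV = m. (\<Prod>i\<in>UNIV. (x $ i - u\<^sub>0 $ i) ^ \<alpha> i) *\<^sub>R c \<alpha>) = lterm h EPhi m" for m
      proof -
        have "(\<Sum>\<alpha>\<in>L m. (\<Prod>i\<in>UNIV. (x $ i - u\<^sub>0 $ i) ^ \<alpha> i) *\<^sub>R c \<alpha>) = (1 / fact m) *\<^sub>R (\<Sum>\<alpha>\<in>L m. \<Sum>w\<in>{w \<in> W m. count_list w = \<alpha>}. G w)"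
          unfolding scaleR_sum_right[of _ _ "L m"] by (intro sum.cong refl gc)
        also have "\<dots> = (1 / fact m) *\<^sub>R (\<Sum>w\<in>W m. G w)"
          by (simp add: sum.group[OF finW finL cntL])
        also have "\<dots> = lterm h EPhi m"
          by (simp add: lie_term_def iter_dL_expand[OF inj] G_def word_coeff_def W_def)
        finally show ?thesis by (simp add: L_def)
      qed
      moreover have "lterm h EPhi sums lsol x"
        unfolding lsol_def lie_series_def h_def[symmetric]
        using summable_lterm[of h] h r by (intro summable_sums) auto
      ultimately show ?thesis by simp
    qed
    show "(\<Sum>\<alpha> | sum \<alpha> UNIV = m. norm ((\<Prod>i\<in>UNIV. (x $ i - u\<^sub>0 $ i) ^ \<alpha> i) *\<^sub>R c \<alpha>)) \<le> C * (1 / 2) ^ m" for m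
    proof -
      have "(\<Sum>\<alpha>\<in>L m. norm ((\<Prod>i\<in>UNIV. (x $ i - u\<^sub>0 $ i) ^ \<alpha> i) *\<^sub>R c \<alpha>)) \<le>
          (\<Sum>\<alpha>\<in>L m. (1 / fact m) * (\<Sum>w\<in>{w \<in> W m. count_list w = \<alpha>}. norm (G w)))"
        by (intro sum_mono) (simp add: gc divide_right_mono norm_sum)
      also have "\<dots> = (1 / fact m) * (\<Sum>w\<in>W m. norm (G w))"
        by (simp add: sum_distrib_left[symmetric] sum.group[OF finW finL cntL] sum_divide_distrib[symmetric])
      also have "\<dots> \<le> (1 / fact m) * (\<Sum>w\<in>W m. r ^ m * (C * K ^ m * fact m))"
      proof (intro mult_left_mono sum_mono)
        fix w assume w: "w \<in> W m"
        have "\<bar>\<Prod>k\<leftarrow>w. h $ k\<bar> \<le> r ^ length w"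
        proof (induction w)
          case (Cons a w)
          have "\<bar>h $ a\<bar> \<le> r" using component_le_norm_cart[of h a] h by linarith
          then show ?case using Cons r by (auto simp: abs_mult intro!: mult_mono)
        qed simp
        then have "\<bar>\<Prod>k\<leftarrow>w. h $ k\<bar> \<le> r ^ m" using w by (simp add: W_def)
        then show "norm (G w) \<le> r ^ m * (C * K ^ m * fact m)"
          unfolding G_def norm_scaleR using wc[OF w] r by (intro mult_mono) auto
      qed simp
      also have "card (W m) = CARD('n) ^ m"
        using card_lists_length_eq[of "UNIV :: 'n set" m] by (simp add: W_def)
      then have "(1 / fact m) * (\<Sum>w\<in>W m. r ^ m * (C * K ^ m * fact m)) = C * (K * n * r) ^ m"
        by (simp add: n_def power_mult_distrib mult_ac)
      also have "\<dots> \<le> C * (1 / 2) ^ m"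
        using r n K b(1) by (intro mult_left_mono power_mono) (auto simp: C_def)
      finally show ?thesis by (simp add: L_def)
    qed
  qed auto
  then show ?thesis using r(1) by blast
qed

end

section \<open>Global solutions\<close>

text \<open>
  Convex open sets that exhaust \<open>U_id\<close> and on which both \<open>1 / (u\<^sub>i - u\<^sub>j)\<close> and \<open>u\<^sub>i - u\<^sub>j\<close> are bounded, so that the local
  solutions have a common radius.
\<close>

definition gap_box :: "real \<Rightarrow> real \<Rightarrow> (real^'n::{finite,linorder}) set" where
  "gap_box \<epsilon> R = {u. (\<forall>i j. i < j \<longrightarrow> \<epsilon> < u $ j - u $ i) \<and> norm u < R}"

lemma gap_box_subset: "0 < \<epsilon> \<Longrightarrow> gap_box \<epsilon> R \<subseteq> U_id"
  by (force simp: gap_box_def U_id_iff)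

lemma gap_box_mono: "\<epsilon>' \<le> \<epsilon> \<Longrightarrow> R \<le> R' \<Longrightarrow> gap_box \<epsilon> R \<subseteq> gap_box \<epsilon>' R'"
  by (force simp: gap_box_def)

lemma open_gap_box: "open (gap_box \<epsilon> R :: (real^'n::{finite,linorder}) set)"
proof -
  have "gap_box \<epsilon> R = (\<Inter>i. \<Inter>j\<in>{i<..}. {u :: real^'n::{finite,linorder}. \<epsilon> < u $ j - u $ i}) \<inter> ball 0 R"
    by (auto simp: gap_box_def)
  also have "open \<dots>"
    by (intro open_Int open_INT finite ballI open_Collect_less continuous_intros open_ball)
  finally show ?thesis .
qed

lemma convex_gap_box: "convex (gap_box \<epsilon> R :: (real^'n::{finite,linorder}) set)"
proof -
  have "gap_box \<epsilon> R = (\<Inter>i. \<Inter>j\<in>{i<..}. {u :: real^'n::{finite,linorder}. inner (axis j 1 - axis i 1) u > \<epsilon>}) \<inter> ball 0 R"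
    by (auto simp: gap_box_def inner_diff_left inner_axis')
  also have "convex \<dots>"
    by (intro convex_Int convex_INT convex_halfspace_gt convex_ball)
  finally show ?thesis .
qed

lemma gap_box_exhausts:
  assumes "u \<in> U_id"
  obtains \<epsilon> R where "0 < \<epsilon>" "u \<in> gap_box \<epsilon> R"
proof -
  define S where "S = insert 1 ((\<lambda>(i, j). u $ j - u $ i) ` {(i, j). i < j})"
  have S: "finite S" "S \<noteq> {}" by (auto simp: S_def)
  have "\<And>x. x \<in> S \<Longrightarrow> 0 < x" using assms by (auto simp: S_def U_id_iff)
  then have pos: "0 < Min S" using S by simp
  have "Min S / 2 < u $ j - u $ i" if "i < j" for i j
  proof -
    have "Min S \<le> u $ j - u $ i" using that S by (intro Min_le) (auto simp: S_def)
    with pos show ?thesis by linarith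
  qed
  then show ?thesis using pos by (intro that[of "Min S / 2" "norm u + 1"]) (auto simp: gap_box_def)
qed

lemma gap_box_exhausts2:
  assumes "u \<in> U_id" "v \<in> U_id"
  obtains \<epsilon> R where "0 < \<epsilon>" "u \<in> gap_box \<epsilon> R" "v \<in> gap_box \<epsilon> R"
proof -
  obtain \<epsilon>1 R1 where 1: "0 < \<epsilon>1" "u \<in> gap_box \<epsilon>1 R1" using gap_box_exhausts[OF assms(1)] .
  obtain \<epsilon>2 R2 where 2: "0 < \<epsilon>2" "v \<in> gap_box \<epsilon>2 R2" using gap_box_exhausts[OF assms(2)] .
  show ?thesis
    using 1 2 gap_box_mono[of "min \<epsilon>1 \<epsilon>2" \<epsilon>1 R1 "max R1 R2"] gap_box_mono[of "min \<epsilon>1 \<epsilon>2" \<epsilon>2 R2 "max R1 R2"]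
    by (intro that[of "min \<epsilon>1 \<epsilon>2" "max R1 R2"]) auto
qed

text \<open>
  The condition that \<open>real_analytic_on\<close> imposes at a single point.
\<close>

definition analytic_at :: "(real^'n::finite \<Rightarrow> 'n cmat) \<Rightarrow> real^'n \<Rightarrow> bool" where
  "analytic_at f a \<longleftrightarrow> (\<exists>r>0. \<exists>c :: ('n \<Rightarrow> nat) \<Rightarrow> 'n cmat. \<forall>x\<in>ball a r.
        ((\<lambda>\<alpha>. (\<Prod>i\<in>UNIV. (x $ i - a $ i) ^ \<alpha> i) *\<^sub>R c \<alpha>) has_sum f x) UNIV)"

lemma uniform_local_solutions:
  fixes K :: real
  assumes \<epsilon>: "0 < \<epsilon>"
  obtains \<rho> where "0 < \<rho>"
    "\<And>u (Y :: 'n::{finite,linorder} cmat). u \<in> gap_box \<epsilon> R \<Longrightarrow> norm Y \<le> K \<Longrightarrow>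
      \<exists>\<Phi>. \<Phi> u = Y \<and> solution_on (ball u \<rho>) \<Phi> \<and> analytic_at \<Phi> u"
proof -
  define n where "n = real CARD('n)"
  have n: "n \<ge> 1" unfolding n_def using zero_less_card_finite[where 'a = 'n] by linarith
  (* b bounds the norms of Y, pmat u and dmat u; \<rho> turns the condition of local_series into an equality. *)
  define b where "b = max 1 (max K (max (n\<^sup>2 / \<epsilon>) (2 * n\<^sup>2 * R)))"
  have b: "1 \<le> b" by (simp add: b_def)
  define \<rho> where "\<rho> = 1 / (32 * n\<^sup>2 * b\<^sup>2)"
  have \<rho>: "0 < \<rho>" "8 * (2 * n\<^sup>2 * \<rho>) * b\<^sup>2 \<le> 1 / 2" using n b by (auto simp: \<rho>_def)
  show ?thesis
  proof (rule that[OF \<rho>(1)])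
    fix u :: "real^'n::{finite,linorder}" and Y :: "'n cmat" assume u: "u \<in> gap_box \<epsilon> R" and Y: "norm Y \<le> K"
    have "norm (pmat u) \<le> (\<Sum>i\<in>(UNIV :: 'n set). \<Sum>j\<in>(UNIV :: 'n set). 1 / \<epsilon>)"
    proof (rule order_trans[OF norm_cmat_le_sum], intro sum_mono)
      fix i j :: 'n
      have "norm (pmat u $ i $ j) = inverse \<bar>u $ i - u $ j\<bar>"
        unfolding pmat_nth norm_inverse norm_of_real ..
      also have "\<dots> \<le> 1 / \<epsilon>"
      proof (cases "i = j")
        case False
        then have "\<epsilon> \<le> \<bar>u $ i - u $ j\<bar>" using u unfolding gap_box_def
          by (cases i j rule: linorder_cases) force+
        then show ?thesis using \<epsilon> by (simp add: inverse_eq_divide frac_le)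
      qed (use \<epsilon> in simp)
      finally show "norm (pmat u $ i $ j) \<le> 1 / \<epsilon>" .
    qed
    then have p: "norm (pmat u) \<le> b" by (simp add: b_def n_def power2_eq_square)
    have "norm (dmat u) \<le> 2 * n\<^sup>2 * norm u" using norm_dmat[of u] by (simp add: n_def)
    also have "\<dots> \<le> 2 * n\<^sup>2 * R" by (intro mult_left_mono) (use u in \<open>auto simp: gap_box_def\<close>)
    finally have d: "norm (dmat u) \<le> b" by (simp add: b_def)
    have Yb: "norm Y \<le> b" using Y by (simp add: b_def le_max_iff_disj)
    interpret local_series u Y b \<rho>
      using inj_U_id[of u] gap_box_subset[OF \<epsilon>] u b p d \<rho> Yb
      by unfold_locales (auto simp: n_def)
    show "\<exists>\<Phi>. \<Phi> u = Y \<and> solution_on (ball u \<rho>) \<Phi> \<and> analytic_at \<Phi> u"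
      using lsol_at solution_on_lsol analytic_lsol unfolding analytic_at_def by blast
  qed
qed

lemma solution_on_UN:
  assumes "\<And>u. u \<in> C \<Longrightarrow> \<exists>D. u \<in> D \<and> solution_on D \<Phi>"
  shows "solution_on C \<Phi>"
  using assms unfolding solution_on_def by blast

text \<open>
  Continuation by dilation from \<open>u\<^sub>0\<close>. Let \<open>S l\<close> be the box shrunk towards \<open>u\<^sub>0\<close> by the factor \<open>l\<close>. A solution on \<open>S l\<close> extends
  to \<open>S l'\<close> if \<open>l' - l\<close> is small: a point \<open>v\<close> of \<open>S l'\<close> is pulled back to the point \<open>p v\<close> of \<open>S l\<close>, which is closer
  to \<open>v\<close> than the common radius, and the extension at \<open>v\<close> is the value of the local solution centred at \<open>p v\<close>. The norm of the
  solution is constant, so the admissible step is the same throughout and finitely many steps lead to \<open>l = 1\<close>.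
\<close>

lemma box_solution:
  fixes u\<^sub>0 :: "real^'n::{finite,linorder}"
  assumes \<epsilon>: "0 < \<epsilon>" and u0: "u\<^sub>0 \<in> gap_box \<epsilon> R" and Y: "hermitian Y"
  shows "\<exists>\<Phi>. solution_on (gap_box \<epsilon> R) \<Phi> \<and> \<Phi> u\<^sub>0 = Y"
proof -
  let ?C = "gap_box \<epsilon> R :: (real^'n::{finite,linorder}) set"
  have R: "0 < R" using u0 norm_ge_zero[of u\<^sub>0] by (simp add: gap_box_def del: norm_ge_zero)
  obtain \<rho> where \<rho>: "0 < \<rho>"
    and loc: "\<And>u (Z :: 'n cmat). u \<in> ?C \<Longrightarrow> norm Z \<le> norm Y \<Longrightarrow> \<exists>\<Phi>. \<Phi> u = Z \<and> solution_on (ball u \<rho>) \<Phi> \<and> analytic_at \<Phi> u"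
    using uniform_local_solutions[OF \<epsilon>, of R "norm Y"] by metis
  define f where "f = (\<lambda>l v. u\<^sub>0 + (1 / l) *\<^sub>R (v - u\<^sub>0))"
  define S where "S = (\<lambda>l. f l -` ?C)"
  have openS: "open (S l)" for l
    unfolding S_def f_def by (intro open_vimage open_gap_box continuous_intros)
  have convS: "convex (S l)" for l
  proof (rule convexI)
    fix x y and a b :: real assume xy: "x \<in> S l" "y \<in> S l" "0 \<le> a" "0 \<le> b" "a + b = 1"
    have a: "a = 1 - b" using xy by simp
    have "f l (a *\<^sub>R x + b *\<^sub>R y) = a *\<^sub>R f l x + b *\<^sub>R f l y"
    proof -
      have "u\<^sub>0 + c *\<^sub>R ((1 - b) *\<^sub>R x + b *\<^sub>R y - u\<^sub>0) = (1 - b) *\<^sub>R (u\<^sub>0 + c *\<^sub>R (x - u\<^sub>0)) + b *\<^sub>R (u\<^sub>0 + c *\<^sub>R (y - u\<^sub>0))" for c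
        by (simp add: algebra_simps)
      then show ?thesis unfolding f_def a .
    qed
    then show "a *\<^sub>R x + b *\<^sub>R y \<in> S l"
      using xy convexD[OF convex_gap_box] by (auto simp: S_def)
  qed
  have u0S: "u\<^sub>0 \<in> S l" for l using u0 by (simp add: S_def f_def)
  have SC: "S l \<subseteq> ?C" if "0 < l" "l \<le> 1" for l
  proof
    fix v assume v: "v \<in> S l"
    have "v = (1 - l) *\<^sub>R u\<^sub>0 + l *\<^sub>R f l v" using that by (simp add: f_def algebra_simps)
    also have "\<dots> \<in> ?C" using that v u0 by (intro convexD[OF convex_gap_box]) (auto simp: S_def)
    finally show "v \<in> ?C" .
  qed
  have SU: "S l \<subseteq> U_id" if "0 < l" "l \<le> 1" for l using SC[OF that] gap_box_subset[OF \<epsilon>] by blast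
  have far: "norm (v - u\<^sub>0) \<le> l * (2 * R)" if "v \<in> S l" "0 < l" for v l
  proof -
    have "v - u\<^sub>0 = l *\<^sub>R (f l v - u\<^sub>0)" using that by (simp add: f_def)
    then have "norm (v - u\<^sub>0) = l * norm (f l v - u\<^sub>0)" using that by (metis abs_of_pos norm_scaleR)
    also have "norm (f l v - u\<^sub>0) \<le> norm (f l v) + norm u\<^sub>0" by (rule norm_triangle_ineq4)
    also have "\<dots> \<le> 2 * R" using that u0 by (simp add: S_def gap_box_def)
    finally show ?thesis using that by simp
  qed
  define Ex where "Ex = (\<lambda>l. \<exists>\<Phi>. solution_on (S l) \<Phi> \<and> \<Phi> u\<^sub>0 = Y)"
  have step: "Ex l'" if Exl: "Ex l" and l: "0 < l" "l < l'" "l' \<le> 1" and close: "(l' - l) * (2 * R) \<le> \<rho> / 2" for l l'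
  proof -
    obtain \<Phi> where \<Phi>: "solution_on (S l) \<Phi>" "\<Phi> u\<^sub>0 = Y" using Exl unfolding Ex_def by blast
    have bd: "norm (\<Phi> u) \<le> norm Y" if "u \<in> S l" for u
      using solution_on_norm[OF \<Phi>(1) convS SU u0S _ that] l Y \<Phi>(2) by simp
    have "\<exists>\<Psi>. \<Psi> u = \<Phi> u \<and> solution_on (ball u \<rho>) \<Psi>" if "u \<in> S l" for u
      using loc[OF _ bd[OF that]] SC[of l] l that by auto
    then obtain \<Psi> where \<Psi>: "\<And>u. u \<in> S l \<Longrightarrow> \<Psi> u u = \<Phi> u" "\<And>u. u \<in> S l \<Longrightarrow> solution_on (ball u \<rho>) (\<Psi> u)"
      by metis
    define p where "p = (\<lambda>v. u\<^sub>0 + (l / l') *\<^sub>R (v - u\<^sub>0))"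
    have pS: "p v \<in> S l" if "v \<in> S l'" for v
    proof -
      have "f l (p v) = f l' v" using l by (simp add: f_def p_def)
      then show ?thesis using that by (simp add: S_def)
    qed
    have near: "dist (p v) v \<le> \<rho> / 2" if "v \<in> S l'" for v
    proof -
      have "v - p v = (1 - l / l') *\<^sub>R (v - u\<^sub>0)" by (simp add: p_def algebra_simps)
      then have "dist (p v) v = (1 - l / l') * norm (v - u\<^sub>0)"
        using l by (simp add: dist_norm norm_minus_commute[of "p v"])
      also have "\<dots> \<le> (1 - l / l') * (l' * (2 * R))"
        using l far[OF that] by (intro mult_left_mono) auto
      also have "\<dots> = (l' - l) * (2 * R)" using l by (simp add: field_simps)
      finally show ?thesis using close by linarith
    qed
    have contr: "dist (p v) (p w) \<le> dist v w" for v w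
    proof -
      have "p v - p w = (l / l') *\<^sub>R (v - w)" by (simp add: p_def algebra_simps)
      then have "dist (p v) (p w) = (l / l') * dist v w" using l by (simp add: dist_norm)
      also have "\<dots> \<le> 1 * dist v w" using l by (intro mult_right_mono) auto
      finally show ?thesis by simp
    qed
    define \<Phi>' where "\<Phi>' = (\<lambda>v. \<Psi> (p v) v)"
    have "solution_on (S l') \<Phi>'"
    proof (rule solution_on_UN)
      fix v assume v: "v \<in> S l'"
      let ?D = "S l' \<inter> ball v (\<rho> / 2)"
      have D: "open ?D" by (intro open_Int openS open_ball)
      (* The local solutions centred at p v and p w agree at p w, hence on the convex overlap of their balls. *)
      have eq: "\<Psi> (p v) w = \<Phi>' w" if w: "w \<in> ?D" for w
      proof -
        have w1: "w \<in> S l'" and vw: "dist v w < \<rho> / 2" using w by auto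
        have 1: "\<Psi> (p v) (p w) = \<Phi> (p w)"
        proof (rule solution_on_unique[where C = "ball (p v) \<rho> \<inter> S l" and u = "p v"])
          show "solution_on (ball (p v) \<rho> \<inter> S l) (\<Psi> (p v))" using \<Psi>(2)[OF pS[OF v]] by (rule solution_on_subset) auto
          show "solution_on (ball (p v) \<rho> \<inter> S l) \<Phi>" using \<Phi>(1) by (rule solution_on_subset) auto
          show "p w \<in> ball (p v) \<rho> \<inter> S l" using pS[OF w1] contr[of v w] vw \<rho> by auto
        qed (use \<Psi>(1) pS[OF v] SU[of l] l \<rho> convS in \<open>auto intro!: convex_Int\<close>)
        show ?thesis unfolding \<Phi>'_def
        proof (rule solution_on_unique[where C = "ball (p v) \<rho> \<inter> ball (p w) \<rho> \<inter> S l'" and u = "p w"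
              and \<Phi> = "\<Psi> (p v)" and \<Psi> = "\<Psi> (p w)" and v = w])
          show "solution_on (ball (p v) \<rho> \<inter> ball (p w) \<rho> \<inter> S l') (\<Psi> (p v))" using \<Psi>(2)[OF pS[OF v]] by (rule solution_on_subset) auto
          show "solution_on (ball (p v) \<rho> \<inter> ball (p w) \<rho> \<inter> S l') (\<Psi> (p w))" using \<Psi>(2)[OF pS[OF w1]] by (rule solution_on_subset) auto
          show "\<Psi> (p v) (p w) = \<Psi> (p w) (p w)" using 1 \<Psi>(1)[OF pS[OF w1]] by simp
          have "dist (p v) w < \<rho>" using near[OF v] vw dist_triangle[of "p v" w v] by simp
          moreover have "dist (p w) w < \<rho>" using near[OF w1] \<rho> by simp
          ultimately show "w \<in> ball (p v) \<rho> \<inter> ball (p w) \<rho> \<inter> S l'" using w1 by simp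
          have "p w \<in> S l'"
          proof -
            have "p w = (1 - l / l') *\<^sub>R u\<^sub>0 + (l / l') *\<^sub>R w" by (simp add: p_def algebra_simps)
            also have "\<dots> \<in> S l'" using l u0S w1 by (intro convexD[OF convS]) auto
            finally show ?thesis .
          qed
          then show "p w \<in> ball (p v) \<rho> \<inter> ball (p w) \<rho> \<inter> S l'" using contr[of v w] vw \<rho> by auto
        qed (use SU[of l'] l convS in \<open>auto intro!: convex_Int\<close>)
      qed
      have "solution_on ?D (\<Psi> (p v))"
      proof (rule solution_on_subset[OF \<Psi>(2)[OF pS[OF v]]])
        show "?D \<subseteq> ball (p v) \<rho>"
        proof
          fix w assume "w \<in> ?D"
          then show "w \<in> ball (p v) \<rho>" using near[OF v] dist_triangle[of "p v" w v] by simp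
        qed
      qed
      then have "solution_on ?D \<Phi>'" by (rule solution_on_cong_open[OF D, where \<Phi> = "\<Psi> (p v)", rotated]) (rule eq)
      moreover have "v \<in> ?D" using v \<rho> by simp
      ultimately show "\<exists>D. v \<in> D \<and> solution_on D \<Phi>'" by blast
    qed
    moreover have "\<Phi>' u\<^sub>0 = Y" using \<Psi>(1)[OF u0S] \<Phi>(2) by (simp add: \<Phi>'_def p_def)
    ultimately show ?thesis unfolding Ex_def by blast
  qed
  define e where "e = \<rho> / (4 * R)"
  have e: "0 < e" "e * (2 * R) = \<rho> / 2" using \<rho> R by (auto simp: e_def)
  have ind: "Ex (min 1 (real (Suc k) * e))" for k
  proof (induction k)
    case 0
    let ?l = "min 1 (real (Suc 0) * e)"
    obtain \<Phi> where \<Phi>: "\<Phi> u\<^sub>0 = Y" "solution_on (ball u\<^sub>0 \<rho>) \<Phi>" using loc[OF u0] by blast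
    have "S ?l \<subseteq> ball u\<^sub>0 \<rho>"
    proof
      fix v assume v: "v \<in> S ?l"
      have "norm (v - u\<^sub>0) \<le> ?l * (2 * R)" using e by (intro far[OF v]) auto
      also have "\<dots> \<le> e * (2 * R)" using R by (intro mult_right_mono) auto
      finally show "v \<in> ball u\<^sub>0 \<rho>" using e \<rho> by (simp add: dist_norm norm_minus_commute)
    qed
    then show ?case unfolding Ex_def using \<Phi> solution_on_subset by blast
  next
    case (Suc k)
    let ?l = "min 1 (real (Suc k) * e)" and ?l' = "min 1 (real (Suc (Suc k)) * e)"
    have le: "?l' - ?l \<le> e" "?l \<le> ?l'" using e by (auto simp: min_def algebra_simps)
    show ?case
    proof (cases "?l = ?l'")
      case False
      show ?thesis
      proof (rule step[OF Suc])
        have "(?l' - ?l) * (2 * R) \<le> e * (2 * R)" using le R by (intro mult_right_mono) auto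
        then show "(?l' - ?l) * (2 * R) \<le> \<rho> / 2" using e by linarith
        show "0 < ?l" using e by simp
        show "?l < ?l'" using le(2) False by linarith
      qed auto
    qed (use Suc in simp)
  qed
  obtain k :: nat where "1 / e < real k" using reals_Archimedean2 by blast
  then have "1 \<le> real (Suc k) * e" using e by (simp add: field_simps)
  then have "Ex 1" using ind[of k] by (simp add: min_def)
  moreover have "S 1 = ?C" by (simp add: S_def f_def vimage_def)
  ultimately show ?thesis by (simp add: Ex_def)
qed

text \<open>
  The solutions on the boxes that contain \<open>u\<^sub>0\<close> agree with each other, because the intersection of two boxes is convex.
\<close>

theorem global_solution:
  fixes u\<^sub>0 :: "real^'n::{finite,linorder}"
  assumes u0: "u\<^sub>0 \<in> U_id" and Y: "hermitian Y"
  obtains \<Phi> where "solution_on U_id \<Phi>" "\<Phi> u\<^sub>0 = Y"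
proof -
  have *: "\<exists>\<epsilon> R \<Phi>. 0 < \<epsilon> \<and> u\<^sub>0 \<in> gap_box \<epsilon> R \<and> v \<in> gap_box \<epsilon> R \<and> solution_on (gap_box \<epsilon> R) \<Phi> \<and> \<Phi> u\<^sub>0 = Y"
    if v: "v \<in> U_id" for v :: "real^'n::{finite,linorder}"
  proof -
    obtain \<epsilon> R where b: "0 < \<epsilon>" "u\<^sub>0 \<in> gap_box \<epsilon> R" "v \<in> gap_box \<epsilon> R" using gap_box_exhausts2[OF u0 v] .
    with box_solution[OF b(1,2) Y] show ?thesis by blast
  qed
  define good where "good = (\<lambda>(v :: real^'n::{finite,linorder}) (z :: real \<times> real \<times> (real^'n::{finite,linorder} \<Rightarrow> 'n cmat)).
      0 < fst z \<and> u\<^sub>0 \<in> gap_box (fst z) (fst (snd z)) \<and> v \<in> gap_box (fst z) (fst (snd z)) \<and>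
      solution_on (gap_box (fst z) (fst (snd z))) (snd (snd z)) \<and> snd (snd z) u\<^sub>0 = Y)"
  have "\<forall>v\<in>U_id. \<exists>z. good v z"
  proof
    fix v :: "real^'n::{finite,linorder}" assume v: "v \<in> U_id"
    from *[OF v] obtain \<epsilon> R \<Phi> where "0 < \<epsilon> \<and> u\<^sub>0 \<in> gap_box \<epsilon> R \<and> v \<in> gap_box \<epsilon> R \<and> solution_on (gap_box \<epsilon> R) \<Phi> \<and> \<Phi> u\<^sub>0 = Y"
      by blast
    then show "\<exists>z. good v z"
      by (intro exI[of _ "(\<epsilon>, R, \<Phi>)"]) (simp add: good_def)
  qed
  from bchoice[OF this] obtain F where F: "\<forall>v\<in>U_id. good v (F v)"
    by blast
  define E R \<Psi> where "E = (\<lambda>v. fst (F v))" "R = (\<lambda>v. fst (snd (F v)))" "\<Psi> = (\<lambda>v. snd (snd (F v)))"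
  have H: "\<And>v. v \<in> U_id \<Longrightarrow> 0 < E v" "\<And>v. v \<in> U_id \<Longrightarrow> u\<^sub>0 \<in> gap_box (E v) (R v)"
      "\<And>v. v \<in> U_id \<Longrightarrow> v \<in> gap_box (E v) (R v)" "\<And>v. v \<in> U_id \<Longrightarrow> solution_on (gap_box (E v) (R v)) (\<Psi> v)"
      "\<And>v. v \<in> U_id \<Longrightarrow> \<Psi> v u\<^sub>0 = Y" using F by (simp_all add: E_R_\<Psi>_def good_def)
  define \<Phi> where "\<Phi> = (\<lambda>v. \<Psi> v v)"
  have "solution_on U_id \<Phi>"
  proof (rule solution_on_UN)
    fix v :: "real^'n::{finite,linorder}" assume v: "v \<in> U_id"
    let ?D = "gap_box (E v) (R v)"
    have eq: "\<Psi> v w = \<Phi> w" if w: "w \<in> ?D" for w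
    proof -
      have wU: "w \<in> U_id" using w gap_box_subset[OF H(1)[OF v]] by blast
      let ?C = "?D \<inter> gap_box (E w) (R w)"
      show ?thesis unfolding \<Phi>_def
      proof (rule solution_on_unique[where C = ?C and u = u\<^sub>0 and \<Phi> = "\<Psi> v" and \<Psi> = "\<Psi> w" and v = w])
        show "solution_on ?C (\<Psi> v)" using H(4)[OF v] by (rule solution_on_subset) auto
        show "solution_on ?C (\<Psi> w)" using H(4)[OF wU] by (rule solution_on_subset) auto
        show "convex ?C" by (intro convex_Int convex_gap_box)
        show "?C \<subseteq> U_id" using gap_box_subset[OF H(1)[OF v]] by blast
      qed (use H v wU w in auto)
    qed
    have "solution_on ?D \<Phi>" by (rule solution_on_cong_open[OF open_gap_box, where \<Phi> = "\<Psi> v", rotated]) (use eq H(4)[OF v] in auto)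
    then show "\<exists>D. v \<in> D \<and> solution_on D \<Phi>" using H(3)[OF v] by blast
  qed
  moreover have "\<Phi> u\<^sub>0 = Y" using H(5)[OF u0] by (simp add: \<Phi>_def)
  ultimately show ?thesis by (rule that)
qed

theorem solution_real_analytic:
  assumes "solution_on U_id \<Phi>"
  shows "real_analytic_on \<Phi> (U_id :: (real^'n::{finite,linorder}) set)"
  unfolding real_analytic_on_def
proof
  fix a :: "real^'n::{finite,linorder}" assume a: "a \<in> U_id"
  obtain \<epsilon> R where b: "0 < \<epsilon>" "a \<in> gap_box \<epsilon> R" using gap_box_exhausts[OF a] .
  obtain \<rho> where \<rho>: "0 < \<rho>"
    and loc: "\<And>u (Z :: 'n cmat). u \<in> gap_box \<epsilon> R \<Longrightarrow> norm Z \<le> norm (\<Phi> a) \<Longrightarrow> \<exists>\<Phi>. \<Phi> u = Z \<and> solution_on (ball u \<rho>) \<Phi> \<and> analytic_at \<Phi> u"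
    using uniform_local_solutions[OF b(1), of R "norm (\<Phi> a)"] by metis
  obtain \<Psi> where \<Psi>: "\<Psi> a = \<Phi> a" "solution_on (ball a \<rho>) \<Psi>" "analytic_at \<Psi> a" using loc[OF b(2) order_refl] by blast
  obtain r c where r: "r > 0" and c: "\<And>x. x \<in> ball a r \<Longrightarrow>
      ((\<lambda>\<alpha>. (\<Prod>i\<in>UNIV. (x $ i - a $ i) ^ \<alpha> i) *\<^sub>R c \<alpha>) has_sum \<Psi> x) UNIV"
    using \<Psi>(3) unfolding analytic_at_def by blast
  obtain s where s: "s > 0" "ball a s \<subseteq> gap_box \<epsilon> R" using open_gap_box b(2) openE by blast
  have eq: "\<Psi> x = \<Phi> x" if "x \<in> ball a (min r (min s \<rho>))" for x
  proof (rule solution_on_unique[where C = "ball a (min s \<rho>)" and u = a])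
    show "solution_on (ball a (min s \<rho>)) \<Psi>" using \<Psi>(2) by (rule solution_on_subset) auto
    have sub: "ball a (min s \<rho>) \<subseteq> ball a s" by auto
    show "ball a (min s \<rho>) \<subseteq> U_id" using sub s(2) gap_box_subset[OF b(1), of R] by blast
    then show "solution_on (ball a (min s \<rho>)) \<Phi>" using assms solution_on_subset by blast
  qed (use \<Psi>(1) s \<rho> that in auto)
  show "\<exists>r>0. \<exists>c :: ('n \<Rightarrow> nat) \<Rightarrow> 'n cmat. \<forall>x\<in>ball a r.
        ((\<lambda>\<alpha>. (\<Prod>i\<in>UNIV. (x $ i - a $ i) ^ \<alpha> i) *\<^sub>R c \<alpha>) has_sum \<Phi> x) UNIV"
  proof (intro exI[of _ "min r (min s \<rho>)"] conjI exI[of _ c] ballI)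
    show "0 < min r (min s \<rho>)" using r s \<rho> by simp
    fix x assume x: "x \<in> ball a (min r (min s \<rho>))"
    then have "x \<in> ball a r" by simp
    from c[OF this] show "((\<lambda>\<alpha>. (\<Prod>i\<in>UNIV. (x $ i - a $ i) ^ \<alpha> i) *\<^sub>R c \<alpha>) has_sum \<Phi> x) UNIV"
      unfolding eq[OF x] .
  qed
qed

section \<open>Solutions with partial derivatives only\<close>

lemma iso_field_scaleR: "iso_field u (r *\<^sub>R \<eta>) Z = r *\<^sub>R iso_field u \<eta> Z"
  using iso_field_linear[of u 0 r \<eta> Z] iso_field_linear[of u 0 1 0 Z] by simp

lemma isomonodromy_axis_step:
  assumes \<Phi>: "isomonodromy_solution \<Phi>" and \<Psi>: "solution_on U_id \<Psi>"
    and u: "u \<in> U_id" "u + \<tau> *\<^sub>R axis k 1 \<in> U_id" and eq: "\<Phi> u = \<Psi> u"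
  shows "\<Phi> (u + \<tau> *\<^sub>R axis k 1) = \<Psi> (u + \<tau> *\<^sub>R axis k 1)"
proof -
  let ?\<eta> = "\<tau> *\<^sub>R axis k 1"
  have "solves_along u ?\<eta> (\<lambda>t. \<Phi> (u + t *\<^sub>R ?\<eta>))"
    unfolding solves_along_def
  proof
    fix t :: real assume t: "t \<in> {0..1}"
    define w where "w = u + t *\<^sub>R ?\<eta>"
    have w: "w \<in> U_id" unfolding w_def using segment_U_id[OF u t] .
    have "((\<lambda>s. \<Phi> (w + s *\<^sub>R axis k 1)) \<circ> (\<lambda>s. \<tau> * s) has_vector_derivative \<tau> *\<^sub>R iso_field w (axis k 1) (\<Phi> w)) (at 0)"
      by (rule vector_diff_chain_at) (use \<Phi> w in \<open>auto simp: isomonodromy_solution_iff intro!: derivative_eq_intros\<close>)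
    then have "((\<lambda>s. \<Phi> (w + s *\<^sub>R ?\<eta>)) has_vector_derivative iso_field w ?\<eta> (\<Phi> w)) (at 0)"
      by (simp add: o_def iso_field_scaleR mult.commute)
    then show "((\<lambda>t. \<Phi> (u + t *\<^sub>R ?\<eta>)) has_vector_derivative iso_field (u + t *\<^sub>R ?\<eta>) ?\<eta> (\<Phi> (u + t *\<^sub>R ?\<eta>))) (at t)"
      unfolding w_def by (rule has_vector_derivative_shift)
  qed
  from solves_along_unique[OF u this solution_on_solves_along[OF \<Psi> convex_U_id u]] eq
  show ?thesis by simp
qed

lemma idx_pos_less: "i < j \<Longrightarrow> idx_pos i < idx_pos (j :: 'n::{finite,linorder})"
  unfolding idx_pos_def by (rule psubset_card_mono) auto

lemma idx_pos_bounds: "1 \<le> idx_pos (i :: 'n::{finite,linorder})" "idx_pos i \<le> CARD('n)"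
  by (auto simp: idx_pos_def card_mono Suc_le_eq card_gt_0_iff)

lemma idx_pos_less_iff: "idx_pos i < idx_pos j \<longleftrightarrow> i < (j :: 'n::{finite,linorder})"
  by (metis idx_pos_less less_asym less_irrefl linorder_less_linear)

text \<open>
  The point \<open>u\<close> is moved to \<open>v\<close> one coordinate at a time, the last coordinate first; as the coordinates only increase, they
  remain strictly ordered on the way.
\<close>

lemma isomonodromy_agree_mono:
  fixes u v :: "real^'n::{finite,linorder}"
  assumes \<Phi>: "isomonodromy_solution \<Phi>" and \<Psi>: "solution_on U_id \<Psi>"
    and u: "u \<in> U_id" and v: "v \<in> U_id" and le: "\<And>i. u $ i \<le> v $ i"
  shows "\<Phi> u = \<Psi> u \<longleftrightarrow> \<Phi> v = \<Psi> v"
proof -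
  define w :: "nat \<Rightarrow> real^'n::{finite,linorder}" where "w = (\<lambda>k. \<chi> i. if k < idx_pos i then v $ i else u $ i)"
  have wU: "w k \<in> U_id" for k
  proof -
    have "w k $ i < w k $ j" if "i < j" for i j
      using that u v le[of i] le[of j] idx_pos_less[OF that] by (fastforce simp: w_def U_id_iff)
    then show ?thesis by (simp add: U_id_iff)
  qed
  have "\<Phi> u = \<Psi> u \<longleftrightarrow> \<Phi> (w k) = \<Psi> (w k)" if "k \<le> CARD('n)" for k
    using that
  proof (induction k rule: inc_induct)
    case base
    have "w CARD('n) = u" using idx_pos_bounds(2)[where 'n = 'n] by (simp add: w_def vec_eq_iff not_less[symmetric])
    then show ?case by simp
  next
    case (step k)
    define i :: 'n where "i = idx (Suc k)"
    have pi: "idx_pos i = Suc k" using step.hyps by (simp add: i_def idx_pos_idx)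
    have w1: "w k = w (Suc k) + (v $ i - u $ i) *\<^sub>R axis i 1"
    proof -
      have "w k $ j = (w (Suc k) + (v $ i - u $ i) *\<^sub>R axis i 1) $ j" for j
      proof (cases "j = i")
        case False
        then have "idx_pos j \<noteq> Suc k" using pi by (metis idx_idx_pos)
        then have "k < idx_pos j \<longleftrightarrow> Suc k < idx_pos j" by linarith
        then show ?thesis using False by (simp add: w_def axis_def)
      qed (simp add: w_def pi axis_def)
      then show ?thesis by (simp add: vec_eq_iff)
    qed
    then have w2: "w (Suc k) = w k + (- (v $ i - u $ i)) *\<^sub>R axis i 1" by (simp add: scaleR_diff_left)
    have "\<Phi> (w (Suc k)) = \<Psi> (w (Suc k)) \<longleftrightarrow> \<Phi> (w k) = \<Psi> (w k)"
      using isomonodromy_axis_step[OF \<Phi> \<Psi> wU, of "Suc k" "v $ i - u $ i" i] isomonodromy_axis_step[OF \<Phi> \<Psi> wU, of k "- (v $ i - u $ i)" i]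
        w1 w2 wU by metis
    with step.IH show ?case by simp
  qed
  from this[of 0] have "\<Phi> u = \<Psi> u \<longleftrightarrow> \<Phi> (w 0) = \<Psi> (w 0)" by simp
  moreover have "w 0 = v" using idx_pos_bounds(1)[where 'n = 'n] by (simp add: w_def vec_eq_iff Suc_le_eq)
  ultimately show ?thesis by simp
qed

text \<open>
  The global solution with the same value at \<open>u\<close> is compared with \<open>\<Phi>\<close> along paths parallel to the axes, which pass through the
  coordinatewise maximum of their end points. In particular \<open>\<Phi>\<close>, which has been assumed to have partial derivatives,
  is automatically analytic.
\<close>

theorem isomonodromy_imp_solution_on:
  assumes \<Phi>: "herm_isomonodromy_solution \<Phi>"
  shows "solution_on (U_id :: (real^'n::{finite,linorder}) set) \<Phi>"
proof (rule solution_on_UN)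
  fix u :: "real^'n::{finite,linorder}" assume u: "u \<in> U_id"
  have iso: "isomonodromy_solution \<Phi>" and h: "hermitian (\<Phi> u)" using \<Phi> u by (auto simp: herm_isomonodromy_solution_def)
  obtain \<Psi> where \<Psi>: "solution_on U_id \<Psi>" "\<Psi> u = \<Phi> u" using global_solution[OF u h] .
  have "\<Psi> v = \<Phi> v" if v: "v \<in> U_id" for v
  proof -
    define m :: "real^'n::{finite,linorder}" where "m = (\<chi> i. max (u $ i) (v $ i))"
    have m: "m \<in> U_id" using u v by (force simp: m_def U_id_iff max_def)
    have "\<Phi> m = \<Psi> m" using isomonodromy_agree_mono[OF iso \<Psi>(1) u m] \<Psi>(2) by (simp add: m_def)
    then show ?thesis using isomonodromy_agree_mono[OF iso \<Psi>(1) v m] by (simp add: m_def)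
  qed
  from solution_on_cong_open[OF open_U_id this \<Psi>(1)] u
  show "\<exists>D. u \<in> D \<and> solution_on D \<Phi>" by blast
qed

lemma solution_on_imp_isomonodromy: "solution_on U_id \<Phi> \<Longrightarrow> isomonodromy_solution \<Phi>"
  by (simp add: isomonodromy_solution_iff solution_on_def)

section \<open>The matrix exponential and conjugation by unitary matrices\<close>

text \<open>
  Powers with respect to the matrix product; the operation \<open>^\<close> is the power for the entrywise product.
\<close>

definition mpow :: "'n::finite cmat \<Rightarrow> nat \<Rightarrow> 'n cmat" where
  "mpow A m = ((\<lambda>X. A ** X) ^^ m) (mat 1)"

lemma mpow_0: "mpow A 0 = mat 1" and mpow_Suc: "mpow A (Suc m) = A ** mpow A m"
  by (simp_all add: mpow_def)

lemma mat_exp_eq: "mat_exp A = (\<Sum>m. (1 / fact m) *\<^sub>R mpow A m)"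
  by (simp add: mat_exp_def mpow_def)

lemma norm_mpow:
  fixes A :: "'n::finite cmat"
  shows "norm (mpow A m) \<le> norm A ^ m * norm (mat 1 :: 'n cmat)"
proof (induction m)
  case (Suc m)
  have "norm (mpow A (Suc m)) \<le> norm A * norm (mpow A m)" by (simp add: mpow_Suc norm_matrix_mult)
  also have "\<dots> \<le> norm A * (norm A ^ m * norm (mat 1 :: 'n cmat))" by (intro mult_left_mono Suc) auto
  finally show ?case by (simp add: mult_ac)
qed (simp add: mpow_0)

lemma mpow_scaleR: "mpow (t *\<^sub>R A) m = t ^ m *\<^sub>R mpow A m"
  by (induction m) (simp_all add: mpow_0 mpow_Suc matmul.scaleR_left matmul.scaleR_right mult.commute)

lemma mpow_commute: "A ** B = B ** A \<Longrightarrow> mpow A m ** B = B ** mpow A m"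
proof (induction m)
  case (Suc m)
  have "mpow A (Suc m) ** B = A ** (mpow A m ** B)" by (simp add: mpow_Suc matrix_mul_assoc)
  also have "\<dots> = (A ** B) ** mpow A m" using Suc by (simp add: matrix_mul_assoc)
  also have "\<dots> = B ** mpow A (Suc m)" using Suc by (simp add: matrix_mul_assoc mpow_Suc)
  finally show ?case .
qed (simp add: mpow_0)

lemma exp_bound_summable: "summable (\<lambda>m. (1 / fact m) * (R ^ m * C))" for R C :: real
  using summable_mult2[OF summable_exp_generic[of R], of C] by (simp add: field_simps)

lemma norm_exp_term:
  fixes A :: "'n::finite cmat"
  shows "norm A \<le> R \<Longrightarrow> norm ((1 / fact m) *\<^sub>R mpow A m) \<le> (1 / fact m) * (R ^ m * norm (mat 1 :: 'n cmat))"
  unfolding norm_scaleR abs_of_nonneg[OF divide_nonneg_nonneg[OF zero_le_one fact_ge_zero]]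
  by (intro mult_left_mono order_trans[OF norm_mpow] mult_right_mono power_mono) auto

lemma summable_mat_exp: "summable (\<lambda>m. (1 / fact m) *\<^sub>R mpow A m)"
  by (rule summable_comparison_test'[OF exp_bound_summable]) (rule norm_exp_term[OF order_refl])

lemma bounded_linear_mat_exp:
  assumes "bounded_linear f"
  shows "f (mat_exp A) = (\<Sum>m. (1 / fact m) *\<^sub>R f (mpow A m))"
  unfolding mat_exp_eq bounded_linear.suminf[OF assms summable_mat_exp]
  by (simp add: linear_scale[OF bounded_linear.linear[OF assms]])

lemma mat_exp_commute:
  assumes "A ** B = B ** A" shows "mat_exp A ** B = B ** mat_exp A"
  using bounded_linear_mat_exp[OF matmul.bounded_linear_left[of B], of A]
    bounded_linear_mat_exp[OF matmul.bounded_linear_right[of B], of A] mpow_commute[OF assms]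
  by simp

lemma mat_exp_deriv: "((\<lambda>t. mat_exp (t *\<^sub>R A)) has_vector_derivative A ** mat_exp (t *\<^sub>R A)) (at t)"
proof -
  define R where "R = \<bar>t\<bar> + 1"
  define N where "N = norm (mat 1 :: 'a cmat)"
  let ?f' = "\<lambda>n s. case n of 0 \<Rightarrow> 0 | Suc k \<Rightarrow> (1 / fact k) *\<^sub>R (A ** mpow (s *\<^sub>R A) k)"
  let ?M = "\<lambda>n. case n of 0 \<Rightarrow> 0 | Suc k \<Rightarrow> norm A * ((1 / fact k) * ((R * norm A) ^ k * N))"
  have "((\<lambda>s. \<Sum>n. (1 / fact n) *\<^sub>R mpow (s *\<^sub>R A) n) has_vector_derivative (\<Sum>n. ?f' n t)) (at t)"
  proof (rule has_vector_derivative_suminf[where T = "ball 0 R" and M = ?M])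
    show "t \<in> ball 0 R" by (simp add: R_def)
    show "((\<lambda>s. (1 / fact n) *\<^sub>R mpow (s *\<^sub>R A) n) has_vector_derivative ?f' n s) (at s)" for n s
    proof (cases n)
      case (Suc k)
      have "((\<lambda>s. s ^ n) has_vector_derivative real n * s ^ k) (at s)"
        unfolding has_real_derivative_iff_has_vector_derivative[symmetric]
        using DERIV_pow[of n s] by (simp add: Suc)
      from has_vector_derivative_scaleR[OF this[folded has_real_derivative_iff_has_vector_derivative] has_vector_derivative_const[of "mpow A n"]]
      have "((\<lambda>s. s ^ n *\<^sub>R mpow A n) has_vector_derivative (real n * s ^ k) *\<^sub>R mpow A n) (at s)" by simp
      from bounded_linear.has_vector_derivative[OF bounded_linear_scaleR_right[of "1 / fact n"] this]
      show ?thesis by (simp add: Suc mpow_scaleR mpow_Suc matmul.scaleR_right matmul.scaleR_left divide_simps mult.commute del: of_nat_Suc)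
    qed (simp add: mpow_0)
    show "norm (?f' n s) \<le> ?M n" if "s \<in> ball 0 R" for n s
    proof (cases n)
      case (Suc k)
      have s: "norm (s *\<^sub>R A) \<le> R * norm A" using that by (simp add: mult_right_mono)
      have "norm ((1 / fact k) *\<^sub>R (A ** mpow (s *\<^sub>R A) k)) = norm (A ** ((1 / fact k) *\<^sub>R mpow (s *\<^sub>R A) k))"
        by (simp add: matmul.scaleR_right)
      also have "\<dots> \<le> norm A * ((1 / fact k) * ((R * norm A) ^ k * N))"
        unfolding N_def by (intro order_trans[OF norm_matrix_mult] mult_left_mono norm_exp_term[OF s]) auto
      finally show ?thesis by (simp add: Suc)
    qed simp
    show "summable ?M"
      by (rule summable_Suc_iff[THEN iffD1]) (simp add: summable_mult exp_bound_summable del: times_divide_eq_left)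
    show "summable (\<lambda>n. (1 / fact n) *\<^sub>R mpow (t *\<^sub>R A) n)" by (rule summable_mat_exp)
  qed auto
  moreover have "(\<Sum>n. ?f' n t) = A ** mat_exp (t *\<^sub>R A)"
  proof -
    define g where "g = (\<lambda>n. ?f' n t)"
    have "(\<lambda>k. A ** ((1 / fact k) *\<^sub>R mpow (t *\<^sub>R A) k)) sums (A ** mat_exp (t *\<^sub>R A))"
      unfolding mat_exp_eq by (intro bounded_linear.sums[OF matmul.bounded_linear_right] summable_sums summable_mat_exp)
    then have "(\<lambda>k. g (Suc k)) sums (A ** mat_exp (t *\<^sub>R A))" by (simp add: g_def matmul.scaleR_right)
    then have "g sums (A ** mat_exp (t *\<^sub>R A) + g 0)" by (rule sums_Suc)
    then show ?thesis by (simp add: g_def sums_iff)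
  qed
  ultimately show ?thesis by (simp add: mat_exp_eq)
qed

lemma mat_exp_0: "mat_exp 0 = mat 1"
proof -
  have z: "(1 / fact m) *\<^sub>R mpow 0 m = (if m = 0 then mat 1 else 0)" for m
    by (cases m) (simp_all add: mpow_0 mpow_Suc matmul.zero_left)
  show ?thesis unfolding mat_exp_eq z by (rule sums_unique[symmetric]) (rule sums_single)
qed

lemma mat_exp_minus: "mat_exp A ** mat_exp (- A) = mat 1"
proof -
  let ?h = "\<lambda>t. mat_exp (t *\<^sub>R A) ** mat_exp (t *\<^sub>R (- A))"
  have "(?h has_vector_derivative 0) (at t)" for t
  proof -
    have c: "A ** mat_exp (t *\<^sub>R A) = mat_exp (t *\<^sub>R A) ** A"
      by (rule mat_exp_commute[symmetric]) (simp add: matmul.scaleR_left matmul.scaleR_right)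
    have "mat_exp (t *\<^sub>R A) ** ((- A) ** mat_exp (t *\<^sub>R (- A))) + (A ** mat_exp (t *\<^sub>R A)) ** mat_exp (t *\<^sub>R (- A)) = 0"
      unfolding c by (simp add: matmul.minus_left matmul.minus_right matrix_mul_assoc)
    then show ?thesis
      using matmul.has_vector_derivative[OF mat_exp_deriv[of A t] mat_exp_deriv[of "- A" t]] by simp
  qed
  then obtain c where "\<And>t. ?h t = c"
    using has_vector_derivative_zero_constant[of UNIV ?h] by auto
  from this[of 0] this[of 1] show ?thesis by (simp add: mat_exp_0)
qed

lemma dagger_mat_exp: "dagger (mat_exp A) = mat_exp (dagger A)"
proof -
  have "dagger (mpow A m) = mpow (dagger A) m" for m
  proof (induction m)
    case (Suc m)
    have "dagger (mpow A (Suc m)) = dagger (mpow A m ** A)" by (simp add: mpow_Suc mpow_commute)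
    then show ?case by (simp add: dagger_mult Suc mpow_Suc)
  qed (simp add: mpow_0 vec_eq_iff mat_def)
  then show ?thesis
    unfolding bounded_linear_mat_exp[OF bounded_linear_dagger] by (simp add: mat_exp_eq)
qed

lemma continuous_mat_exp: "continuous_on UNIV (mat_exp :: 'n::finite cmat \<Rightarrow> 'n cmat)"
proof -
  have "continuous_on (ball 0 R) (mat_exp :: 'n cmat \<Rightarrow> 'n cmat)" for R
  proof (rule uniform_limit_theorem[where F = sequentially])
    have "continuous_on S (\<lambda>A :: 'n cmat. mpow A m)" for S m
      by (induction m) (auto simp: mpow_0 mpow_Suc intro!: matmul.continuous_on continuous_intros)
    then show "\<forall>\<^sub>F n in sequentially. continuous_on (ball 0 R) (\<lambda>A :: 'n cmat. \<Sum>m<n. (1 / fact m) *\<^sub>R mpow A m)"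
      by (intro always_eventually allI continuous_intros)
    show "uniform_limit (ball 0 R) (\<lambda>n A :: 'n cmat. \<Sum>m<n. (1 / fact m) *\<^sub>R mpow A m) mat_exp sequentially"
      unfolding mat_exp_eq[abs_def]
      by (rule Weierstrass_m_test[OF _ exp_bound_summable[of R]]) (rule norm_exp_term, simp)
  qed simp
  then have "isCont (mat_exp :: 'n cmat \<Rightarrow> 'n cmat) A" for A
    by (metis continuous_on_interior interior_ball dist_0_norm less_add_one mem_ball)
  then show ?thesis by (simp add: continuous_at_imp_continuous_on)
qed

definition unitary :: "'n::finite cmat \<Rightarrow> bool" where
  "unitary g \<longleftrightarrow> dagger g ** g = mat 1 \<and> g ** dagger g = mat 1"

text \<open>
  Agrees with \<open>Ad\<close> on unitary matrices, and is continuous in \<open>g\<close> without any case distinction on invertibility.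
\<close>

definition uconj :: "'n::finite cmat \<Rightarrow> 'n cmat \<Rightarrow> 'n cmat" where
  "uconj g X = g ** X ** dagger g"

lemma Ad_unitary: "unitary g \<Longrightarrow> Ad g X = uconj g X"
proof -
  assume g: "unitary g"
  then have "\<exists>h. g ** h = mat 1 \<and> h ** g = mat 1" unfolding unitary_def by blast
  then have i: "g ** matrix_inv g = mat 1" unfolding matrix_inv_def by (metis (lifting) someI_ex)
  have "matrix_inv g = dagger g ** g ** matrix_inv g" using g by (simp add: unitary_def)
  also have "\<dots> = dagger g" using i by (simp add: matrix_mul_assoc[symmetric])
  finally show ?thesis by (simp add: Ad_def uconj_def)
qed

lemma unitary_1: "unitary (mat 1)"
proof -
  have "dagger (mat 1 :: 'a cmat) = mat 1" by (simp add: vec_eq_iff mat_def)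
  then show ?thesis by (simp add: unitary_def)
qed

lemma unitary_mult: "unitary g \<Longrightarrow> unitary h \<Longrightarrow> unitary (g ** h)"
proof -
  assume g: "unitary g" and h: "unitary h"
  have "dagger (g ** h) ** (g ** h) = dagger h ** (dagger g ** g) ** h" by (simp add: dagger_mult matrix_mul_assoc)
  also have "\<dots> = mat 1" using g h by (simp add: unitary_def)
  finally have 1: "dagger (g ** h) ** (g ** h) = mat 1" .
  have "(g ** h) ** dagger (g ** h) = g ** (h ** dagger h) ** dagger g" by (simp add: dagger_mult matrix_mul_assoc)
  also have "\<dots> = mat 1" using g h by (simp add: unitary_def)
  finally show ?thesis using 1 by (simp add: unitary_def)
qed

lemma unitary_mat_exp: "dagger A = - A \<Longrightarrow> unitary (mat_exp A)"
  using mat_exp_minus[of A] mat_exp_minus[of "- A"] by (simp add: unitary_def dagger_mat_exp)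

lemma uconj_mult: "uconj (g ** h) X = uconj g (uconj h X)"
  by (simp add: uconj_def dagger_mult matrix_mul_assoc)

lemma uconj_1: "uconj (mat 1) X = X"
proof -
  have "dagger (mat 1 :: 'a cmat) = mat 1" by (simp add: vec_eq_iff mat_def)
  then show ?thesis by (simp add: uconj_def)
qed

lemma norm_uconj: assumes "unitary g" shows "norm (uconj g X) = norm X"
proof -
  have "inner (uconj g X) (uconj g X) = inner X (dagger g ** (uconj g X ** g))"
    using inner_mult_right[of "g ** X" "dagger g" "uconj g X"] inner_mult_left[of g X "uconj g X ** g"]
    by (simp add: uconj_def)
  also have "dagger g ** (uconj g X ** g) = (dagger g ** g) ** X ** (dagger g ** g)"
    by (simp add: uconj_def matrix_mul_assoc)
  finally show ?thesis using assms by (simp add: unitary_def norm_eq_sqrt_inner)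
qed

lemma linear_uconj: "linear (uconj g)"
  by (rule linearI) (simp_all add: uconj_def matmul.add_left matmul.add_right matmul.scaleR_left matmul.scaleR_right)

lemma uconj_diff: "uconj g (X - Y) = uconj g X - uconj g Y" by (rule linear_diff[OF linear_uconj])

lemma hermitian_uconj: "hermitian X \<Longrightarrow> hermitian (uconj g X)"
  by (simp add: hermitian_iff_dagger uconj_def dagger_mult matrix_mul_assoc)

lemma uconj_ad: assumes "unitary g" shows "uconj g (ad A B) = ad (uconj g A) (uconj g B)"
proof -
  have "uconj g A ** uconj g B = g ** A ** (dagger g ** g) ** B ** dagger g" for A B
    by (simp add: uconj_def matrix_mul_assoc)
  then have *: "uconj g A ** uconj g B = uconj g (A ** B)" for A B
    unfolding assms[unfolded unitary_def, THEN conjunct1] by (simp add: uconj_def matrix_mul_assoc)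
  show ?thesis by (simp add: ad_def uconj_diff *)
qed

lemma uconj_commuting: "unitary g \<Longrightarrow> g ** X = X ** g \<Longrightarrow> uconj g X = X"
  by (simp add: uconj_def matrix_mul_assoc[symmetric] unitary_def)

lemma uconj_cscale: "uconj g (cscale c X) = cscale c (uconj g X)"
  by (simp add: uconj_def cscale_mult_left cscale_mult_right)

section \<open>The leading term as a solution of the limiting system\<close>

definition delta_mask :: "nat \<Rightarrow> 'n::{finite,linorder} cmat" where
  "delta_mask k = (\<chi> i j. if (idx_pos i \<le> k \<and> idx_pos j \<le> k) \<or> i = j then 1 else 0)"

lemma delta_eq_mask: "delta k X = delta_mask k * X"
  by (simp add: delta_def delta_mask_def vec_eq_iff)

lemma delta_nth: "delta k M $ i $ j = (if (idx_pos i \<le> k \<and> idx_pos j \<le> k) \<or> i = j then M $ i $ j else 0)"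
  by (simp add: delta_def)

lemma norm_delta_le: "norm (delta k X) \<le> norm X"
  using norm_hadamard_bound[of "delta_mask k" 1 X] by (simp add: delta_eq_mask delta_mask_def)

lemma linear_delta: "linear (delta k)"
  by (rule linearI) (simp_all add: delta_eq_mask algebra_simps)

lemma bounded_linear_delta: "bounded_linear (delta k)"
  using linear_delta by (simp add: linear_conv_bounded_linear)

lemma delta_diff: "delta k (X - Y) = delta k X - delta k Y" by (rule linear_diff[OF linear_delta])

lemma delta_cscale: "delta k (cscale c X) = cscale c (delta k X)"
  by (simp add: vec_eq_iff delta_nth)

lemma dagger_delta: "dagger (delta k X) = delta k (dagger X)"
  by (auto simp: vec_eq_iff delta_nth)

lemma hermitian_delta: "hermitian X \<Longrightarrow> hermitian (delta k X)"
  by (simp add: hermitian_iff_dagger dagger_delta)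

lemma delta_delta_le: "j \<le> k \<Longrightarrow> delta j (delta k X) = delta j X" and delta_delta_ge: "j \<le> k \<Longrightarrow> delta k (delta j X) = delta j X"
  by (auto simp: vec_eq_iff delta_nth)

lemma delta_card:
  fixes X :: "'n::{finite,linorder} cmat"
  shows "CARD('n) \<le> k \<Longrightarrow> delta k X = X"
  using order_trans[OF idx_pos_bounds(2)] by (auto simp: vec_eq_iff delta_nth)

text \<open>
  The range of \<open>delta k\<close> is the algebra of matrices consisting of a \<open>k \<times> k\<close> block and a diagonal rest, and \<open>delta k\<close> is
  the projection onto it. Like a conditional expectation it is linear over this algebra on both sides.
\<close>

lemma delta_mult_left: "delta k A = A \<Longrightarrow> delta k (A ** Y) = A ** delta k Y"
proof -
  assume A: "delta k A = A"
  have A0: "A $ i $ j = 0" if "\<not> ((idx_pos i \<le> k \<and> idx_pos j \<le> k) \<or> i = j)" for i j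
    using arg_cong[OF A, of "\<lambda>M. M $ i $ j"] that by (simp add: delta_nth split: if_splits)
  have "delta k (A ** Y) $ i $ j = (A ** delta k Y) $ i $ j" for i j
  proof (cases "(idx_pos i \<le> k \<and> idx_pos j \<le> k) \<or> i = j")
    case True
    have "A $ i $ l * Y $ l $ j = A $ i $ l * delta k Y $ l $ j" for l
      using True A0[of i l] by (cases "(idx_pos i \<le> k \<and> idx_pos l \<le> k) \<or> i = l") (auto simp: delta_nth)
    then have "(\<Sum>l\<in>UNIV. A $ i $ l * Y $ l $ j) = (\<Sum>l\<in>UNIV. A $ i $ l * delta k Y $ l $ j)"
      by (intro sum.cong refl)
    then show ?thesis using True by (simp add: delta_nth[of k "A ** Y"] matrix_mult_nth)
  next
    case False
    have "A $ i $ l * delta k Y $ l $ j = 0" for l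
      using False A0[of i l] by (cases "(idx_pos i \<le> k \<and> idx_pos l \<le> k) \<or> i = l") (auto simp: delta_nth)
    then have "(A ** delta k Y) $ i $ j = 0" unfolding matrix_mult_nth by (intro sum.neutral ballI)
    then show ?thesis using False by (auto simp: delta_nth[of k "A ** Y"])
  qed
  then show ?thesis by (simp add: vec_eq_iff)
qed

lemma delta_mult_right: "delta k A = A \<Longrightarrow> delta k (Y ** A) = delta k Y ** A"
  using delta_mult_left[of k "dagger A" "dagger Y"] dagger_dagger
  by (metis dagger_delta dagger_mult)

lemma delta_1: "delta k (mat 1) = mat 1"
  by (simp add: vec_eq_iff delta_nth mat_def)

lemma delta_mat_exp: assumes "delta k A = A" shows "delta k (mat_exp A) = mat_exp A"
proof -
  have "delta k (mpow A m) = mpow A m" for m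
    by (induction m) (simp_all add: mpow_0 mpow_Suc delta_1 delta_mult_left[OF assms])
  then show ?thesis unfolding bounded_linear_mat_exp[OF bounded_linear_delta] by (simp add: mat_exp_eq)
qed

lemma delta_uconj: assumes "delta k g = g" shows "delta k (uconj g X) = uconj g (delta k X)"
proof -
  have "delta k (dagger g) = dagger g" using assms by (metis dagger_delta)
  then show ?thesis by (simp add: uconj_def delta_mult_right delta_mult_left[OF assms])
qed

text \<open>
  Conjugation by \<open>flow r k Z\<close> is the flow of \<open>c [\<delta>\<^sub>k Z, Z]\<close> for the time \<open>r\<close>, since \<open>\<delta>\<^sub>k Z\<close> does not change along it.
\<close>

definition flow :: "real \<Rightarrow> nat \<Rightarrow> 'n::{finite,linorder} cmat \<Rightarrow> 'n cmat" where
  "flow r k Z = mat_exp (r *\<^sub>R cscale c0 (delta k Z))"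

lemma dagger_scaleR: "dagger (r *\<^sub>R A) = r *\<^sub>R dagger A"
  by (rule linear_scale[OF bounded_linear.linear[OF bounded_linear_dagger]])

lemma skew_delta: "hermitian Z \<Longrightarrow> dagger (cscale c0 (delta k Z)) = - cscale c0 (delta k Z)"
  unfolding dagger_cscale cnj_c0 using hermitian_delta[of Z k]
  by (simp add: hermitian_iff_dagger) (simp add: vec_eq_iff)

lemma unitary_flow: "hermitian Z \<Longrightarrow> unitary (flow r k Z)"
  unfolding flow_def by (rule unitary_mat_exp) (simp add: dagger_scaleR skew_delta)

lemma delta_flow: "j \<le> k \<Longrightarrow> delta k (flow r j Z) = flow r j Z"
  unfolding flow_def by (rule delta_mat_exp)
    (simp add: linear_scale[OF linear_delta] delta_cscale delta_delta_ge)

lemma uconj_flow_delta: "hermitian Z \<Longrightarrow> uconj (flow r k Z) (delta k Z) = delta k Z"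
  by (rule uconj_commuting[OF unitary_flow])
    (auto simp: flow_def cscale_mult_left cscale_mult_right matmul.scaleR_left matmul.scaleR_right intro!: mat_exp_commute)

lemma flow_minus: "hermitian Z \<Longrightarrow> flow r k Z ** flow (- r) k Z = mat 1"
  using mat_exp_minus[of "r *\<^sub>R cscale c0 (delta k Z)"] by (simp add: flow_def)

lemma flow_cong: "delta k Z = delta k Z' \<Longrightarrow> flow r k Z = flow r k Z'"
  by (simp add: flow_def)

text \<open>
  The leading term is \<open>Z\<close> conjugated by \<open>g\<^sub>1 g\<^sub>2 \<cdots> g\<^sub>n\<^sub>-\<^sub>1\<close> with \<open>g\<^sub>k = flow (s k) k Z\<close>. For every \<open>k\<close> it splits into a conjugation by the head
  \<open>gprod s Z k = g\<^sub>1 \<cdots> g\<^sub>k\<close>, which lies in the \<open>k\<close>-th block algebra, and \<open>ytail s Z d\<close>, the conjugate of \<open>Z\<close> by the last \<open>d\<close> factors, which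
  has the same \<open>k\<close>-th block as \<open>Z\<close>.
\<close>

primrec gprod :: "(nat \<Rightarrow> real) \<Rightarrow> 'n::{finite,linorder} cmat \<Rightarrow> nat \<Rightarrow> 'n cmat" where
  "gprod s Z 0 = mat 1"
| "gprod s Z (Suc k) = gprod s Z k ** flow (s (Suc k)) (Suc k) Z"

primrec ytail :: "(nat \<Rightarrow> real) \<Rightarrow> 'n::{finite,linorder} cmat \<Rightarrow> nat \<Rightarrow> 'n cmat" where
  "ytail s Z 0 = Z"
| "ytail s Z (Suc d) = uconj (flow (s (CARD('n) - 1 - d)) (CARD('n) - 1 - d) Z) (ytail s Z d)"

definition model :: "'n::{finite,linorder} cmat \<Rightarrow> (nat \<Rightarrow> real) \<Rightarrow> 'n cmat" where
  "model Z s = uconj (gprod s Z (CARD('n) - 1)) Z"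

lemma unitary_gprod: "hermitian Z \<Longrightarrow> unitary (gprod s Z k)"
  by (induction k) (auto intro: unitary_1 unitary_mult unitary_flow)

lemma delta_gprod: "j \<le> k \<Longrightarrow> delta k (gprod s Z j) = gprod s Z j"
proof (induction j)
  case (Suc j)
  then show ?case by (simp add: delta_mult_left[where A = "gprod s Z j"] delta_flow)
qed (simp add: delta_1)

lemma hermitian_model: "hermitian Z \<Longrightarrow> hermitian (model Z s)"
  by (simp add: model_def hermitian_uconj)

lemma norm_model: "hermitian Z \<Longrightarrow> norm (model Z s) = norm Z"
  by (simp add: model_def norm_uconj unitary_gprod)

lemma gprod_cong: "(\<And>i. 1 \<le> i \<Longrightarrow> i \<le> k \<Longrightarrow> s i = s' i) \<Longrightarrow> (\<And>i. 1 \<le> i \<Longrightarrow> i \<le> k \<Longrightarrow> delta i Z = delta i Z') \<Longrightarrow> gprod s Z k = gprod s' Z' k"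
  by (induction k) (auto intro!: arg_cong2[of _ _ _ _ "(**)"] flow_cong)

lemma ytail_cong:
  fixes Z :: "'n::{finite,linorder} cmat"
  shows "d \<le> CARD('n) - 1 \<Longrightarrow> (\<And>i. CARD('n) - 1 - d < i \<Longrightarrow> s i = s' i) \<Longrightarrow> ytail s Z d = ytail s' Z d"
  by (induction d) auto

lemma model_split:
  fixes Z :: "'n::{finite,linorder} cmat"
  shows "d \<le> CARD('n) - 1 \<Longrightarrow> model Z s = uconj (gprod s Z (CARD('n) - 1 - d)) (ytail s Z d)"
proof (induction d)
  case (Suc d)
  define k where "k = CARD('n) - 1 - Suc d"
  have k: "CARD('n) - 1 - d = Suc k" "CARD('n) - Suc d = Suc k" using Suc.prems by (simp_all add: k_def)
  show ?case using Suc unfolding k_def[symmetric] by (simp add: k uconj_mult)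
qed (simp add: model_def)

text \<open>
  The factor with index \<open>k\<close> commutes with \<open>\<delta>\<^sub>k Z\<close>; and once the block of size \<open>k\<close> is known, so are the smaller ones.
\<close>

lemma delta_ytail:
  fixes Z :: "'n::{finite,linorder} cmat"
  assumes Z: "hermitian Z"
  shows "d \<le> CARD('n) - 1 \<Longrightarrow> j \<le> CARD('n) - d \<Longrightarrow> delta j (ytail s Z d) = delta j Z"
proof (induction d arbitrary: j)
  case (Suc d)
  define k where "k = CARD('n) - 1 - d"
  have jk: "j \<le> k" using Suc.prems by (simp add: k_def)
  have "delta k (ytail s Z (Suc d)) = uconj (flow (s k) k Z) (delta k (ytail s Z d))"
    unfolding ytail.simps k_def[symmetric] by (rule delta_uconj[OF delta_flow]) simp
  also have "\<dots> = uconj (flow (s k) k Z) (delta k Z)"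
    using Suc.IH[of k] Suc.prems by (simp add: k_def)
  also have "\<dots> = delta k Z" by (rule uconj_flow_delta[OF Z])
  finally show ?case using delta_delta_le[OF jk] by metis
qed simp

lemma delta_model:
  fixes Z :: "'n::{finite,linorder} cmat"
  assumes Z: "hermitian Z" and k: "1 \<le> k" "k \<le> CARD('n)"
  shows "delta k (model Z s) = uconj (gprod s Z (k - 1)) (delta k Z)"
proof -
  define d where "d = CARD('n) - k"
  have d: "d \<le> CARD('n) - 1" "CARD('n) - 1 - d = k - 1" "k \<le> CARD('n) - d" using k by (auto simp: d_def)
  show ?thesis unfolding model_split[OF d(1)] d(2)
    by (subst delta_uconj[OF delta_gprod]) (simp_all add: delta_ytail[OF Z d(1,3)])
qed

text \<open>
  Only the factor with index \<open>k\<close> depends on \<open>s k\<close>. Its logarithmic derivative, moved through the head of the product, is the block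
  \<open>\<delta>\<^sub>k\<close> of the leading term by \<open>delta_model\<close>.
\<close>

lemma model_deriv:
  fixes Z :: "'n::{finite,linorder} cmat"
  assumes Z: "hermitian Z" and k: "1 \<le> k" "k \<le> CARD('n) - 1"
  shows "((\<lambda>r. model Z (s(k := r))) has_vector_derivative
     cscale c0 (ad (delta k (model Z (s(k := r)))) (model Z (s(k := r))))) (at r)"
proof -
  define d where "d = CARD('n) - 1 - k"
  have d: "d \<le> CARD('n) - 1" "CARD('n) - 1 - d = k" "k \<le> CARD('n)" using k by (auto simp: d_def)
  define g where "g = gprod s Z (k - 1)"
  define Y where "Y = ytail s Z d"
  have g: "gprod (s(k := r)) Z (k - 1) = g" for r unfolding g_def using k by (intro gprod_cong) auto
  have gk: "gprod (s(k := r)) Z k = g ** flow r k Z" for r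
    using k g[of r] by (cases k) auto
  have y: "ytail (s(k := r)) Z d = Y" for r unfolding Y_def using d by (intro ytail_cong) auto
  have m: "model Z (s(k := r)) = uconj g (uconj (flow r k Z) Y)" for r
    unfolding model_split[OF d(1)] d(2) gk y uconj_mult ..
  define A where "A = cscale c0 (delta k Z)"
  have skew: "dagger A = - A" unfolding A_def by (rule skew_delta[OF Z])
  have E: "((\<lambda>r. flow r k Z) has_vector_derivative A ** flow r k Z) (at r)"
    unfolding flow_def A_def by (rule mat_exp_deriv)
  have "((\<lambda>r. uconj (flow r k Z) Y) has_vector_derivative
     (flow r k Z ** Y) ** dagger (A ** flow r k Z) + (flow r k Z ** 0 + (A ** flow r k Z) ** Y) ** dagger (flow r k Z)) (at r)"
    unfolding uconj_def
    by (intro matmul.has_vector_derivative bounded_linear.has_vector_derivative[OF bounded_linear_dagger] E has_vector_derivative_const)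
  moreover have "(flow r k Z ** Y) ** dagger (A ** flow r k Z) + (flow r k Z ** 0 + (A ** flow r k Z) ** Y) ** dagger (flow r k Z)
      = ad A (uconj (flow r k Z) Y)"
    by (simp add: ad_def uconj_def dagger_mult skew matmul.zero_right matmul.minus_right matrix_mul_assoc)
  ultimately have "((\<lambda>r. uconj (flow r k Z) Y) has_vector_derivative ad A (uconj (flow r k Z) Y)) (at r)" by simp
  from bounded_linear.has_vector_derivative[OF linear_conv_bounded_linear[THEN iffD1, OF linear_uconj[of g]] this]
  have "((\<lambda>r. model Z (s(k := r))) has_vector_derivative ad (uconj g A) (model Z (s(k := r)))) (at r)"
    unfolding m uconj_ad[OF unitary_gprod[OF Z], folded g_def] by (simp add: g_def uconj_ad[OF unitary_gprod[OF Z]])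
  moreover have "uconj g A = cscale c0 (delta k (model Z (s(k := r))))"
    unfolding delta_model[OF Z k(1) d(3)] g A_def uconj_cscale ..
  ultimately show ?thesis by (simp add: ad_def cscale_mult_left cscale_mult_right linear_diff[OF bounded_linear.linear[OF bounded_linear_cscale]])
qed

text \<open>
  The flows are undone in the order \<open>1, \<dots>, n - 1\<close>. Undoing the \<open>k\<close>-th one keeps the blocks of size at most \<open>k\<close>, so the block
  that determines each factor is the one of the final matrix \<open>Z\<close>.
\<close>

lemma model_inverse:
  fixes X :: "'n::{finite,linorder} cmat"
  assumes X: "hermitian X"
  obtains Z where "hermitian Z" "model Z s = X"
proof -
  define f where "f = rec_nat X (\<lambda>k Y. uconj (flow (- s (Suc k)) (Suc k) Y) Y)"
  have f0: "f 0 = X" and fS: "f (Suc k) = uconj (flow (- s (Suc k)) (Suc k) (f k)) (f k)" for k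
    by (simp_all add: f_def)
  have h: "hermitian (f k)" for k by (induction k) (simp_all add: f0 fS X hermitian_uconj)
  have dS: "delta (Suc k) (f (Suc k)) = delta (Suc k) (f k)" for k
    unfolding fS by (subst delta_uconj[OF delta_flow]) (simp_all add: uconj_flow_delta[OF h])
  have dk: "delta (Suc j) (f (j + d)) = delta (Suc j) (f j)" for j d
  proof (induction d)
    case (Suc d)
    have "delta (Suc j) (f (j + Suc d)) = delta (Suc j) (delta (Suc (j + d)) (f (Suc (j + d))))"
      by (simp add: delta_delta_le)
    then show ?case using Suc by (simp add: dS delta_delta_le)
  qed simp
  let ?Z = "f (CARD('n) - 1)"
  have "X = uconj (gprod s ?Z k) (f k)" if "k \<le> CARD('n) - 1" for k
    using that
  proof (induction k)
    case (Suc k)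
    have "flow (s (Suc k)) (Suc k) ?Z = flow (s (Suc k)) (Suc k) (f k)"
      using dk[of k "CARD('n) - 1 - k"] Suc.prems by (intro flow_cong) simp
    then have "uconj (flow (s (Suc k)) (Suc k) ?Z) (f (Suc k)) = uconj (flow (s (Suc k)) (Suc k) (f k) ** flow (- s (Suc k)) (Suc k) (f k)) (f k)"
      by (simp add: fS uconj_mult)
    also have "\<dots> = f k" by (simp add: flow_minus[OF h] uconj_1)
    finally show ?case using Suc by (simp add: uconj_mult)
  qed (simp add: f0 uconj_1)
  from this[of "CARD('n) - 1"] show ?thesis
    by (intro that[of ?Z]) (simp_all add: h model_def)
qed

lemma model_continuous:
  assumes "(f \<longlongrightarrow> Z) F"
  shows "((\<lambda>x. model (f x) s) \<longlongrightarrow> model Z s) F"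
proof -
  have e: "((\<lambda>x. mat_exp (h x)) \<longlongrightarrow> mat_exp H) F" if "(h \<longlongrightarrow> H) F" for h H
    by (rule continuous_on_tendsto_compose[OF continuous_mat_exp that]) auto
  have fl: "((\<lambda>x. flow r k (f x)) \<longlongrightarrow> flow r k Z) F" for r k
    unfolding flow_def
    by (intro e tendsto_scaleR tendsto_const bounded_linear.tendsto[OF bounded_linear_cscale] bounded_linear.tendsto[OF bounded_linear_delta] assms)
  have "((\<lambda>x. gprod s (f x) k) \<longlongrightarrow> gprod s Z k) F" for k
    by (induction k) (auto intro!: matmul.tendsto fl)
  then show ?thesis unfolding model_def uconj_def
    by (intro matmul.tendsto bounded_linear.tendsto[OF bounded_linear_dagger] assms)
qed

text \<open>
  If the blocks of size less than \<open>k\<close> agree, then the \<open>k\<close>-th blocks of the two leading terms are conjugates of \<open>\<delta>\<^sub>k Z\<close> and \<open>\<delta>\<^sub>k Z'\<close> by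
  the same unitary matrix, and their distance does not depend on \<open>s\<close>.
\<close>

lemma model_determines:
  fixes Z :: "'n::{finite,linorder} cmat"
  assumes Z: "hermitian Z" and Z': "hermitian Z'"
    and close: "\<And>e. e > 0 \<Longrightarrow> \<exists>s. norm (model Z s - model Z' s) < e"
  shows "Z = Z'"
proof -
  have "1 \<le> k \<longrightarrow> k \<le> CARD('n) \<longrightarrow> delta k Z = delta k Z'" for k
  proof (induction k rule: less_induct)
    case (less k)
    show ?case
    proof (intro impI)
      assume k: "1 \<le> k" "k \<le> CARD('n)"
      have "norm (delta k Z - delta k Z') < e" if e: "e > 0" for e
      proof -
        obtain s where s: "norm (model Z s - model Z' s) < e" using close[OF e] by blast
        have g: "gprod s Z (k - 1) = gprod s Z' (k - 1)" using less k by (intro gprod_cong) auto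
        have "norm (delta k Z - delta k Z') = norm (uconj (gprod s Z (k - 1)) (delta k Z - delta k Z'))"
          by (simp add: norm_uconj unitary_gprod Z)
        also have "\<dots> = norm (delta k (model Z s - model Z' s))"
          unfolding uconj_diff delta_diff delta_model[OF Z k] delta_model[OF Z' k] g ..
        also have "\<dots> \<le> norm (model Z s - model Z' s)" by (rule norm_delta_le)
        finally show ?thesis using s by simp
      qed
      then have "norm (delta k Z - delta k Z') \<le> 0" by (meson not_less order_less_irrefl)
      then show "delta k Z = delta k Z'" by simp
    qed
  qed
  from this[of "CARD('n)"] show ?thesis by (simp add: delta_card Suc_le_eq)
qed

section \<open>Logarithmic gap coordinates\<close>

text \<open>
  Points of \<open>U_id\<close> with first coordinate \<open>0\<close>, parametrized by \<open>s\<^sub>1 = log (u\<^sub>2 - u\<^sub>1)\<close> and the logarithms \<open>s\<^sub>k\<close> of the gap ratios: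
  \<open>gapl s l\<close> is the \<open>l\<close>-th gap and \<open>upos s j\<close> the \<open>j\<close>-th coordinate.
\<close>

definition gapl :: "(nat \<Rightarrow> real) \<Rightarrow> nat \<Rightarrow> real" where
  "gapl s l = exp (\<Sum>m\<in>{1..l}. s m)"

definition upos :: "(nat \<Rightarrow> real) \<Rightarrow> nat \<Rightarrow> real" where
  "upos s j = (\<Sum>l\<in>{1..<j}. gapl s l)"

definition pt :: "(nat \<Rightarrow> real) \<Rightarrow> real^'n::{finite,linorder}" where
  "pt s = (\<chi> i. upos s (idx_pos i))"

lemma gapl_pos: "0 < gapl s l" by (simp add: gapl_def)

lemma upos_Suc: "1 \<le> j \<Longrightarrow> upos s (Suc j) = upos s j + gapl s j"
  by (simp add: upos_def)

lemma upos_1: "upos s (Suc 0) = 0" by (simp add: upos_def)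

lemma upos_diff: "1 \<le> a \<Longrightarrow> a \<le> b \<Longrightarrow> upos s b - upos s a = (\<Sum>l\<in>{a..<b}. gapl s l)"
  unfolding upos_def using sum.atLeastLessThan_concat[of 1 a b "gapl s"] by linarith

lemma upos_mono: "1 \<le> a \<Longrightarrow> a \<le> b \<Longrightarrow> upos s a \<le> upos s b"
proof -
  assume ab: "1 \<le> a" "a \<le> b"
  have "0 \<le> (\<Sum>l\<in>{a..<b}. gapl s l)" by (intro sum_nonneg less_imp_le gapl_pos)
  then show ?thesis using upos_diff[OF ab, of s] by simp
qed

lemma upos_strict_mono: "1 \<le> a \<Longrightarrow> a < b \<Longrightarrow> upos s a < upos s b"
  using upos_Suc[of a s] upos_mono[of "Suc a" b s] gapl_pos[of s a] by simp

lemma upos_gap_le: "1 \<le> a \<Longrightarrow> a \<le> k \<Longrightarrow> k < b \<Longrightarrow> gapl s k \<le> upos s b - upos s a"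
  using upos_mono[of "Suc k" b s] upos_mono[of a k s] upos_Suc[of k s] by simp

lemma pt_in_U_id: "pt s \<in> U_id"
  unfolding U_id_iff
proof (intro allI impI)
  fix i j :: 'a assume "i < j"
  then show "pt s $ i < pt s $ j"
    using upos_strict_mono[OF idx_pos_bounds(1) idx_pos_less] by (simp add: pt_def)
qed

lemma gapl_upd: "gapl (s(k := r)) l = (if 1 \<le> k \<and> k \<le> l then exp (r - s k) * gapl s l else gapl s l)"
proof (cases "1 \<le> k \<and> k \<le> l")
  case True
  then have k: "k \<in> {1..l}" by simp
  have "(\<Sum>m\<in>{1..l}. (s(k := r)) m) = r + (\<Sum>m\<in>{1..l} - {k}. s m)"
    by (subst sum.remove[OF _ k]) auto
  moreover have "(\<Sum>m\<in>{1..l}. s m) = s k + (\<Sum>m\<in>{1..l} - {k}. s m)"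
    by (subst sum.remove[OF _ k]) auto
  ultimately show ?thesis using True by (simp add: gapl_def exp_add[symmetric])
next
  case False
  then have "(\<Sum>m\<in>{1..l}. (s(k := r)) m) = (\<Sum>m\<in>{1..l}. s m)"
    by (intro sum.cong) auto
  then have "gapl (s(k := r)) l = gapl s l" unfolding gapl_def by simp
  then show ?thesis using False by auto
qed

lemma upos_upd:
  assumes k: "1 \<le> k" and j: "1 \<le> j"
  shows "upos (s(k := r)) j = (if j \<le> k then upos s j else upos s k + exp (r - s k) * (upos s j - upos s k))"
proof (cases "j \<le> k")
  case True
  then show ?thesis unfolding upos_def by (simp add: gapl_upd)
next
  case False
  have "upos (s(k := r)) j - upos (s(k := r)) k = exp (r - s k) * (upos s j - upos s k)"
    using False k by (simp add: upos_diff gapl_upd sum_distrib_left)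
  moreover have "upos (s(k := r)) k = upos s k" unfolding upos_def by (simp add: gapl_upd)
  ultimately show ?thesis using False by simp
qed

text \<open>
  The deviation of the equation in the coordinate \<open>s\<^sub>k\<close> from the limiting system.
\<close>

definition eps :: "nat \<Rightarrow> (nat \<Rightarrow> real) \<Rightarrow> nat \<Rightarrow> nat \<Rightarrow> real" where
  "eps k s a b = (if a < k \<and> k < b then (upos s k - upos s a) / (upos s b - upos s a)
     else if b < k \<and> k < a then (upos s k - upos s b) / (upos s a - upos s b) else 0)"

definition eps_mat :: "nat \<Rightarrow> (nat \<Rightarrow> real) \<Rightarrow> 'n::{finite,linorder} cmat" where
  "eps_mat k s = (\<chi> i j. of_real (eps k s (idx_pos i) (idx_pos j)))"

lemma eps_sym: "eps k s a b = eps k s b a" by (simp add: eps_def)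

definition dvec :: "nat \<Rightarrow> (nat \<Rightarrow> real) \<Rightarrow> real^'n::{finite,linorder}" where
  "dvec k s = (\<chi> i. if k < idx_pos i then upos s (idx_pos i) - upos s k else 0)"

text \<open>
  Increasing \<open>s\<^sub>k\<close> dilates the points above the \<open>k\<close>-th one around it, along a straight line in \<open>U_id\<close>.
\<close>

lemma pt_upd:
  assumes k: "1 \<le> k"
  shows "pt (s(k := r)) = pt s + (exp (r - s k) - 1) *\<^sub>R dvec k s"
  unfolding vec_eq_iff
proof
  fix i
  show "pt (s(k := r)) $ i = (pt s + (exp (r - s k) - 1) *\<^sub>R dvec k s) $ i"
    using upos_upd[OF k idx_pos_bounds(1), of s r i] by (simp add: pt_def dvec_def algebra_simps)
qed

text \<open>
  The entry for a pair of positions \<open>a < b\<close> is \<open>0\<close> if both points are fixed, \<open>1\<close> if the pair is dilated as a whole, and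
  \<open>(u\<^sub>b - u\<^sub>k) / (u\<^sub>b - u\<^sub>a)\<close> if \<open>a < k < b\<close>.
\<close>

lemma wmat_dvec:
  assumes k: "1 \<le> k"
  shows "wmat (pt s :: real^'n::{finite,linorder}) (dvec k s) = 1 - (delta_mask k + eps_mat k s)"
proof -
  define D where "D = (\<lambda>a. if k < a then upos s a - upos s k else 0)"
  have main: "(D a - D b) / (upos s a - upos s b) = 1 - ((if (a \<le> k \<and> b \<le> k) \<or> a = b then 1 else 0) + eps k s a b)"
    if ab: "1 \<le> a" "1 \<le> b" for a b
  proof -
    have lt: "(D a - D b) / (upos s a - upos s b) = 1 - ((if (a \<le> k \<and> b \<le> k) \<or> a = b then 1 else 0) + eps k s a b)"
      if "1 \<le> a" "a < b" for a b
      using upos_strict_mono[OF that, of s] that by (auto simp: D_def eps_def field_simps)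
    show ?thesis
    proof (cases a b rule: linorder_cases)
      case less
      then show ?thesis using lt ab by simp
    next
      case greater
      have "(D a - D b) / (upos s a - upos s b) = (D b - D a) / (upos s b - upos s a)"
        by (metis minus_diff_eq minus_divide_divide)
      then show ?thesis using lt[of b a] ab greater by (simp add: eps_sym[of k s a b] conj_commute)
    qed (simp add: eps_def)
  qed
  have "wmat (pt s :: real^'n::{finite,linorder}) (dvec k s) $ i $ j = (1 - (delta_mask k + eps_mat k s)) $ i $ j" for i j
  proof -
    have "wmat (pt s :: real^'n::{finite,linorder}) (dvec k s) $ i $ j
        = of_real ((D (idx_pos i) - D (idx_pos j)) / (upos s (idx_pos i) - upos s (idx_pos j)))"
      unfolding wmat_nth by (simp add: D_def dvec_def pt_def)
    also have "\<dots> = (1 - (delta_mask k + eps_mat k s)) $ i $ j"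
      unfolding main[OF idx_pos_bounds(1) idx_pos_bounds(1)]
      using bij_betw_imp_inj_on[OF idx_pos_bij[where 'n = 'n]] by (auto simp: delta_mask_def eps_mat_def inj_eq)
    finally show ?thesis .
  qed
  then show ?thesis by (simp add: vec_eq_iff)
qed

text \<open>
  The constant matrix \<open>1\<close> in \<open>wmat_dvec\<close> drops out, since \<open>\<Phi>\<close> commutes with itself.
\<close>

lemma solution_deriv_s:
  fixes \<Phi> :: "real^'n::{finite,linorder} \<Rightarrow> 'n cmat"
  assumes \<Phi>: "solution_on U_id \<Phi>" and k: "1 \<le> k"
  shows "((\<lambda>r. \<Phi> (pt (s(k := r)))) has_vector_derivative
    cscale c0 (ad ((delta_mask k + eps_mat k (s(k := r))) * \<Phi> (pt (s(k := r)))) (\<Phi> (pt (s(k := r)))))) (at r)"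
proof -
  define s' where "s' = s(k := r)"
  define Z where "Z = \<Phi> (pt s')"
  have P: "pt (s(k := x)) = pt s' + (exp (x - r) - 1) *\<^sub>R dvec k s'" for x
    using pt_upd[OF k, of s' x] by (simp add: s'_def)
  have d: "((\<lambda>x. exp (x - r) - 1) has_vector_derivative 1) (at r)"
    unfolding has_real_derivative_iff_has_vector_derivative[symmetric] by (auto intro!: derivative_eq_intros)
  have "((\<lambda>t. \<Phi> (pt s' + t *\<^sub>R dvec k s')) has_vector_derivative iso_field (pt s') (dvec k s') Z) (at (exp (r - r) - 1))"
    using \<Phi>[unfolded solution_on_def, rule_format, OF pt_in_U_id[of s'], of "dvec k s'"] by (simp add: Z_def)
  from vector_diff_chain_at[OF d this]
  have "((\<lambda>x. \<Phi> (pt (s(k := x)))) has_vector_derivative iso_field (pt s') (dvec k s') Z) (at r)"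
    by (simp add: o_def P)
  moreover have "iso_field (pt s') (dvec k s') Z = cscale c0 (ad ((delta_mask k + eps_mat k s') * Z) Z)"
  proof -
    have "ad Z ((1 - (delta_mask k + eps_mat k s')) * Z) = ad Z (Z - (delta_mask k + eps_mat k s') * Z)"
      by (simp add: algebra_simps)
    also have "\<dots> = - ad Z ((delta_mask k + eps_mat k s') * Z)" by (simp only: ad.diff_right) (simp add: ad_def)
    also have "\<dots> = ad ((delta_mask k + eps_mat k s') * Z) Z" by (simp add: ad_def)
    finally show ?thesis unfolding iso_field_def wmat_dvec[OF k] by simp
  qed
  ultimately show ?thesis by (simp add: s'_def Z_def)
qed

lemma gapl_mono:
  assumes nn: "\<And>m. m \<in> {2..n - 1} \<Longrightarrow> 0 \<le> s m" and l: "1 \<le> l" "l \<le> l'" "l' \<le> n - 1"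
  shows "gapl s l \<le> gapl s l'"
proof -
  have "{1..l} \<union> {Suc l..l'} = {1..l'}" using l by auto
  then have "(\<Sum>m\<in>{1..l'}. s m) = (\<Sum>m\<in>{1..l}. s m) + (\<Sum>m\<in>{Suc l..l'}. s m)"
    using sum.union_disjoint[of "{1..l}" "{Suc l..l'}" s] by simp
  moreover have "0 \<le> (\<Sum>m\<in>{Suc l..l'}. s m)" using nn l by (intro sum_nonneg) auto
  ultimately show ?thesis by (simp add: gapl_def)
qed

lemma gapl_ratio:
  assumes nn: "\<And>m. m \<in> {2..n - 1} \<Longrightarrow> 0 \<le> s m" and m: "2 \<le> m" "m \<le> k" "k \<le> n - 1"
  shows "gapl s (m - 1) \<le> exp (- s m) * gapl s k" and "m < k \<Longrightarrow> gapl s (m - 1) \<le> exp (- s m) * exp (- s k) * gapl s k"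
proof -
  have step: "gapl s (j - 1) = exp (- s j) * gapl s j" if "1 \<le> j" for j
  proof -
    have "{1..j} = insert j {1..j - 1}" using that by auto
    then have "(\<Sum>m\<in>{1..j}. s m) = s j + (\<Sum>m\<in>{1..j - 1}. s m)" using that by simp
    then show ?thesis by (simp add: gapl_def exp_add[symmetric])
  qed
  have "gapl s m \<le> gapl s k" by (rule gapl_mono[OF nn]) (use m in auto)
  then show "gapl s (m - 1) \<le> exp (- s m) * gapl s k" using step[of m] m by simp
  assume mk: "m < k"
  have "gapl s m \<le> gapl s (k - 1)" by (rule gapl_mono[OF nn]) (use m mk in auto)
  then show "gapl s (m - 1) \<le> exp (- s m) * exp (- s k) * gapl s k"
    using step[of m] step[of k] m by (simp add: mult.assoc)
qed

lemma upos_diff_le: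
  assumes nn: "\<And>m. m \<in> {2..n - 1} \<Longrightarrow> 0 \<le> s m" and a: "1 \<le> a" "a \<le> m" "2 \<le> m" "m \<le> n"
  shows "upos s m - upos s a \<le> real n * gapl s (m - 1)"
proof -
  have "upos s m - upos s a \<le> (\<Sum>l\<in>{a..<m}. gapl s (m - 1))"
    unfolding upos_diff[OF a(1,2)] by (intro sum_mono gapl_mono[OF nn]) (use a in auto)
  also have "\<dots> = real (m - a) * gapl s (m - 1)" by simp
  also have "\<dots> \<le> real n * gapl s (m - 1)" using a gapl_pos[of s "m - 1"] by (intro mult_right_mono) auto
  finally show ?thesis .
qed

text \<open>
  With nonnegative \<open>s\<close> the gaps increase, so \<open>u\<^sub>k - u\<^sub>a\<close> is at most \<open>n\<close> times the gap below \<open>u\<^sub>k\<close>, whereas \<open>u\<^sub>b - u\<^sub>a\<close> exceeds the gap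
  above \<open>u\<^sub>k\<close>.
\<close>

lemma eps_bound:
  assumes nn: "\<And>m. m \<in> {2..n - 1} \<Longrightarrow> 0 \<le> s m" and k: "1 \<le> k" "k \<le> n - 1" and ab: "1 \<le> a" "1 \<le> b"
  shows "\<bar>eps k s a b\<bar> \<le> real n * exp (- s k)"
proof -
  have main: "\<bar>(upos s k - upos s a) / (upos s b - upos s a)\<bar> \<le> real n * exp (- s k)" if "1 \<le> a" "a < k" "k < b" for a b
  proof -
    have pos: "0 < gapl s k" "gapl s k \<le> upos s b - upos s a" using gapl_pos upos_gap_le[of a k b s] that by auto
    have "upos s k - upos s a \<le> real n * gapl s (k - 1)" by (rule upos_diff_le[OF nn]) (use that k in auto)
    also have "\<dots> \<le> real n * (exp (- s k) * gapl s k)" using gapl_ratio(1)[of n s k k] nn that k by (intro mult_left_mono) auto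
    also have "\<dots> \<le> real n * (exp (- s k) * (upos s b - upos s a))" using pos by (intro mult_left_mono) auto
    finally have "upos s k - upos s a \<le> real n * exp (- s k) * (upos s b - upos s a)" by (simp add: mult.assoc)
    moreover have "0 \<le> upos s k - upos s a" using upos_mono[of a k s] that by simp
    ultimately show ?thesis using pos by (simp add: abs_of_nonneg pos_divide_le_eq)
  qed
  show ?thesis using main[of a b] main[of b a] ab by (auto simp: eps_def)
qed

text \<open>
  Within a column the entries of \<open>eps\<close> nearly cancel: their difference is proportional to \<open>u\<^sub>b - u\<^sub>a\<close>, which is bounded by the gaps inside
  the block of size \<open>m\<close>. By \<open>gapl_ratio\<close> this gains the factor \<open>exp (- s m)\<close>.
\<close>

lemma eps_diff_bound:
  assumes nn: "\<And>m. m \<in> {2..n - 1} \<Longrightarrow> 0 \<le> s m" and mk: "2 \<le> m" "m \<le> k" "k \<le> n - 1"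
    and ab: "1 \<le> a" "a \<le> m" "1 \<le> b" "b \<le> m" and j: "k < j"
  shows "\<bar>eps k s a j - eps k s b j\<bar> \<le> real n * (gapl s (m - 1) / gapl s k)"
proof -
  let ?x = "upos s a" and ?y = "upos s b" and ?K = "upos s k" and ?J = "upos s j"
  have e: "eps k s c j = (?K - upos s c) / (?J - upos s c)" if "1 \<le> c" "c \<le> k" for c
    using that j by (cases "c = k") (auto simp: eps_def)
  have pos: "0 < gapl s k" "gapl s k \<le> ?J - ?x" "gapl s k \<le> ?J - ?y" "gapl s k \<le> ?J - ?K"
    using gapl_pos upos_gap_le[of _ k j s] mk ab j by auto
  have "?x \<le> ?K" using upos_mono[of a k s] mk ab by simp
  have eq: "(?K - ?x) / (?J - ?x) - (?K - ?y) / (?J - ?y) = (?J - ?K) / (?J - ?x) * ((?y - ?x) / (?J - ?y))"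
  proof -
    have "?J - ?x \<noteq> 0" "?J - ?y \<noteq> 0" using pos by linarith+
    then show ?thesis by (simp add: divide_simps) (simp add: algebra_simps)
  qed
  have "\<bar>?y - ?x\<bar> \<le> upos s m - upos s 1"
    using upos_mono[of 1 a s] upos_mono[of 1 b s] upos_mono[of a m s] upos_mono[of b m s] ab by auto
  also have "\<dots> \<le> real n * gapl s (m - 1)" by (rule upos_diff_le[OF nn]) (use mk in auto)
  finally have yx: "\<bar>?y - ?x\<bar> \<le> real n * gapl s (m - 1)" .
  have "\<bar>(?J - ?K) / (?J - ?x)\<bar> \<le> 1" using pos \<open>?x \<le> ?K\<close> by simp
  moreover have "\<bar>(?y - ?x) / (?J - ?y)\<bar> \<le> real n * gapl s (m - 1) / gapl s k"
  proof -
    have "\<bar>(?y - ?x) / (?J - ?y)\<bar> = \<bar>?y - ?x\<bar> / (?J - ?y)" using pos by simp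
    also have "\<dots> \<le> real n * gapl s (m - 1) / gapl s k"
      using pos yx gapl_pos[of s "m - 1"] by (intro frac_le) auto
    finally show ?thesis .
  qed
  ultimately have "\<bar>(?J - ?K) / (?J - ?x) * ((?y - ?x) / (?J - ?y))\<bar> \<le> 1 * (real n * gapl s (m - 1) / gapl s k)"
    unfolding abs_mult by (intro mult_mono) auto
  then show ?thesis using e[of a] e[of b] ab mk by (simp add: eq)
qed

section \<open>Comparison of two solutions\<close>

lemma ad_had_nth: "ad (\<mu> * Z) Z $ a $ b = (\<Sum>l\<in>UNIV. (\<mu> $ a $ l - \<mu> $ l $ b) * (Z $ a $ l * Z $ l $ b))"
  by (simp add: ad_def matrix_mult_nth sum_subtractf[symmetric] algebra_simps)

lemma norm_cmat_le_const:
  assumes "\<And>i j. norm (A $ i $ j) \<le> r" shows "norm (A :: 'n::finite cmat) \<le> (real CARD('n))\<^sup>2 * r"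
proof -
  have "norm A \<le> (\<Sum>i\<in>(UNIV :: 'n set). \<Sum>j\<in>(UNIV :: 'n set). r)"
    by (rule order_trans[OF norm_cmat_le_sum]) (intro sum_mono assms)
  then show ?thesis by (simp add: power2_eq_square mult_ac)
qed

text \<open>
  In the limiting system the block \<open>\<delta>\<^sub>m\<close> does not change in the direction \<open>s\<^sub>k\<close> for \<open>m \<le> k\<close>: within the block of size \<open>k\<close> the
  bracket is that of the block with itself.
\<close>

lemma delta_ad_delta:
  assumes "m \<le> k" shows "delta m (ad (delta_mask k * Z) Z) = 0"
proof -
  have "delta m (ad (delta_mask k * Z) Z) $ a $ b = 0" for a b
  proof (cases "a = b")
    case True
    have "(delta_mask k $ a $ l - delta_mask k $ l $ a) = (0 :: complex)" for l by (auto simp: delta_mask_def)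
    then show ?thesis using True by (simp add: delta_nth ad_had_nth)
  next
    case ab: False
    show ?thesis
    proof (cases "idx_pos a \<le> m \<and> idx_pos b \<le> m")
      case True
      then have "(delta_mask k $ a $ l - delta_mask k $ l $ b) = (0 :: complex)" for l
        using assms by (auto simp: delta_mask_def)
      then show ?thesis by (simp add: delta_nth ad_had_nth)
    qed (use ab in \<open>auto simp: delta_nth\<close>)
  qed
  then show ?thesis by (simp add: vec_eq_iff)
qed

text \<open>
  The contribution of \<open>eps\<close> to the derivative of the difference of two solutions. For \<open>\<theta> = 1\<close> both satisfy the
  isomonodromy equation, for \<open>\<theta> = 0\<close> the second one satisfies the limiting system. In both cases the bounds only use
  a bound for \<open>Z\<^sub>a\<^sub>l Z\<^sub>l\<^sub>b - \<theta> W\<^sub>a\<^sub>l W\<^sub>l\<^sub>b\<close>.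
\<close>

definition qdiff :: "nat \<Rightarrow> (nat \<Rightarrow> real) \<Rightarrow> real \<Rightarrow> 'n::{finite,linorder} cmat \<Rightarrow> 'n cmat \<Rightarrow> 'n cmat" where
  "qdiff k s \<theta> Z W = ad (eps_mat k s * Z) Z - \<theta> *\<^sub>R ad (eps_mat k s * W) W"

lemma qdiff_nth:
  "qdiff k s \<theta> Z W $ a $ b = (\<Sum>l\<in>UNIV. of_real (eps k s (idx_pos a) (idx_pos l) - eps k s (idx_pos l) (idx_pos b)) *
     (Z $ a $ l * Z $ l $ b - of_real \<theta> * (W $ a $ l * W $ l $ b)))"
  unfolding qdiff_def vector_minus_component vector_scaleR_component ad_had_nth
  by (simp add: eps_mat_def sum_distrib_left sum_subtractf[symmetric] scaleR_sum_right scaleR_conv_of_real[where 'a = complex])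
    (intro sum.cong refl, simp add: algebra_simps)

lemma norm_qdiff_nth_le:
  fixes Z W :: "'n::{finite,linorder} cmat"
  assumes t: "\<And>a l b. norm (Z $ a $ l * Z $ l $ b - of_real \<theta> * (W $ a $ l * W $ l $ b)) \<le> \<tau>"
    and e: "\<And>l :: 'n. \<bar>eps k s (idx_pos a) (idx_pos l) - eps k s (idx_pos l) (idx_pos b)\<bar> \<le> \<beta>"
  shows "norm (qdiff k s \<theta> Z W $ a $ b) \<le> real CARD('n) * (\<beta> * \<tau>)"
proof -
  have \<beta>: "0 \<le> \<beta>" using e[of a] by (meson abs_ge_zero order_trans)
  have "norm (qdiff k s \<theta> Z W $ a $ b) \<le> (\<Sum>l\<in>(UNIV :: 'n set). \<beta> * \<tau>)"
    unfolding qdiff_nth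
  proof (rule order_trans[OF norm_sum], intro sum_mono)
    fix l
    show "norm (of_real (eps k s (idx_pos a) (idx_pos l) - eps k s (idx_pos l) (idx_pos b)) *
     (Z $ a $ l * Z $ l $ b - of_real \<theta> * (W $ a $ l * W $ l $ b))) \<le> \<beta> * \<tau>"
      unfolding norm_mult[of "of_real _"] norm_of_real using \<beta> by (intro mult_mono e t) auto
  qed
  then show ?thesis by simp
qed

lemma norm_qdiff:
  fixes Z W :: "'n::{finite,linorder} cmat"
  assumes t: "\<And>a l b. norm (Z $ a $ l * Z $ l $ b - of_real \<theta> * (W $ a $ l * W $ l $ b)) \<le> \<tau>"
    and nn: "\<And>m. m \<in> {2..CARD('n) - 1} \<Longrightarrow> 0 \<le> s m" and k: "1 \<le> k" "k \<le> CARD('n) - 1"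
  shows "norm (qdiff k s \<theta> Z W) \<le> 2 * real CARD('n) ^ 4 * \<tau> * exp (- s k)"
proof -
  have "norm (qdiff k s \<theta> Z W) \<le> (real CARD('n))\<^sup>2 * (real CARD('n) * (2 * real CARD('n) * exp (- s k) * \<tau>))"
  proof (intro norm_cmat_le_const norm_qdiff_nth_le t)
    fix a b l :: 'n
    show "\<bar>eps k s (idx_pos a) (idx_pos l) - eps k s (idx_pos l) (idx_pos b)\<bar> \<le> 2 * real CARD('n) * exp (- s k)"
      using eps_bound[of "CARD('n)" s k "idx_pos a" "idx_pos l"] eps_bound[of "CARD('n)" s k "idx_pos l" "idx_pos b"]
        nn k idx_pos_bounds(1) by fastforce
  qed
  then show ?thesis by (simp add: power2_eq_square power4_eq_xxxx mult_ac)
qed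

text \<open>
  For positions \<open>a, b \<le> m \<le> k\<close> only the column indices above \<open>k\<close> contribute, each with a difference as in \<open>eps_diff_bound\<close>;
  diagonal entries vanish by symmetry.
\<close>

lemma norm_delta_qdiff:
  fixes Z W :: "'n::{finite,linorder} cmat"
  assumes t: "\<And>a l b. norm (Z $ a $ l * Z $ l $ b - of_real \<theta> * (W $ a $ l * W $ l $ b)) \<le> \<tau>"
    and nn: "\<And>m. m \<in> {2..CARD('n) - 1} \<Longrightarrow> 0 \<le> s m" and mk: "2 \<le> m" "m \<le> k" "k \<le> CARD('n) - 1"
  shows "norm (delta m (qdiff k s \<theta> Z W)) \<le> real CARD('n) ^ 4 * \<tau> * (gapl s (m - 1) / gapl s k)"
proof -
  let ?\<beta> = "real CARD('n) * (gapl s (m - 1) / gapl s k)"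
  have \<beta>: "0 \<le> ?\<beta>" using gapl_pos[of s] by (auto intro!: divide_nonneg_nonneg less_imp_le)
  have \<tau>: "0 \<le> \<tau>" using t[of undefined undefined undefined] norm_ge_zero order_trans by blast
  have rhs0: "0 \<le> real CARD('n) * (?\<beta> * \<tau>)" by (intro mult_nonneg_nonneg \<beta> \<tau>) simp
  have "norm (delta m (qdiff k s \<theta> Z W)) \<le> (real CARD('n))\<^sup>2 * (real CARD('n) * (?\<beta> * \<tau>))"
  proof (rule norm_cmat_le_const)
    fix a b :: 'n
    show "norm (delta m (qdiff k s \<theta> Z W) $ a $ b) \<le> real CARD('n) * (?\<beta> * \<tau>)"
    proof (cases "a = b")
      case True
      have "delta m (qdiff k s \<theta> Z W) $ a $ b = 0"
        using True by (simp add: delta_nth qdiff_nth eps_sym[of k s _ "idx_pos b"])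
      then show ?thesis using rhs0 by (simp only: norm_zero)
    next
      case ab: False
      show ?thesis
      proof (cases "idx_pos a \<le> m \<and> idx_pos b \<le> m")
        case True
        have "norm (qdiff k s \<theta> Z W $ a $ b) \<le> real CARD('n) * (?\<beta> * \<tau>)"
        proof (rule norm_qdiff_nth_le[OF t])
          fix l :: 'n
          show "\<bar>eps k s (idx_pos a) (idx_pos l) - eps k s (idx_pos l) (idx_pos b)\<bar> \<le> ?\<beta>"
          proof (cases "k < idx_pos l")
            case kl: True
            show ?thesis unfolding eps_sym[of k s "idx_pos l"]
              by (rule eps_diff_bound) (use nn mk kl True idx_pos_bounds(1) in auto)
          next
            case False
            then have "eps k s (idx_pos a) (idx_pos l) = 0" "eps k s (idx_pos l) (idx_pos b) = 0"
              using True mk by (auto simp: eps_def)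
            then show ?thesis using \<beta> by simp
          qed
        qed
        then show ?thesis using True by (simp add: delta_nth)
      next
        case False
        then have "delta m (qdiff k s \<theta> Z W) $ a $ b = 0" using ab by (auto simp: delta_nth)
        then show ?thesis using rhs0 by (simp only: norm_zero)
      qed
    qed
  qed
  then show ?thesis by (simp add: power2_eq_square power4_eq_xxxx mult_ac)
qed

lemma eps_mat_1: "eps_mat 1 s = (0 :: 'n::{finite,linorder} cmat)"
proof -
  have p: "(idx_pos i = 0) = False" for i :: 'n using idx_pos_bounds(1)[of i] by auto
  show ?thesis by (auto simp: vec_eq_iff eps_mat_def eps_def p)
qed

definition region :: "nat \<Rightarrow> real \<Rightarrow> (nat \<Rightarrow> real) set" where
  "region n R = {s. \<forall>m\<in>{2..n - 1}. R \<le> s m}"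

text \<open>
  A solution \<open>\<Phi>\<close> of the isomonodromy equation in logarithmic coordinates and a function \<open>\<Psi>\<close>, which solves the same equation for
  \<open>\<theta> = 1\<close> and the limiting system for \<open>\<theta> = 0\<close>. Keeping \<open>\<tau>\<close> as a parameter lets the estimates be linear in the difference when \<open>\<theta> = 1\<close>,
  where \<open>\<tau>\<close> is a multiple of the supremum of \<open>norm (\<Phi> s - \<Psi> s)\<close>.
\<close>

locale compare =
  fixes \<Phi> \<Psi> :: "(nat \<Rightarrow> real) \<Rightarrow> 'n::{finite,linorder} cmat" and \<theta> b \<tau> R :: real
  assumes d\<Phi>: "\<And>k s r. 1 \<le> k \<Longrightarrow> k \<le> CARD('n) - 1 \<Longrightarrow> ((\<lambda>r. \<Phi> (s(k := r))) has_vector_derivative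
      cscale c0 (ad ((delta_mask k + eps_mat k (s(k := r))) * \<Phi> (s(k := r))) (\<Phi> (s(k := r))))) (at r)"
    and d\<Psi>: "\<And>k s r. 1 \<le> k \<Longrightarrow> k \<le> CARD('n) - 1 \<Longrightarrow> ((\<lambda>r. \<Psi> (s(k := r))) has_vector_derivative
      cscale c0 (ad (delta_mask k * \<Psi> (s(k := r))) (\<Psi> (s(k := r))) +
        \<theta> *\<^sub>R ad (eps_mat k (s(k := r)) * \<Psi> (s(k := r))) (\<Psi> (s(k := r))))) (at r)"
    and herm: "\<And>s. hermitian (\<Psi> s)" and b: "\<And>s. norm (\<Phi> s) \<le> b"
    and R: "0 \<le> R"
    and \<tau>: "\<And>s i l j. s \<in> region CARD('n) R \<Longrightarrow>
      norm (\<Phi> s $ i $ l * \<Phi> s $ l $ j - of_real \<theta> * (\<Psi> s $ i $ l * \<Psi> s $ l $ j)) \<le> \<tau>"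
begin

definition "D s = \<Phi> s - \<Psi> s"

abbreviation "q k s \<equiv> qdiff k s \<theta> (\<Phi> s) (\<Psi> s)"

lemma b_nonneg: "0 \<le> b" using b norm_ge_zero order_trans by blast

lemma D_deriv:
  assumes k: "1 \<le> k" "k \<le> CARD('n) - 1"
  shows "((\<lambda>r. D (s(k := r))) has_vector_derivative
    cscale c0 (ad (delta k (\<Psi> (s(k := r)))) (D (s(k := r)))) +
    cscale c0 (ad (delta k (D (s(k := r)))) (\<Phi> (s(k := r))) + q k (s(k := r)))) (at r)"
proof -
  let ?s = "s(k := r)"
  have cs: "cscale c0 A - cscale c0 B = cscale c0 (A - B)" "cscale c0 A + cscale c0 B = cscale c0 (A + B)" for A B :: "'n cmat"
    by (simp_all add: vec_eq_iff algebra_simps)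
  have "ad ((delta_mask k + eps_mat k ?s) * \<Phi> ?s) (\<Phi> ?s) -
      (ad (delta_mask k * \<Psi> ?s) (\<Psi> ?s) + \<theta> *\<^sub>R ad (eps_mat k ?s * \<Psi> ?s) (\<Psi> ?s))
    = ad (delta k (\<Psi> ?s)) (D ?s) + (ad (delta k (D ?s)) (\<Phi> ?s) + q k ?s)"
    by (simp add: delta_eq_mask D_def qdiff_def distrib_right right_diff_distrib ad.add_left ad.diff_left ad.diff_right)
  then show ?thesis
    using has_vector_derivative_diff[OF d\<Phi>[OF k, of s r] d\<Psi>[OF k, of s r]] unfolding cs D_def by simp
qed

lemma delta_D_deriv:
  assumes k: "1 \<le> k" "k \<le> CARD('n) - 1" and m: "m \<le> k"
  shows "((\<lambda>r. delta m (D (s(k := r)))) has_vector_derivative cscale c0 (delta m (q k (s(k := r))))) (at r)"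
proof -
  let ?s = "s(k := r)"
  have cs: "cscale c0 A - cscale c0 B = cscale c0 (A - B)" for A B :: "'n cmat"
    by (simp_all add: vec_eq_iff algebra_simps)
  have eq: "ad ((delta_mask k + eps_mat k ?s) * \<Phi> ?s) (\<Phi> ?s) -
      (ad (delta_mask k * \<Psi> ?s) (\<Psi> ?s) + \<theta> *\<^sub>R ad (eps_mat k ?s * \<Psi> ?s) (\<Psi> ?s))
    = ad (delta_mask k * \<Phi> ?s) (\<Phi> ?s) - ad (delta_mask k * \<Psi> ?s) (\<Psi> ?s) + q k ?s"
    by (simp add: qdiff_def distrib_right ad.add_left)
  have "delta m (ad (delta_mask k * \<Phi> ?s) (\<Phi> ?s) - ad (delta_mask k * \<Psi> ?s) (\<Psi> ?s) + q k ?s) = delta m (q k ?s)"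
    by (simp add: linear_add[OF linear_delta] delta_diff delta_ad_delta[OF m])
  then show ?thesis
    using bounded_linear.has_vector_derivative[OF bounded_linear_delta[of m]
        has_vector_derivative_diff[OF d\<Phi>[OF k, of s r] d\<Psi>[OF k, of s r]]]
    unfolding cs eq delta_cscale D_def by simp
qed

text \<open>
  There is no point below \<open>u\<^sub>1\<close>, so \<open>eps\<close> vanishes for \<open>k = 1\<close>. The diagonal \<open>\<delta>\<^sub>1 D\<close> is then constant, hence zero, and \<open>D\<close> is merely rotated.
\<close>

lemma coordinate_one:
  assumes n: "2 \<le> CARD('n)" and S: "D S = 0"
  shows "D (S(1 := x)) = 0"
proof -
  have k: "1 \<le> (1::nat)" "1 \<le> CARD('n) - 1" using n by auto
  have q0: "q 1 s = 0" for s unfolding qdiff_def eps_mat_1 by (simp add: ad.zero_left)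
  note q0' = q0[unfolded One_nat_def]
  define y where "y = S 1"
  have S': "D (S(1 := y)) = 0" using S by (simp add: y_def)
  have lin: "linear (cscale c0 :: 'n cmat \<Rightarrow> 'n cmat)" using bounded_linear.linear[OF bounded_linear_cscale] .
  have const: "\<bar>norm (delta 1 (D (S(1 := c)))) - norm (delta 1 (D (S(1 := a))))\<bar> \<le> 0 - 0" if "a \<le> c" for a c
  proof (rule norm_growth[OF that, where f = "\<lambda>r. delta 1 (D (S(1 := r)))" and A = "\<lambda>_. 0" and r = "\<lambda>_. 0" and \<phi>' = "\<lambda>_. 0"])
    show "((\<lambda>r. delta 1 (D (S(1 := r)))) has_vector_derivative 0 + 0) (at r)" for r
      using delta_D_deriv[OF k order_refl, of S r] by (simp add: q0' linear_0[OF linear_delta] linear_0[OF lin])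
  qed auto
  have d0: "delta 1 (D (S(1 := r))) = 0" for r
    using const[of r y] const[of y r] by (cases "r \<le> y") (simp_all add: S'[unfolded One_nat_def] linear_0[OF linear_delta])
  note d0' = d0[unfolded One_nat_def]
  have "\<bar>norm (D (S(1 := c))) - norm (D (S(1 := a)))\<bar> \<le> 0 - 0" if "a \<le> c" for a c
  proof (rule norm_growth[OF that, where f = "\<lambda>r. D (S(1 := r))" and A = "\<lambda>r. cscale c0 (ad (delta 1 (\<Psi> (S(1 := r)))) (D (S(1 := r))))"
        and r = "\<lambda>_. 0" and \<phi>' = "\<lambda>_. 0"])
    show "((\<lambda>r. D (S(1 := r))) has_vector_derivative cscale c0 (ad (delta 1 (\<Psi> (S(1 := r)))) (D (S(1 := r)))) + 0) (at r)" for r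
      using D_deriv[OF k, of S r] by (simp add: q0' d0' ad.zero_left linear_0[OF lin])
    show "inner (D (S(1 := r))) (cscale c0 (ad (delta 1 (\<Psi> (S(1 := r)))) (D (S(1 := r))))) = 0" for r
      by (intro inner_c0_ad hermitian_delta herm)
  qed auto
  from this[of x y] this[of y x] show ?thesis using S' by (cases "x \<le> y") auto
qed

definition "c_delta = real CARD('n) ^ 4 * \<tau>"

lemma c_delta_nonneg: "region CARD('n) R \<noteq> {} \<Longrightarrow> 0 \<le> c_delta"
proof -
  assume "region CARD('n) R \<noteq> {}"
  then obtain s where "s \<in> region CARD('n) R" by blast
  from \<tau>[OF this, of undefined undefined undefined] have "0 \<le> \<tau>" by (meson norm_ge_zero order_trans)
  then show ?thesis by (simp add: c_delta_def)
qed

lemma region_nonneg: "s \<in> region CARD('n) R \<Longrightarrow> m \<in> {2..CARD('n) - 1} \<Longrightarrow> 0 \<le> s m"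
  using order_trans[OF R, of "s m"] by (simp add: region_def)

lemma q_bounds:
  assumes s: "s \<in> region CARD('n) R" and k: "2 \<le> m" "m \<le> k" "k \<le> CARD('n) - 1"
  shows "norm (q k s) \<le> 2 * c_delta * exp (- s k)"
    and "norm (delta m (q k s)) \<le> c_delta * exp (- s m)"
    and "m < k \<Longrightarrow> norm (delta m (q k s)) \<le> c_delta * exp (- s m) * exp (- s k)"
proof -
  have c_delta: "0 \<le> c_delta" using c_delta_nonneg s by blast
  show "norm (q k s) \<le> 2 * c_delta * exp (- s k)"
    using norm_qdiff[of "\<Phi> s" \<theta> "\<Psi> s" \<tau> s k] \<tau>[OF s] region_nonneg[OF s] k by (simp add: c_delta_def)
  have *: "norm (delta m (q k s)) \<le> c_delta * (gapl s (m - 1) / gapl s k)"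
    using norm_delta_qdiff[of "\<Phi> s" \<theta> "\<Psi> s" \<tau> s m k] \<tau>[OF s] region_nonneg[OF s] k by (simp add: c_delta_def)
  have g: "0 < gapl s k" by (rule gapl_pos)
  have "gapl s (m - 1) / gapl s k \<le> exp (- s m)"
    using gapl_ratio(1)[of "CARD('n)" s m k] region_nonneg[OF s] k g by (simp add: pos_divide_le_eq)
  then show "norm (delta m (q k s)) \<le> c_delta * exp (- s m)"
    using * mult_left_mono[OF _ c_delta] order_trans by blast
  assume "m < k"
  then have "gapl s (m - 1) / gapl s k \<le> exp (- s m) * exp (- s k)"
    using gapl_ratio(2)[of "CARD('n)" s m k] region_nonneg[OF s] k g by (simp add: pos_divide_le_eq)
  then show "norm (delta m (q k s)) \<le> c_delta * exp (- s m) * exp (- s k)"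
    using order_trans[OF * mult_left_mono[OF _ c_delta]] by (simp add: mult.assoc)
qed

definition "c_path = (2 * b * (real CARD('n) + 1) + 2) * c_delta"

text \<open>
  The coordinates are lowered from \<open>S\<close> to \<open>s\<close>, the last one first: \<open>P j\<close> is the point at which those with index above \<open>j\<close> have
  their final values. On the stretch from \<open>P m\<close> to \<open>P (m - 1)\<close> the growth of \<open>D\<close> is governed by \<open>\<delta>\<^sub>m D\<close>. This block is still small
  at \<open>P m\<close>, because on all earlier stretches the \<open>m\<close>-th coordinate has its initial value \<open>S m\<close>.
\<close>

theorem comparison:
  assumes s: "s \<in> region CARD('n) R" and sS: "\<And>i. i \<in> {2..CARD('n) - 1} \<Longrightarrow> s i \<le> S i"
    and eq: "\<And>i. i \<notin> {2..CARD('n) - 1} \<Longrightarrow> s i = S i"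
  shows "norm (D s) \<le> norm (D S) + (\<Sum>m=2..CARD('n) - 1. 2 * b * norm (D S) * (S m - s m) + c_path * exp (- s m))"
proof -
  let ?n = "CARD('n)"
  define P where "P = (\<lambda>j i. if j < i then s i else S i)"
  have c_delta: "0 \<le> c_delta" using c_delta_nonneg s by blast
  have reg: "(P j)(j := r) \<in> region ?n R" if "s j \<le> r" for j r
    using s sS that by (force simp: region_def P_def)
  have P_top: "P (?n - 1) = S"
    using eq by (auto simp: P_def fun_eq_iff)
  have P_bot: "P 1 = s"
  proof
    fix i show "P 1 i = s i" using eq[of i] by (cases "i = 0 \<or> i = 1") (auto simp: P_def)
  qed
  have P_up: "(P j)(j := S j) = P j" for j by (auto simp: P_def)
  have P_down: "(P (Suc j))(Suc j := s (Suc j)) = P j" for j by (auto simp: P_def fun_eq_iff)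
  (* On the stretches before the m-th one, the change of the m-th block carries the factor exp (- S m). *)
  have A: "norm (delta m (D (P j))) \<le> norm (D S) + c_delta * exp (- S m) * real (?n - 1 - j)"
    if m: "2 \<le> m" and j: "m \<le> j" "j \<le> ?n - 1" for m j
    using j(2,1)
  proof (induction j rule: inc_induct)
    case base
    show ?case unfolding P_top using norm_delta_le[of m "D S"] by simp
  next
    case (step j)
    let ?i = "Suc j"
    have i: "1 \<le> ?i" "?i \<le> ?n - 1" "m < ?i" "?i \<in> {2..?n - 1}" using step m by auto
    let ?\<phi>' = "\<lambda>r. c_delta * exp (- S m) * exp (- r)"
    have "\<bar>norm (delta m (D ((P ?i)(?i := S ?i)))) - norm (delta m (D ((P ?i)(?i := s ?i))))\<bar>
        \<le> - (c_delta * exp (- S m) * exp (- S ?i)) - - (c_delta * exp (- S m) * exp (- s ?i))"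
    proof (rule norm_growth[OF sS[OF i(4)], where f = "\<lambda>r. delta m (D ((P ?i)(?i := r)))" and A = "\<lambda>_. 0"
          and r = "\<lambda>r. cscale c0 (delta m (q ?i ((P ?i)(?i := r))))" and \<phi>' = ?\<phi>' and \<phi> = "\<lambda>r. - (c_delta * exp (- S m) * exp (- r))"])
      fix r assume r: "s ?i \<le> r" "r \<le> S ?i"
      show "((\<lambda>r. delta m (D ((P ?i)(?i := r)))) has_vector_derivative 0 + cscale c0 (delta m (q ?i ((P ?i)(?i := r))))) (at r)"
        using delta_D_deriv[OF i(1,2) less_imp_le[OF i(3)], of "P ?i" r] by simp
      show "((\<lambda>r. - (c_delta * exp (- S m) * exp (- r))) has_real_derivative ?\<phi>' r) (at r)"
        by (auto intro!: derivative_eq_intros)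
      have "((P ?i)(?i := r)) m = S m" "((P ?i)(?i := r)) ?i = r" using i by (auto simp: P_def)
      then show "norm (cscale c0 (delta m (q ?i ((P ?i)(?i := r))))) \<le> ?\<phi>' r"
        using q_bounds(3)[OF reg[OF r(1)] m less_imp_le[OF i(3)] i(2) i(3)]
        by (intro order_trans[OF norm_cscale_c0_le]) simp
    qed simp
    then have "norm (delta m (D (P j))) \<le> norm (delta m (D (P ?i))) + c_delta * exp (- S m) * (exp (- s ?i) - exp (- S ?i))"
      unfolding P_up P_down by (simp add: algebra_simps abs_le_iff)
    also have "\<dots> \<le> (norm (D S) + c_delta * exp (- S m) * real (?n - 1 - ?i)) + c_delta * exp (- S m) * 1"
    proof (intro add_mono mult_left_mono)
      show "norm (delta m (D (P ?i))) \<le> norm (D S) + c_delta * exp (- S m) * real (?n - 1 - ?i)" using step by simp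
      have "exp (- s ?i) \<le> 1" using region_nonneg[OF s i(4)] by simp
      then show "exp (- s ?i) - exp (- S ?i) \<le> 1" using exp_gt_zero[of "- S ?i"] by linarith
    qed (use c_delta in auto)
    also have "\<dots> = norm (D S) + c_delta * exp (- S m) * real (?n - 1 - j)"
    proof -
      have "real (?n - 1 - j) = real (?n - 1 - ?i) + 1" using i by auto
      then show ?thesis by (simp add: algebra_simps)
    qed
    finally show ?case .
  qed
  (* On the m-th stretch itself, integrating exp (- r) from S m down to r again gives a multiple of exp (- r). *)
  have B: "norm (delta m (D ((P m)(m := r)))) \<le> norm (D S) + (real ?n + 1) * c_delta * exp (- r)"
    if m: "m \<in> {2..?n - 1}" and r: "s m \<le> r" "r \<le> S m" for m r
  proof -
    have i: "1 \<le> m" "m \<le> ?n - 1" "2 \<le> m" using m by auto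
    have "\<bar>norm (delta m (D ((P m)(m := S m)))) - norm (delta m (D ((P m)(m := r))))\<bar>
        \<le> - (c_delta * exp (- S m)) - - (c_delta * exp (- r))"
    proof (rule norm_growth[OF r(2), where f = "\<lambda>r. delta m (D ((P m)(m := r)))" and A = "\<lambda>_. 0"
          and r = "\<lambda>r. cscale c0 (delta m (q m ((P m)(m := r))))" and \<phi>' = "\<lambda>r. c_delta * exp (- r)" and \<phi> = "\<lambda>r. - (c_delta * exp (- r))"])
      fix x assume x: "r \<le> x" "x \<le> S m"
      show "((\<lambda>r. delta m (D ((P m)(m := r)))) has_vector_derivative 0 + cscale c0 (delta m (q m ((P m)(m := x))))) (at x)"
        using delta_D_deriv[OF i(1,2) order_refl, of "P m" x] by simp
      show "((\<lambda>r. - (c_delta * exp (- r))) has_real_derivative c_delta * exp (- x)) (at x)"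
        by (auto intro!: derivative_eq_intros)
      have "s m \<le> x" using x r by simp
      from q_bounds(2)[OF reg[OF this] i(3) order_refl i(2)]
      show "norm (cscale c0 (delta m (q m ((P m)(m := x))))) \<le> c_delta * exp (- x)"
        by (intro order_trans[OF norm_cscale_c0_le]) simp
    qed simp
    then have "norm (delta m (D ((P m)(m := r)))) \<le> norm (delta m (D (P m))) + c_delta * (exp (- r) - exp (- S m))"
      unfolding P_up by (simp add: algebra_simps abs_le_iff)
    also have "\<dots> \<le> (norm (D S) + c_delta * exp (- r) * real ?n) + c_delta * exp (- r)"
    proof (intro add_mono)
      have "norm (delta m (D (P m))) \<le> norm (D S) + c_delta * exp (- S m) * real (?n - 1 - m)" using A[of m m] i by simp
      also have "c_delta * exp (- S m) * real (?n - 1 - m) \<le> c_delta * exp (- r) * real ?n"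
        using c_delta r by (intro mult_mono) auto
      finally show "norm (delta m (D (P m))) \<le> norm (D S) + c_delta * exp (- r) * real ?n" by simp
      show "c_delta * (exp (- r) - exp (- S m)) \<le> c_delta * exp (- r)" using c_delta by (intro mult_left_mono) auto
    qed
    finally show ?thesis by (simp add: algebra_simps)
  qed
  (* Integrating the bounds for the block and for eps over the m-th stretch; the rotation by \<Psi> does not contribute. *)
  have C: "norm (D (P (m - 1))) \<le> norm (D (P m)) + (2 * b * norm (D S) * (S m - s m) + c_path * exp (- s m))"
    if m: "m \<in> {2..?n - 1}" for m
  proof -
    have i: "1 \<le> m" "m \<le> ?n - 1" "2 \<le> m" using m by auto
    have c_path: "0 \<le> c_path" using c_delta b_nonneg by (auto simp: c_path_def)
    have "\<bar>norm (D ((P m)(m := S m))) - norm (D ((P m)(m := s m)))\<bar>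
        \<le> (2 * b * norm (D S) * S m - c_path * exp (- S m)) - (2 * b * norm (D S) * s m - c_path * exp (- s m))"
    proof (rule norm_growth[OF sS[OF m], where f = "\<lambda>r. D ((P m)(m := r))"
          and A = "\<lambda>r. cscale c0 (ad (delta m (\<Psi> ((P m)(m := r)))) (D ((P m)(m := r))))"
          and r = "\<lambda>r. cscale c0 (ad (delta m (D ((P m)(m := r)))) (\<Phi> ((P m)(m := r))) + q m ((P m)(m := r)))"
          and \<phi>' = "\<lambda>r. 2 * b * norm (D S) + c_path * exp (- r)" and \<phi> = "\<lambda>r. 2 * b * norm (D S) * r - c_path * exp (- r)"])
      fix r assume r: "s m \<le> r" "r \<le> S m"
      let ?p = "(P m)(m := r)"
      show "((\<lambda>r. D ((P m)(m := r))) has_vector_derivative cscale c0 (ad (delta m (\<Psi> ?p)) (D ?p)) +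
         cscale c0 (ad (delta m (D ?p)) (\<Phi> ?p) + q m ?p)) (at r)"
        by (rule D_deriv[OF i(1,2)])
      show "inner (D ?p) (cscale c0 (ad (delta m (\<Psi> ?p)) (D ?p))) = 0"
        by (intro inner_c0_ad hermitian_delta herm)
      show "((\<lambda>r. 2 * b * norm (D S) * r - c_path * exp (- r)) has_real_derivative 2 * b * norm (D S) + c_path * exp (- r)) (at r)"
        by (auto intro!: derivative_eq_intros)
      have "norm (ad (delta m (D ?p)) (\<Phi> ?p)) \<le> 2 * (norm (D S) + (real ?n + 1) * c_delta * exp (- r)) * b"
        using B[OF m r] b[of ?p] c_delta b_nonneg by (intro order_trans[OF norm_ad] mult_mono) auto
      moreover have "norm (q m ?p) \<le> 2 * c_delta * exp (- r)" using q_bounds(1)[OF reg[OF r(1)] i(3) order_refl i(2)] by simp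
      ultimately have "norm (ad (delta m (D ?p)) (\<Phi> ?p) + q m ?p) \<le> 2 * (norm (D S) + (real ?n + 1) * c_delta * exp (- r)) * b + 2 * c_delta * exp (- r)"
        by (intro order_trans[OF norm_triangle_ineq] add_mono)
      also have "\<dots> = 2 * b * norm (D S) + c_path * exp (- r)" by (simp add: c_path_def algebra_simps)
      finally show "norm (cscale c0 (ad (delta m (D ?p)) (\<Phi> ?p) + q m ?p)) \<le> 2 * b * norm (D S) + c_path * exp (- r)"
        by (rule order_trans[OF norm_cscale_c0_le])
    qed
    moreover have "(P m)(m := s m) = P (m - 1)" using P_down[of "m - 1"] i by simp
    ultimately have "norm (D (P (m - 1))) \<le> norm (D (P m)) + (2 * b * norm (D S) * (S m - s m) + c_path * exp (- s m)) - c_path * exp (- S m)"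
      unfolding P_up by (simp add: algebra_simps abs_le_iff)
    moreover have "0 \<le> c_path * exp (- S m)" using c_path by simp
    ultimately show ?thesis by linarith
  qed
  have "norm (D (P j)) \<le> norm (D S) + (\<Sum>m=Suc j..?n - 1. 2 * b * norm (D S) * (S m - s m) + c_path * exp (- s m))"
    if "1 \<le> j" "j \<le> ?n - 1" for j
    using that(2,1)
  proof (induction j rule: inc_induct)
    case base
    show ?case unfolding P_top by simp
  next
    case (step j)
    have "{Suc j..?n - 1} = insert (Suc j) {Suc (Suc j)..?n - 1}" using step by auto
    then show ?case using C[of "Suc j"] step by auto
  qed
  from this[of 1] show ?thesis
  proof (cases "1 \<le> ?n - 1")
    case False
    then have "P 1 = S" using eq by (auto simp: P_def fun_eq_iff)
    then show ?thesis using False P_bot by simp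
  qed (simp add: P_bot[unfolded One_nat_def] numeral_2_eq_2)
qed

end

section \<open>Gap asymptotics in logarithmic coordinates\<close>

lemma pt_cong:
  assumes "\<And>i. i \<in> {1..CARD('n) - 1} \<Longrightarrow> s i = s' i"
  shows "(pt s :: real^'n::{finite,linorder}) = pt s'"
proof -
  have g: "gapl s l = gapl s' l" if "l < CARD('n)" for l
    unfolding gapl_def using assms that by (intro arg_cong[of _ _ exp] sum.cong) auto
  have "upos s (idx_pos i) = upos s' (idx_pos i)" for i :: 'n
    unfolding upos_def using idx_pos_bounds(2)[of i] by (intro sum.cong refl g) auto
  then show ?thesis by (simp add: pt_def)
qed

lemma model_cong:
  fixes Z :: "'n::{finite,linorder} cmat"
  assumes "\<And>i. i \<in> {1..CARD('n) - 1} \<Longrightarrow> s i = s' i"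
  shows "model Z s = model Z s'"
  using gprod_cong[of "CARD('n) - 1" s s' Z Z] assms by (simp add: model_def)

text \<open>
  The inverse of \<open>pt\<close>, up to the translation by \<open>u\<^sub>1\<close>.
\<close>

definition s_of :: "real^'n::{finite,linorder} \<Rightarrow> nat \<Rightarrow> real" where
  "s_of u k = (if k = 1 then ln (coord u 2 - coord u 1) else ln (gap_ratio k u))"

lemma coord_less:
  fixes u :: "real^'n::{finite,linorder}"
  assumes "u \<in> U_id" "1 \<le> a" "a < b" "b \<le> CARD('n)" shows "coord u a < coord u b"
proof -
  have "idx_pos (idx a :: 'n) < idx_pos (idx b :: 'n)" using assms by (simp add: idx_pos_idx)
  then show ?thesis using assms(1) by (simp add: idx_pos_less_iff U_id_iff)
qed

lemma upos_s_of:
  fixes u :: "real^'n::{finite,linorder}"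
  assumes u: "u \<in> U_id"
  shows "1 \<le> l \<Longrightarrow> l < CARD('n) \<Longrightarrow> gapl (s_of u) l = coord u (Suc l) - coord u l"
    and "1 \<le> j \<Longrightarrow> j \<le> CARD('n) \<Longrightarrow> upos (s_of u) j = coord u j - coord u 1"
proof -
  have g: "gapl (s_of u) l = coord u (Suc l) - coord u l" if "1 \<le> l" "l < CARD('n)" for l
    using that
  proof (induction l rule: dec_induct)
    case base
    then show ?case using coord_less[OF u, of 1 2] by (simp add: gapl_def s_of_def numeral_2_eq_2)
  next
    case (step l)
    have pos: "coord u l < coord u (Suc l)" "coord u (Suc l) < coord u (Suc (Suc l))"
      using coord_less[OF u] step by auto
    have r: "gap_ratio (Suc l) u = (coord u (Suc (Suc l)) - coord u (Suc l)) / (coord u (Suc l) - coord u l)"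
      by (simp add: gap_ratio_def)
    have "gapl (s_of u) (Suc l) = gapl (s_of u) l * exp (s_of u (Suc l))"
      by (simp add: gapl_def exp_add)
    also have "exp (s_of u (Suc l)) = gap_ratio (Suc l) u"
      using pos step r by (simp add: s_of_def)
    finally show ?case using step pos r by simp
  qed
  show "1 \<le> l \<Longrightarrow> l < CARD('n) \<Longrightarrow> gapl (s_of u) l = coord u (Suc l) - coord u l" by (rule g)
  show "1 \<le> j \<Longrightarrow> j \<le> CARD('n) \<Longrightarrow> upos (s_of u) j = coord u j - coord u 1"
  proof (induction j rule: dec_induct)
    case (step j)
    then show ?case by (simp add: upos_Suc g)
  qed (simp add: upos_1)
qed

lemma pt_s_of:
  fixes u :: "real^'n::{finite,linorder}"
  assumes u: "u \<in> U_id"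
  shows "u = pt (s_of u) + coord u 1 *\<^sub>R (\<chi> i. 1)"
proof -
  have "u $ i = (pt (s_of u) + coord u 1 *\<^sub>R (\<chi> i. 1)) $ i" for i
    using upos_s_of(2)[OF u, of "idx_pos i"] idx_pos_bounds[of i] by (simp add: pt_def idx_idx_pos)
  then show ?thesis by (intro vec_eq_iff[THEN iffD2] allI)
qed

lemma coord_pt: "j \<in> {1..CARD('n)} \<Longrightarrow> coord (pt s :: real^'n::{finite,linorder}) j = upos s j"
  by (simp add: pt_def idx_pos_idx)

lemma gapl_step: "1 \<le> k \<Longrightarrow> gapl s k = gapl s (k - 1) * exp (s k)"
proof -
  assume "1 \<le> k"
  then have "{1..k} = insert k {1..k - 1}" by auto
  then have "(\<Sum>m\<in>{1..k}. s m) = s k + (\<Sum>m\<in>{1..k - 1}. s m)" using \<open>1 \<le> k\<close> by simp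
  then show ?thesis by (simp add: gapl_def exp_add mult.commute)
qed

lemma gap_ratio_pt:
  assumes k: "k \<in> {2..CARD('n) - 1}"
  shows "gap_ratio k (pt s :: real^'n::{finite,linorder}) = exp (s k)"
proof -
  have "gap_ratio k (pt s :: real^'n::{finite,linorder}) = (upos s (k + 1) - upos s k) / (upos s k - upos s (k - 1))"
    unfolding gap_ratio_def using k by (subst (1 2 3 4) coord_pt) auto
  also have "\<dots> = gapl s k / gapl s (k - 1)"
  proof -
    have k1: "1 \<le> k" "1 \<le> k - 1" "Suc (k - 1) = k" using k by auto
    show ?thesis using upos_Suc[OF k1(1), of s] upos_Suc[OF k1(2), of s] unfolding k1(3) by simp
  qed
  also have "\<dots> = exp (s k)" using gapl_step[of k s] gapl_pos[of s "k - 1"] k by simp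
  finally show ?thesis .
qed

lemma s_of_pt:
  assumes k: "k \<in> {1..CARD('n) - 1}" and n: "2 \<le> CARD('n)"
  shows "s_of (pt s :: real^'n::{finite,linorder}) k = s k"
proof (cases "k = 1")
  case True
  have "coord (pt s :: real^'n::{finite,linorder}) 2 - coord (pt s :: real^'n::{finite,linorder}) 1 = upos s 2 - upos s 1"
    using n by (subst (1 2) coord_pt) auto
  also have "\<dots> = exp (s 1)" by (simp add: numeral_2_eq_2 upos_Suc gapl_def)
  finally show ?thesis using True by (simp add: s_of_def)
qed (use k gap_ratio_pt[where 'n = 'n, of k s] in \<open>simp add: s_of_def\<close>)

lemma gprod_foldr:
  assumes "k \<le> n - 1"
  shows "gprod s Z k ** foldr (\<lambda>k M. flow (s k) k Z ** M) [Suc k..<n] (mat 1) = gprod s Z (n - 1)"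
  using assms
proof (induction k rule: inc_induct)
  case base
  have "[Suc (n - 1)..<n] = []" by simp
  then show ?case by (simp only: foldr_Nil id_apply matrix_mul_rid)
next
  case (step k)
  have "[Suc k..<n] = Suc k # [Suc (Suc k)..<n]" using step by (intro upt_conv_Cons) simp
  then show ?case using step by (simp add: matrix_mul_assoc)
qed

lemma leading_conj_eq_model:
  fixes Z :: "'n::{finite,linorder} cmat"
  assumes n: "2 \<le> CARD('n)" and Z: "hermitian Z"
  shows "Ad (leading_conj Z u) Z = model Z (s_of u)"
proof -
  have "foldr (\<lambda>k M. real_mat_powr (gap_ratio k u) (cscale c0 (delta k Z)) ** M) [2..<CARD('n)] (mat 1) =
      foldr (\<lambda>k M. flow (s_of u k) k Z ** M) [2..<CARD('n)] (mat 1)"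
    by (intro foldr_cong refl) (auto simp: flow_def s_of_def real_mat_powr_def)
  moreover have "real_mat_powr (coord u 2 - coord u 1) (cscale c0 (delta 1 Z)) = flow (s_of u 1) 1 Z"
    by (simp add: flow_def s_of_def real_mat_powr_def)
  ultimately have "leading_conj Z u = gprod (s_of u) Z 1 ** foldr (\<lambda>k M. flow (s_of u k) k Z ** M) [Suc 1..<CARD('n)] (mat 1)"
    unfolding leading_conj_def c0_def[symmetric] by (simp add: numeral_2_eq_2)
  also have "\<dots> = gprod (s_of u) Z (CARD('n) - 1)" using n by (intro gprod_foldr) simp
  finally show ?thesis by (simp add: model_def Ad_unitary unitary_gprod Z)
qed

text \<open>
  The isomonodromy vector field depends only on differences of the components of its direction.
\<close>

lemma solution_translation:
  assumes \<Phi>: "solution_on U_id \<Phi>" and u: "u \<in> U_id"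
  shows "\<Phi> (u + a *\<^sub>R (\<chi> i. 1)) = \<Phi> u"
proof -
  have "((\<lambda>t. \<Phi> (u + t *\<^sub>R (\<chi> i. 1))) has_vector_derivative 0) (at t)" for t
  proof -
    have "u + t *\<^sub>R (\<chi> i. 1) \<in> U_id" using u by (simp add: U_id_iff)
    from solution_on_deriv[OF \<Phi> this]
    have "((\<lambda>t. \<Phi> (u + t *\<^sub>R (\<chi> i. 1))) has_vector_derivative iso_field (u + t *\<^sub>R (\<chi> i. 1)) (\<chi> i. 1) (\<Phi> (u + t *\<^sub>R (\<chi> i. 1)))) (at t)" .
    moreover have "iso_field v (\<chi> i. 1) Z = 0" for v and Z :: "'a cmat"
    proof -
      have "dmat (\<chi> i. 1) = (0 :: 'a cmat)" by (simp add: vec_eq_iff)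
      then show ?thesis by (simp add: iso_field_def wmat_def ad.zero_right linear_0[OF bounded_linear.linear[OF bounded_linear_cscale]])
    qed
    ultimately show ?thesis by simp
  qed
  then obtain c where "\<And>t. \<Phi> (u + t *\<^sub>R (\<chi> i. 1)) = c"
    using has_vector_derivative_zero_constant[of UNIV "\<lambda>t. \<Phi> (u + t *\<^sub>R (\<chi> i. 1))"] by auto
  from this[of a] this[of 0] show ?thesis by simp
qed

text \<open>
  The expansion in logarithmic coordinates. Since the remainders only have to add up to the error of the leading term, a bound for
  the whole error by a multiple of the sum is equivalent to the existence of separate remainders.
\<close>

definition gap_asymptotic :: "(real^'n::{finite,linorder} \<Rightarrow> 'n cmat) \<Rightarrow> 'n cmat \<Rightarrow> bool" where
  "gap_asymptotic \<Phi> Z \<longleftrightarrow> (\<exists>M\<ge>0. \<exists>L. \<forall>s\<in>region CARD('n) L.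
     norm (\<Phi> (pt s) - model Z s) \<le> M * (\<Sum>k=2..CARD('n) - 1. exp (- s k)))"

lemma gap_asymptoticD:
  fixes \<Phi> :: "real^'n::{finite,linorder} \<Rightarrow> 'n cmat"
  assumes n: "2 \<le> CARD('n)" and Z: "hermitian Z" and as: "has_gap_asymptotics \<Phi> Z"
  shows "gap_asymptotic \<Phi> Z"
proof -
  obtain Rk L where Rk: "\<forall>k\<in>{2..CARD('n) - 1}. gap_remainder k (Rk k)"
    and L: "\<forall>u\<in>U_id. (\<forall>k\<in>{2..CARD('n) - 1}. L \<le> gap_ratio k u) \<longrightarrow>
             \<Phi> u = Ad (leading_conj Z u) Z + (\<Sum>k=2..CARD('n) - 1. Rk k u)"
    using as unfolding has_gap_asymptotics_def by blast
  have "\<forall>k\<in>{2..CARD('n) - 1}. \<exists>ml. 0 < fst ml \<and> (\<forall>u\<in>U_id. snd ml \<le> gap_ratio k u \<longrightarrow>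
        norm (Rk k u) \<le> fst ml * ((coord u k - coord u (k - 1)) / (coord u (k + 1) - coord u k)))"
    using Rk unfolding gap_remainder_def by (metis fst_conv snd_conv)
  from bchoice[OF this] obtain ml where ml: "\<forall>k\<in>{2..CARD('n) - 1}. 0 < fst (ml k) \<and> (\<forall>u\<in>U_id. snd (ml k) \<le> gap_ratio k u \<longrightarrow>
        norm (Rk k u) \<le> fst (ml k) * ((coord u k - coord u (k - 1)) / (coord u (k + 1) - coord u k)))" by blast
  define M where "M = (\<Sum>k=2..CARD('n) - 1. fst (ml k))"
  have M: "fst (ml k) \<le> M" if "k \<in> {2..CARD('n) - 1}" for k
    unfolding M_def using ml that by (intro member_le_sum) (auto intro: less_imp_le)
  have M0: "0 \<le> M" unfolding M_def using ml by (intro sum_nonneg) (auto intro: less_imp_le)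
  (* exp x \<ge> x turns this bound for s k into all the lower bounds that are required of the gap ratios. *)
  define L' where "L' = \<bar>L\<bar> + (\<Sum>k=2..CARD('n) - 1. \<bar>snd (ml k)\<bar>)"
  have LL: "L \<le> exp x" and Lk: "k \<in> {2..CARD('n) - 1} \<Longrightarrow> snd (ml k) \<le> exp x" if "L' \<le> x" for x k
  proof -
    have e: "L' \<le> exp x" using that exp_ge_add_one_self[of x] by linarith
    have "0 \<le> (\<Sum>k=2..CARD('n) - 1. \<bar>snd (ml k)\<bar>)" by (intro sum_nonneg) auto
    then show "L \<le> exp x" using e abs_ge_self[of L] unfolding L'_def by linarith
    assume "k \<in> {2..CARD('n) - 1}"
    then have "\<bar>snd (ml k)\<bar> \<le> (\<Sum>k=2..CARD('n) - 1. \<bar>snd (ml k)\<bar>)" by (intro member_le_sum) auto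
    then show "snd (ml k) \<le> exp x" using e abs_ge_self[of "snd (ml k)"] abs_ge_zero[of L] unfolding L'_def by linarith
  qed
  have "norm (\<Phi> (pt s) - model Z s) \<le> M * (\<Sum>k=2..CARD('n) - 1. exp (- s k))" if s: "s \<in> region CARD('n) L'" for s
  proof -
    have U: "(pt s :: real^'n::{finite,linorder}) \<in> U_id" by (rule pt_in_U_id)
    have gr: "gap_ratio k (pt s :: real^'n::{finite,linorder}) = exp (s k)" if "k \<in> {2..CARD('n) - 1}" for k
      by (rule gap_ratio_pt[OF that])
    have sk: "L' \<le> s k" if "k \<in> {2..CARD('n) - 1}" for k using s that by (simp add: region_def)
    have "\<Phi> (pt s) = Ad (leading_conj Z (pt s)) Z + (\<Sum>k=2..CARD('n) - 1. Rk k (pt s))"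
      using L U gr LL[OF sk] by simp
    moreover have "Ad (leading_conj Z (pt s)) Z = model Z s"
      unfolding leading_conj_eq_model[OF n Z] by (rule model_cong) (rule s_of_pt[OF _ n])
    ultimately have "norm (\<Phi> (pt s) - model Z s) \<le> (\<Sum>k=2..CARD('n) - 1. norm (Rk k (pt s)))"
      by (simp add: norm_sum)
    also have "\<dots> \<le> (\<Sum>k=2..CARD('n) - 1. M * exp (- s k))"
    proof (intro sum_mono)
      fix k assume k: "k \<in> {2..CARD('n) - 1}"
      have "(coord (pt s :: real^'n::{finite,linorder}) k - coord (pt s :: real^'n::{finite,linorder}) (k - 1)) /
          (coord (pt s :: real^'n::{finite,linorder}) (k + 1) - coord (pt s :: real^'n::{finite,linorder}) k) = inverse (gap_ratio k (pt s :: real^'n::{finite,linorder}))"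
        by (simp add: gap_ratio_def)
      also have "\<dots> = exp (- s k)" by (simp add: gr[OF k] exp_minus)
      finally have inv: "(coord (pt s :: real^'n::{finite,linorder}) k - coord (pt s :: real^'n::{finite,linorder}) (k - 1)) /
          (coord (pt s :: real^'n::{finite,linorder}) (k + 1) - coord (pt s :: real^'n::{finite,linorder}) k) = exp (- s k)" .
      have "snd (ml k) \<le> gap_ratio k (pt s :: real^'n::{finite,linorder})" using Lk[OF sk[OF k] k] gr[OF k] by simp
      from bspec[OF ml k, THEN conjunct2, rule_format, OF U this]
      have "norm (Rk k (pt s)) \<le> fst (ml k) * exp (- s k)" unfolding inv .
      also have "\<dots> \<le> M * exp (- s k)" using M[OF k] by (intro mult_right_mono) auto
      finally show "norm (Rk k (pt s)) \<le> M * exp (- s k)" .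
    qed
    finally show ?thesis by (simp add: sum_distrib_left)
  qed
  then show ?thesis unfolding gap_asymptotic_def using M0 by blast
qed

text \<open>
  The error is distributed over the remainders in proportion to \<open>exp (- s\<^sub>k)\<close>. Outside the region where the error bound holds the
  remainders may be chosen as zero. If \<open>n = 2\<close> the sum is empty and the bound says that the error vanishes.
\<close>

lemma gap_asymptoticI:
  fixes \<Phi> :: "real^'n::{finite,linorder} \<Rightarrow> 'n cmat"
  assumes n: "2 \<le> CARD('n)" and Z: "hermitian Z" and \<Phi>: "solution_on U_id \<Phi>" and as: "gap_asymptotic \<Phi> Z"
  shows "has_gap_asymptotics \<Phi> Z"
proof -
  let ?I = "{2..CARD('n) - 1}"
  obtain M L where M: "0 \<le> M" and L: "\<And>s. s \<in> region CARD('n) L \<Longrightarrow>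
     norm (\<Phi> (pt s) - model Z s) \<le> M * (\<Sum>k\<in>?I. exp (- s k))"
    using as unfolding gap_asymptotic_def by blast
  define E where "E = (\<lambda>u. \<Phi> u - Ad (leading_conj Z u) Z)"
  define W where "W = (\<lambda>u :: real^'n::{finite,linorder}. \<Sum>k\<in>?I. exp (- s_of u k))"
  have E: "norm (E u) \<le> M * W u" if u: "u \<in> U_id" and r: "\<And>k. k \<in> ?I \<Longrightarrow> exp L \<le> gap_ratio k u" for u
  proof -
    have "\<Phi> u = \<Phi> (pt (s_of u) + coord u 1 *\<^sub>R (\<chi> i. 1))" by (rule arg_cong[OF pt_s_of[OF u]])
    also have "\<dots> = \<Phi> (pt (s_of u))" by (rule solution_translation[OF \<Phi> pt_in_U_id])
    finally have 1: "E u = \<Phi> (pt (s_of u)) - model Z (s_of u)" by (simp add: E_def leading_conj_eq_model[OF n Z])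
    have "L \<le> s_of u k" if k: "k \<in> ?I" for k
    proof -
      have g: "0 < gap_ratio k u" using r[OF k] exp_gt_zero[of L] by linarith
      have "L = ln (exp L)" by simp
      also have "\<dots> \<le> ln (gap_ratio k u)" using r[OF k] g by (subst ln_le_cancel_iff) auto
      finally show ?thesis using k by (simp add: s_of_def)
    qed
    then have "s_of u \<in> region CARD('n) L" by (simp add: region_def)
    from L[OF this] show ?thesis by (simp add: 1 W_def)
  qed
  define good where "good = (\<lambda>u :: real^'n::{finite,linorder}. \<forall>k\<in>?I. exp L \<le> gap_ratio k u)"
  define Rk where "Rk = (\<lambda>k u. if good u then (exp (- s_of u k) / W u) *\<^sub>R E u else 0)"
  have Wpos: "?I \<noteq> {} \<Longrightarrow> 0 < W u" for u unfolding W_def by (intro sum_pos) auto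
  have "gap_remainder k (Rk k)" if k: "k \<in> ?I" for k
    unfolding gap_remainder_def
  proof (intro exI conjI ballI impI)
    show "0 < M + 1" using M by simp
    fix u :: "real^'n::{finite,linorder}" assume u: "u \<in> U_id"
    have c: "coord u (k - 1) < coord u k" "coord u k < coord u (k + 1)"
      using coord_less[OF u, of "k - 1" k] coord_less[OF u, of k "k + 1"] k by auto
    have r: "(coord u k - coord u (k - 1)) / (coord u (k + 1) - coord u k) = exp (- s_of u k)"
    proof -
      have "0 < gap_ratio k u" using c by (simp add: gap_ratio_def)
      then have "exp (- s_of u k) = inverse (gap_ratio k u)" using k by (simp add: s_of_def exp_minus)
      then show ?thesis by (simp add: gap_ratio_def)
    qed
    have W: "0 < W u" using Wpos k by blast
    have "norm (Rk k u) \<le> M * exp (- s_of u k)"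
    proof (cases "good u")
      case True
      then have "norm (Rk k u) \<le> (exp (- s_of u k) / W u) * (M * W u)"
        using E[OF u] W unfolding Rk_def good_def by (simp add: divide_right_mono mult_left_mono del: times_divide_eq_left)
      then show ?thesis using W by (simp add: mult.commute)
    qed (simp add: Rk_def M)
    also have "\<dots> \<le> (M + 1) * exp (- s_of u k)" by (intro mult_right_mono) auto
    finally show "norm (Rk k u) \<le> (M + 1) * ((coord u k - coord u (k - 1)) / (coord u (k + 1) - coord u k))"
      unfolding r .
  qed
  moreover have "\<Phi> u = Ad (leading_conj Z u) Z + (\<Sum>k\<in>?I. Rk k u)" if u: "u \<in> U_id" and r: "\<forall>k\<in>?I. exp L \<le> gap_ratio k u" for u
  proof -
    have g: "good u" using r by (simp add: good_def)
    have "(\<Sum>k\<in>?I. Rk k u) = E u"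
    proof (cases "?I = {}")
      case True
      then show ?thesis using E[OF u] r by (simp add: W_def)
    next
      case False
      have "(\<Sum>k\<in>?I. Rk k u) = (\<Sum>k\<in>?I. exp (- s_of u k) / W u) *\<^sub>R E u"
        using g by (simp add: Rk_def scaleR_sum_left)
      also have "(\<Sum>k\<in>?I. exp (- s_of u k) / W u) = 1"
        using Wpos[OF False, of u] by (simp add: sum_divide_distrib[symmetric] W_def)
      finally show ?thesis by simp
    qed
    then show ?thesis by (simp add: E_def)
  qed
  ultimately show ?thesis unfolding has_gap_asymptotics_def by blast
qed

lemma compare_solution_model:
  fixes \<Phi> :: "real^'n::{finite,linorder} \<Rightarrow> 'n cmat"
  assumes \<Phi>: "solution_on U_id \<Phi>" and b: "\<And>u. u \<in> U_id \<Longrightarrow> norm (\<Phi> u) \<le> b" and Z: "hermitian Z"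
  shows "compare (\<lambda>s. \<Phi> (pt s)) (model Z) 0 b (b * b) 0"
proof
  show "((\<lambda>r. \<Phi> (pt (s(k := r)))) has_vector_derivative
      cscale c0 (ad ((delta_mask k + eps_mat k (s(k := r))) * \<Phi> (pt (s(k := r)))) (\<Phi> (pt (s(k := r)))))) (at r)"
    if "1 \<le> k" for k s r by (rule solution_deriv_s[OF \<Phi> that])
  show "((\<lambda>r. model Z (s(k := r))) has_vector_derivative
      cscale c0 (ad (delta_mask k * model Z (s(k := r))) (model Z (s(k := r))) +
        0 *\<^sub>R ad (eps_mat k (s(k := r)) * model Z (s(k := r))) (model Z (s(k := r))))) (at r)"
    if "1 \<le> k" "k \<le> CARD('n) - 1" for k s r
    using model_deriv[OF Z that, of s r] by (simp add: delta_eq_mask)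
  show "norm (\<Phi> (pt s) $ i $ l * \<Phi> (pt s) $ l $ j - of_real 0 * (model Z s $ i $ l * model Z s $ l $ j)) \<le> b * b" for s i l j
  proof -
    have e: "norm (\<Phi> (pt s) $ i $ l) \<le> b" for i l using norm_nth_nth_le b[OF pt_in_U_id] order_trans by blast
    have "0 \<le> b" using e norm_ge_zero order_trans by blast
    then show ?thesis using e by (simp add: norm_mult mult_mono)
  qed
qed (use b pt_in_U_id hermitian_model[OF Z] in auto)

lemma compare_solutions:
  fixes \<Phi> \<Psi> :: "real^'n::{finite,linorder} \<Rightarrow> 'n cmat"
  assumes \<Phi>: "solution_on U_id \<Phi>" and b: "\<And>u. u \<in> U_id \<Longrightarrow> norm (\<Phi> u) \<le> b"
    and \<Psi>: "solution_on U_id \<Psi>" and b': "\<And>u. u \<in> U_id \<Longrightarrow> norm (\<Psi> u) \<le> b" and h: "\<And>u. u \<in> U_id \<Longrightarrow> hermitian (\<Psi> u)"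
    and R: "0 \<le> R" and K: "\<And>s. s \<in> region CARD('n) R \<Longrightarrow> norm (\<Phi> (pt s) - \<Psi> (pt s)) \<le> K"
  shows "compare (\<lambda>s. \<Phi> (pt s)) (\<lambda>s. \<Psi> (pt s)) 1 b (2 * b * K) R"
proof
  show "((\<lambda>r. \<Phi> (pt (s(k := r)))) has_vector_derivative
      cscale c0 (ad ((delta_mask k + eps_mat k (s(k := r))) * \<Phi> (pt (s(k := r)))) (\<Phi> (pt (s(k := r)))))) (at r)"
    if "1 \<le> k" for k s r by (rule solution_deriv_s[OF \<Phi> that])
  show "((\<lambda>r. \<Psi> (pt (s(k := r)))) has_vector_derivative
      cscale c0 (ad (delta_mask k * \<Psi> (pt (s(k := r)))) (\<Psi> (pt (s(k := r)))) +
        1 *\<^sub>R ad (eps_mat k (s(k := r)) * \<Psi> (pt (s(k := r)))) (\<Psi> (pt (s(k := r)))))) (at r)"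
    if "1 \<le> k" for k s r
    using solution_deriv_s[OF \<Psi> that, of s r] by (simp add: distrib_right ad.add_left)
  show "norm (\<Phi> (pt s) $ i $ l * \<Phi> (pt s) $ l $ j - of_real 1 * (\<Psi> (pt s) $ i $ l * \<Psi> (pt s) $ l $ j)) \<le> 2 * b * K"
    if s: "s \<in> region CARD('n) R" for s i l j
  proof -
    let ?A = "\<Phi> (pt s)" and ?B = "\<Psi> (pt s)"
    have e: "norm (?A $ i $ l) \<le> b" "norm (?B $ i $ l) \<le> b" for i l
      using norm_nth_nth_le b[OF pt_in_U_id] b'[OF pt_in_U_id] order_trans by blast+
    have d: "norm (?A $ i $ l - ?B $ i $ l) \<le> K" for i l
      using order_trans[OF norm_nth_nth_le K[OF s], of i l] by simp
    have b0: "0 \<le> b" using order_trans[OF norm_ge_zero e(1)] .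
    have K0: "0 \<le> K" using order_trans[OF norm_ge_zero d] .
    have "?A $ i $ l * ?A $ l $ j - ?B $ i $ l * ?B $ l $ j = (?A $ i $ l - ?B $ i $ l) * ?A $ l $ j + ?B $ i $ l * (?A $ l $ j - ?B $ l $ j)"
      by (simp add: algebra_simps)
    also have "norm \<dots> \<le> K * b + b * K"
      by (intro order_trans[OF norm_triangle_ineq] add_mono) (auto simp: norm_mult intro!: mult_mono e d b0 K0)
    finally show ?thesis by (simp add: algebra_simps)
  qed
qed (use b R pt_in_U_id h in auto)

section \<open>Existence and uniqueness of the regularized limit\<close>

text \<open>
  The points tending to infinity at which solutions and leading terms are matched.
\<close>

definition corner :: "nat \<Rightarrow> nat \<Rightarrow> nat \<Rightarrow> real" where
  "corner n N i = (if i \<in> {2..n - 1} then real N else 0)"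

text \<open>
  The comparison with initial difference zero. The constant depends only on \<open>n\<close> and the norm, and not on the point of matching.
\<close>

lemma model_error:
  fixes \<Phi> :: "real^'n::{finite,linorder} \<Rightarrow> 'n cmat"
  assumes n: "2 \<le> CARD('n)" and \<Phi>: "solution_on U_id \<Phi>" and b: "\<And>u. u \<in> U_id \<Longrightarrow> norm (\<Phi> u) \<le> b" and Z: "hermitian Z"
    and eq: "\<Phi> (pt (corner CARD('n) N)) = model Z (corner CARD('n) N)"
    and s: "s \<in> region CARD('n) 0" and N: "\<And>i. i \<in> {2..CARD('n) - 1} \<Longrightarrow> s i \<le> real N"
  shows "norm (\<Phi> (pt s) - model Z s) \<le>
     ((2 * b * (real CARD('n) + 1) + 2) * (real CARD('n) ^ 4 * (b * b))) * (\<Sum>k=2..CARD('n) - 1. exp (- s k))"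
proof -
  interpret compare "\<lambda>s. \<Phi> (pt s)" "model Z" 0 b "b * b" 0 by (rule compare_solution_model[OF \<Phi> b Z])
  (* The first coordinate, which may have either sign, is adjusted at the start by coordinate_one. *)
  let ?S = "\<lambda>i. if i \<in> {2..CARD('n) - 1} then real N else s i"
  let ?C = "(corner CARD('n) N)(1 := s 1)"
  have "D ?C = 0" by (rule coordinate_one[OF n]) (simp add: D_def eq)
  then have DC: "norm (D ?C) = 0" by simp
  have SC: "?S i = ?C i" if "i \<in> {1..CARD('n) - 1}" for i using that by (auto simp: corner_def)
  have "(pt ?S :: real^'n::{finite,linorder}) = pt ?C" by (rule pt_cong) (rule SC)
  moreover have "model Z ?S = model Z ?C" by (rule model_cong) (rule SC)
  ultimately have "D ?S = D ?C" by (simp only: D_def)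
  then have 0: "D ?S = 0" using DC by (simp only: norm_eq_zero)
  have "norm (D s) \<le> norm (D ?S) + (\<Sum>m=2..CARD('n) - 1. 2 * b * norm (D ?S) * (?S m - s m) + c_path * exp (- s m))"
    by (rule comparison[OF s]) (use N in auto)
  then show ?thesis unfolding 0 by (simp add: D_def c_path_def c_delta_def sum_distrib_left)
qed

lemma limit_le_const:
  assumes "(f \<longlonglongrightarrow> (l::real))" "\<And>N. N \<ge> N0 \<Longrightarrow> f N \<le> c" shows "l \<le> c"
  using assms by (intro LIMSEQ_le_const2) auto

lemma closed_hermitian:
  assumes f: "f \<longlonglongrightarrow> Z" and h: "\<And>N. hermitian (f N)"
  shows "hermitian Z"
proof -
  have "(\<lambda>N. dagger (f N)) \<longlonglongrightarrow> dagger Z" by (rule bounded_linear.tendsto[OF bounded_linear_dagger f])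
  moreover have "dagger (f N) = f N" for N using h[of N] by (simp add: hermitian_iff_dagger)
  ultimately have "f \<longlonglongrightarrow> dagger Z" by simp
  then have "dagger Z = Z" by (rule LIMSEQ_unique[OF _ f])
  then show ?thesis by (simp only: hermitian_iff_dagger)
qed

lemma bounded_subsequence:
  fixes f :: "nat \<Rightarrow> 'n::finite cmat"
  assumes "\<And>N. norm (f N) \<le> b"
  obtains l r where "strict_mono (r :: nat \<Rightarrow> nat)" "(\<lambda>N. f (r N)) \<longlonglongrightarrow> l"
proof -
  have "bounded (range f)" using assms by (auto simp: bounded_iff)
  from bounded_imp_convergent_subsequence[OF this] show ?thesis using that by (auto simp: o_def)
qed

lemma bounded_by_nat: "\<exists>N0::nat. \<forall>i\<in>{2..n - 1}. s i \<le> real N0" for s :: "nat \<Rightarrow> real"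
proof -
  obtain N0 :: nat where "(\<Sum>i\<in>{2..n - 1}. \<bar>s i\<bar>) < real N0" using reals_Archimedean2 by blast
  moreover have "s i \<le> (\<Sum>i\<in>{2..n - 1}. \<bar>s i\<bar>)" if "i \<in> {2..n - 1}" for i
    using member_le_sum[of i "{2..n - 1}" "\<lambda>i. \<bar>s i\<bar>"] that by auto
  ultimately have "\<forall>i\<in>{2..n - 1}. s i \<le> real N0" by fastforce
  then show ?thesis ..
qed

text \<open>
  Let \<open>Z N\<close> be the constant for which the leading term agrees with \<open>\<Phi>\<close> at the \<open>N\<close>-th corner. All \<open>Z N\<close> have the norm of \<open>\<Phi>\<close>; a limit of a
  subsequence inherits the bound of \<open>model_error\<close>, which is uniform in \<open>N\<close>.
\<close>

theorem regularized_limit_exists: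
  fixes \<Phi> :: "real^'n::{finite,linorder} \<Rightarrow> 'n cmat"
  assumes n: "2 \<le> CARD('n)" and \<Phi>: "solution_on U_id \<Phi>" and h: "\<And>u. u \<in> U_id \<Longrightarrow> hermitian (\<Phi> u)"
  shows "\<exists>Z. hermitian Z \<and> gap_asymptotic \<Phi> Z"
proof -
  define b where "b = norm (\<Phi> (pt (\<lambda>_. 0)))"
  have b: "norm (\<Phi> u) = b" if "u \<in> U_id" for u
    unfolding b_def by (rule solution_on_norm[OF \<Phi> convex_U_id order_refl pt_in_U_id h[OF pt_in_U_id] that])
  have "\<exists>Z. hermitian Z \<and> model Z (corner CARD('n) N) = \<Phi> (pt (corner CARD('n) N))" for N
    using model_inverse[OF h[OF pt_in_U_id]] by metis
  then obtain Z where Z: "\<And>N. hermitian (Z N)" "\<And>N. model (Z N) (corner CARD('n) N) = \<Phi> (pt (corner CARD('n) N))"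
    by metis
  have "norm (Z N) \<le> b" for N using norm_model[OF Z(1), of N "corner CARD('n) N"] b[OF pt_in_U_id] by (simp add: Z(2))
  then obtain l r where r: "strict_mono (r :: nat \<Rightarrow> nat)" and l: "(\<lambda>N. Z (r N)) \<longlonglongrightarrow> l" by (rule bounded_subsequence)
  have hl: "hermitian l" by (rule closed_hermitian[OF l Z(1)])
  let ?M = "(2 * b * (real CARD('n) + 1) + 2) * (real CARD('n) ^ 4 * (b * b))"
  have "norm (\<Phi> (pt s) - model l s) \<le> ?M * (\<Sum>k=2..CARD('n) - 1. exp (- s k))" if s: "s \<in> region CARD('n) 0" for s
  proof -
    obtain N0 :: nat where N0: "\<forall>i\<in>{2..CARD('n) - 1}. s i \<le> real N0" using bounded_by_nat by blast
    have lim: "(\<lambda>N. norm (\<Phi> (pt s) - model (Z (r N)) s)) \<longlonglongrightarrow> norm (\<Phi> (pt s) - model l s)"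
      by (intro tendsto_intros model_continuous l)
    show ?thesis
    proof (rule limit_le_const[OF lim])
      fix N assume "N \<ge> N0"
      then have "N0 \<le> r N" using seq_suble[OF r, of N] by simp
      then have "\<And>i. i \<in> {2..CARD('n) - 1} \<Longrightarrow> s i \<le> real (r N)" using N0 by fastforce
      then show "norm (\<Phi> (pt s) - model (Z (r N)) s) \<le> ?M * (\<Sum>k=2..CARD('n) - 1. exp (- s k))"
        by (intro model_error[where N = "r N"] n \<Phi> Z s) (auto simp: b Z(2))
    qed
  qed
  moreover have "0 \<le> ?M" by (auto simp: b_def intro!: mult_nonneg_nonneg add_nonneg_nonneg)
  ultimately show ?thesis using hl unfolding gap_asymptotic_def by blast
qed

lemma corner_region: "corner n N \<in> region n (real N)" by (simp add: corner_def region_def)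

lemma sum_exp_le: "s \<in> region n R \<Longrightarrow> (\<Sum>k=2..n - 1. exp (- s k)) \<le> real n * exp (- R)"
proof -
  assume s: "s \<in> region n R"
  have "(\<Sum>k=2..n - 1. exp (- s k)) \<le> (\<Sum>k=2..n - 1. exp (- R))"
    using s by (intro sum_mono) (auto simp: region_def)
  also have "\<dots> = real (n - 1 - 1) * exp (- R)" by simp
  also have "\<dots> \<le> real n * exp (- R)" by (intro mult_right_mono) auto
  finally show ?thesis .
qed

text \<open>
  At the corners the two leading terms approach each other, so \<open>model_determines\<close> applies.
\<close>

theorem regularized_limit_unique:
  fixes \<Phi> :: "real^'n::{finite,linorder} \<Rightarrow> 'n cmat"
  assumes "hermitian Z" "hermitian Z'" "gap_asymptotic \<Phi> Z" "gap_asymptotic \<Phi> Z'"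
  shows "Z = Z'"
proof (rule model_determines[OF assms(1,2)])
  fix e :: real assume e: "e > 0"
  obtain M L where M: "0 \<le> M" "\<And>s. s \<in> region CARD('n) L \<Longrightarrow> norm (\<Phi> (pt s) - model Z s) \<le> M * (\<Sum>k=2..CARD('n) - 1. exp (- s k))"
    using assms(3) unfolding gap_asymptotic_def by blast
  obtain M' L' where M': "0 \<le> M'" "\<And>s. s \<in> region CARD('n) L' \<Longrightarrow> norm (\<Phi> (pt s) - model Z' s) \<le> M' * (\<Sum>k=2..CARD('n) - 1. exp (- s k))"
    using assms(4) unfolding gap_asymptotic_def by blast
  have "((\<lambda>N. (M + M') * (real CARD('n) * exp (- real N))) \<longlongrightarrow> (M + M') * (real CARD('n) * 0)) sequentially"
    by (intro tendsto_intros filterlim_compose[OF exp_at_bot] filterlim_compose[OF filterlim_uminus_at_bot_at_top] filterlim_real_sequentially)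
  then have "\<forall>\<^sub>F N in sequentially. (M + M') * (real CARD('n) * exp (- real N)) < e"
    using e by (intro order_tendstoD) auto
  moreover have "\<forall>\<^sub>F N in sequentially. L \<le> real N" "\<forall>\<^sub>F N in sequentially. L' \<le> real N"
    using filterlim_real_sequentially by (auto simp: filterlim_at_top)
  ultimately have "\<forall>\<^sub>F N in sequentially. (M + M') * (real CARD('n) * exp (- real N)) < e \<and> L \<le> real N \<and> L' \<le> real N"
    by eventually_elim auto
  then obtain N where N: "(M + M') * (real CARD('n) * exp (- real N)) < e" "L \<le> real N" "L' \<le> real N"
    using eventually_happens'[OF sequentially_bot] by blast
  let ?s = "corner CARD('n) N" and ?S = "\<Sum>k=2..CARD('n) - 1. exp (- corner CARD('n) N k)"
  have reg: "?s \<in> region CARD('n) L" "?s \<in> region CARD('n) L'" using N by (auto simp: corner_def region_def)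
  have "norm (model Z ?s - model Z' ?s) \<le> norm (\<Phi> (pt ?s) - model Z ?s) + norm (\<Phi> (pt ?s) - model Z' ?s)"
    using norm_triangle_ineq4[of "\<Phi> (pt ?s) - model Z' ?s" "\<Phi> (pt ?s) - model Z ?s"] by simp
  also have "\<dots> \<le> M * ?S + M' * ?S" using M(2)[OF reg(1)] M'(2)[OF reg(2)] by (rule add_mono)
  also have "\<dots> \<le> (M + M') * (real CARD('n) * exp (- real N))"
    unfolding distrib_right[symmetric] using M(1) M'(1) by (intro mult_left_mono sum_exp_le corner_region) auto
  finally show "\<exists>s. norm (model Z s - model Z' s) < e" using N(1) by (intro exI[of _ ?s]) linarith
qed

text \<open>
  Let \<open>F N\<close> be the solution that agrees with the leading term at the \<open>N\<close>-th corner. Along a subsequence the values at the base point \<open>o0\<close>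
  converge; by continuous dependence the solutions then converge at every point, and the bound of \<open>model_error\<close>
  passes to the limit.
\<close>

theorem solution_with_limit_exists:
  fixes Z :: "'n::{finite,linorder} cmat"
  assumes n: "2 \<le> CARD('n)" and Z: "hermitian Z"
  shows "\<exists>\<Phi>. solution_on U_id \<Phi> \<and> (\<forall>u\<in>U_id. hermitian (\<Phi> u)) \<and> gap_asymptotic \<Phi> Z"
proof -
  define b where "b = norm Z"
  have "\<exists>\<Phi>. solution_on U_id \<Phi> \<and> \<Phi> (pt (corner CARD('n) N)) = model Z (corner CARD('n) N)" for N
    using global_solution[OF pt_in_U_id hermitian_model[OF Z]] by metis
  then obtain F where F: "\<And>N. solution_on U_id (F N)" "\<And>N. F N (pt (corner CARD('n) N)) = model Z (corner CARD('n) N)"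
    by metis
  have hF: "hermitian (F N u)" if "u \<in> U_id" for N u
    by (rule solution_on_hermitian[OF F(1) convex_U_id order_refl pt_in_U_id _ that, of N "corner CARD('n) N"])
      (simp add: F(2) hermitian_model[OF Z])
  have bF: "norm (F N u) = b" if "u \<in> U_id" for N u
    using solution_on_norm[OF F(1) convex_U_id order_refl pt_in_U_id _ that, of N "corner CARD('n) N"]
    by (simp add: F(2) hermitian_model[OF Z] norm_model[OF Z] b_def)
  define o0 :: "real^'n::{finite,linorder}" where "o0 = pt (\<lambda>_. 0)"
  have o0: "o0 \<in> U_id" by (simp add: o0_def pt_in_U_id)
  have "norm (F N o0) \<le> b" for N using bF[OF o0] by simp
  then obtain Y r where r: "strict_mono (r :: nat \<Rightarrow> nat)" and Y: "(\<lambda>N. F (r N) o0) \<longlonglongrightarrow> Y" by (rule bounded_subsequence)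
  have hY: "hermitian Y" by (rule closed_hermitian[OF Y]) (rule hF[OF o0])
  obtain \<Phi> where \<Phi>: "solution_on U_id \<Phi>" "\<Phi> o0 = Y" using global_solution[OF o0 hY] .
  have h\<Phi>: "hermitian (\<Phi> u)" if "u \<in> U_id" for u
    by (rule solution_on_hermitian[OF \<Phi>(1) convex_U_id order_refl o0 _ that]) (simp add: \<Phi>(2) hY)
  have nY: "norm Y = b"
    using tendsto_norm[OF Y] bF[OF o0] LIMSEQ_unique[of "\<lambda>_. b" "norm Y" b] by simp
  have b\<Phi>: "norm (\<Phi> u) = b" if "u \<in> U_id" for u
    using solution_on_norm[OF \<Phi>(1) convex_U_id order_refl o0 _ that] by (simp add: \<Phi>(2) hY nY)
  have conv: "(\<lambda>N. F (r N) v) \<longlonglongrightarrow> \<Phi> v" if v: "v \<in> U_id" for v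
  proof -
    let ?\<eta> = "v - o0"
    have v': "o0 + ?\<eta> \<in> U_id" using v by simp
    have seg: "o0 + t *\<^sub>R ?\<eta> \<in> U_id" if "t \<in> {0..1}" for t by (rule segment_U_id[OF o0 v' that])
    have "compact ((\<lambda>t. wmat (o0 + t *\<^sub>R ?\<eta>) ?\<eta>) ` {0..1})"
      by (intro compact_continuous_image continuous_on_wmat inj_U_id seg) auto
    then obtain W where W: "\<forall>x\<in>(\<lambda>t. wmat (o0 + t *\<^sub>R ?\<eta>) ?\<eta>) ` {0..1}. norm x \<le> W"
      using compact_imp_bounded bounded_iff by metis
    have gr: "norm (F N v - \<Phi> v) \<le> exp (2 * W * (b + b)) * norm (F N o0 - \<Phi> o0)" for N
    proof -
      have "norm (F N (o0 + 1 *\<^sub>R ?\<eta>) - \<Phi> (o0 + 1 *\<^sub>R ?\<eta>)) \<le> exp (2 * W * (b + b)) * norm (F N (o0 + 0 *\<^sub>R ?\<eta>) - \<Phi> (o0 + 0 *\<^sub>R ?\<eta>))"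
      proof (rule solves_along_gronwall)
        show "solves_along o0 ?\<eta> (\<lambda>t. F N (o0 + t *\<^sub>R ?\<eta>))" "solves_along o0 ?\<eta> (\<lambda>t. \<Phi> (o0 + t *\<^sub>R ?\<eta>))"
          by (rule solution_on_solves_along[OF _ convex_U_id o0 v'], rule F \<Phi>)+
        fix t :: real assume t: "t \<in> {0..1}"
        have b0: "0 \<le> b" by (simp add: b_def)
        show "2 * norm (wmat (o0 + t *\<^sub>R ?\<eta>) ?\<eta>) * (norm (F N (o0 + t *\<^sub>R ?\<eta>)) + norm (\<Phi> (o0 + t *\<^sub>R ?\<eta>))) \<le> 2 * W * (b + b)"
          unfolding bF[OF seg[OF t]] b\<Phi>[OF seg[OF t]] using W t b0 by (intro mult_right_mono) auto
      qed
      then show ?thesis by simp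
    qed
    have "(\<lambda>N. F (r N) o0 - \<Phi> o0) \<longlonglongrightarrow> 0" using LIM_zero[OF Y] by (simp add: \<Phi>(2))
    then have "(\<lambda>N. exp (2 * W * (b + b)) * norm (F (r N) o0 - \<Phi> o0)) \<longlonglongrightarrow> 0"
      by (intro tendsto_mult_right_zero tendsto_norm_zero)
    then have "(\<lambda>N. F (r N) v - \<Phi> v) \<longlonglongrightarrow> 0"
      by (rule Lim_null_comparison[rotated]) (use gr in auto)
    then show ?thesis by (rule LIM_zero_cancel)
  qed
  let ?M = "(2 * b * (real CARD('n) + 1) + 2) * (real CARD('n) ^ 4 * (b * b))"
  have "norm (\<Phi> (pt s) - model Z s) \<le> ?M * (\<Sum>k=2..CARD('n) - 1. exp (- s k))" if s: "s \<in> region CARD('n) 0" for s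
  proof -
    obtain N0 :: nat where N0: "\<forall>i\<in>{2..CARD('n) - 1}. s i \<le> real N0" using bounded_by_nat by blast
    have lim: "(\<lambda>N. norm (F (r N) (pt s) - model Z s)) \<longlonglongrightarrow> norm (\<Phi> (pt s) - model Z s)"
      by (intro tendsto_intros conv pt_in_U_id)
    show ?thesis
    proof (rule limit_le_const[OF lim])
      fix N assume "N \<ge> N0"
      then have "N0 \<le> r N" using seq_suble[OF r, of N] by simp
      then have "\<And>i. i \<in> {2..CARD('n) - 1} \<Longrightarrow> s i \<le> real (r N)" using N0 by fastforce
      then show "norm (F (r N) (pt s) - model Z s) \<le> ?M * (\<Sum>k=2..CARD('n) - 1. exp (- s k))"
        by (intro model_error[where N = "r N"] n F Z s) (auto simp: bF)
    qed
  qed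
  moreover have "0 \<le> ?M" by (auto simp: b_def intro!: mult_nonneg_nonneg add_nonneg_nonneg)
  ultimately show ?thesis using \<Phi>(1) h\<Phi> unfolding gap_asymptotic_def by blast
qed

text \<open>
  Let \<open>K\<close> be the supremum of the difference over the region \<open>s\<^sub>k \<ge> R\<close>. As \<open>S\<close> tends to infinity, the difference at \<open>S\<close> is
  \<open>O(exp (- N))\<close> and the lengths of the stretches are at most \<open>N\<close>, so the comparison leaves only the contribution of \<open>eps\<close>, which is
  \<open>K\<close> times a multiple of \<open>exp (- R)\<close>.
\<close>

theorem solution_determined_by_limit:
  fixes \<Phi> \<Psi> :: "real^'n::{finite,linorder} \<Rightarrow> 'n cmat"
  assumes \<Phi>: "solution_on U_id \<Phi>" "\<And>u. u \<in> U_id \<Longrightarrow> hermitian (\<Phi> u)" "gap_asymptotic \<Phi> Z"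
    and \<Psi>: "solution_on U_id \<Psi>" "\<And>u. u \<in> U_id \<Longrightarrow> hermitian (\<Psi> u)" "gap_asymptotic \<Psi> Z"
    and v: "v \<in> U_id"
  shows "\<Psi> v = \<Phi> v"
proof -
  let ?n = "CARD('n)"
  define b where "b = max (norm (\<Phi> (pt (\<lambda>_. 0)))) (norm (\<Psi> (pt (\<lambda>_. 0))))"
  have b\<Phi>: "norm (\<Phi> u) \<le> b" if "u \<in> U_id" for u
    using solution_on_norm[OF \<Phi>(1) convex_U_id order_refl pt_in_U_id \<Phi>(2)[OF pt_in_U_id] that] by (simp add: b_def)
  have b\<Psi>: "norm (\<Psi> u) \<le> b" if "u \<in> U_id" for u
    using solution_on_norm[OF \<Psi>(1) convex_U_id order_refl pt_in_U_id \<Psi>(2)[OF pt_in_U_id] that] by (simp add: b_def)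
  have b0: "0 \<le> b" by (simp add: b_def le_max_iff_disj)
  obtain M L where M: "0 \<le> M" "\<And>s. s \<in> region ?n L \<Longrightarrow> norm (\<Phi> (pt s) - model Z s) \<le> M * (\<Sum>k=2..?n - 1. exp (- s k))"
    using \<Phi>(3) unfolding gap_asymptotic_def by blast
  obtain M' L' where M': "0 \<le> M'" "\<And>s. s \<in> region ?n L' \<Longrightarrow> norm (\<Psi> (pt s) - model Z s) \<le> M' * (\<Sum>k=2..?n - 1. exp (- s k))"
    using \<Psi>(3) unfolding gap_asymptotic_def by blast
  define A where "A = (2 * b * (real ?n + 1) + 2) * (real ?n ^ 4 * (2 * b))"
  have A0: "0 \<le> A" using b0 by (auto simp: A_def)
  (* Since exp R \<ge> R, this choice makes the contribution of eps at most K / 2. *)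
  define R where "R = A * real ?n * 2"
  have R0: "0 \<le> R" using A0 by (simp add: R_def)
  have AR: "A * (real ?n * exp (- R)) \<le> 1 / 2"
  proof -
    have "R \<le> exp R" using exp_ge_add_one_self[of R] by linarith
    then have "R * exp (- R) \<le> exp R * exp (- R)" by (rule mult_right_mono) simp
    also have "exp R * exp (- R) = 1" by (simp add: exp_minus)
    finally have "R * exp (- R) \<le> 1" .
    moreover have "A * (real ?n * exp (- R)) = R * exp (- R) / 2" by (simp add: R_def)
    ultimately show ?thesis by linarith
  qed
  define d where "d = (\<lambda>s. norm (\<Phi> (pt s) - \<Psi> (pt s)))"
  have dbd: "d s \<le> b + b" for s
    unfolding d_def using norm_triangle_ineq4[of "\<Phi> (pt s)" "\<Psi> (pt s)"] b\<Phi>[OF pt_in_U_id[of s]] b\<Psi>[OF pt_in_U_id[of s]] by linarith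
  define K where "K = (SUP s\<in>region ?n R. d s)"
  have bdd: "bdd_above (d ` region ?n R)" using dbd by (intro bdd_aboveI2)
  have dK: "d s \<le> K" if "s \<in> region ?n R" for s unfolding K_def by (intro cSUP_upper that bdd)
  interpret compare "\<lambda>s. \<Phi> (pt s)" "\<lambda>s. \<Psi> (pt s)" 1 b "2 * b * K" R
    by (rule compare_solutions[OF \<Phi>(1) b\<Phi> \<Psi>(1) b\<Psi> \<Psi>(2) R0]) (use dK in \<open>auto simp: d_def\<close>)
  have c_path: "c_path = A * K" by (simp add: c_path_def c_delta_def A_def)
  have half: "d s \<le> K / 2" if s: "s \<in> region ?n R" for s
  proof -
    obtain N0 :: nat where N0: "\<forall>i\<in>{2..?n - 1}. s i \<le> real N0" using bounded_by_nat by blast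
    have K0: "0 \<le> K" using dK[OF s] norm_ge_zero[of "\<Phi> (pt s) - \<Psi> (pt s)"] unfolding d_def by linarith
    let ?c = "(M + M') * real ?n"
    have bound: "d s \<le> ?c * exp (- real N) + 2 * b * real ?n * (?c * (real N * exp (- real N))) + K / 2"
      if N: "N \<ge> N0" "L \<le> real N" "L' \<le> real N" for N
    proof -
      define S where "S = (\<lambda>i. if i \<in> {2..?n - 1} then real N else s i)"
      have SR: "S \<in> region ?n (real N)" "S \<in> region ?n L" "S \<in> region ?n L'" using N by (auto simp: S_def region_def)
      have "norm (D S) \<le> norm (\<Phi> (pt S) - model Z S) + norm (\<Psi> (pt S) - model Z S)"
        using norm_triangle_ineq4[of "\<Phi> (pt S) - model Z S" "\<Psi> (pt S) - model Z S"] by (simp add: D_def)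
      also have "\<dots> \<le> (M + M') * (\<Sum>k=2..?n - 1. exp (- S k))"
        unfolding distrib_right using M(2)[OF SR(2)] M'(2)[OF SR(3)] by (rule add_mono)
      also have "\<dots> \<le> (M + M') * (real ?n * exp (- real N))"
        using M(1) M'(1) by (intro mult_left_mono sum_exp_le SR) auto
      finally have DS: "norm (D S) \<le> ?c * exp (- real N)" by (simp add: mult.assoc)
      have "norm (D s) \<le> norm (D S) + (\<Sum>m=2..?n - 1. 2 * b * norm (D S) * (S m - s m) + c_path * exp (- s m))"
        by (rule comparison[OF s]) (use N0 N in \<open>fastforce simp: S_def\<close>)+
      also have "\<dots> \<le> ?c * exp (- real N) + (\<Sum>m=2..?n - 1. 2 * b * (?c * exp (- real N)) * real N + c_path * exp (- s m))"
      proof (intro add_mono sum_mono order_refl)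
        fix m assume m: "m \<in> {2..?n - 1}"
        have "0 \<le> s m" by (rule region_nonneg[OF s m])
        moreover have "s m \<le> real N0" using N0 m by blast
        ultimately show "2 * b * norm (D S) * (S m - s m) \<le> 2 * b * (?c * exp (- real N)) * real N"
          using m DS b0 M(1) M'(1) N by (intro mult_mono mult_left_mono) (auto simp: S_def)
      qed (rule DS)
      also have "\<dots> = ?c * exp (- real N) + (real (?n - 1 - 1) * (2 * b * (?c * exp (- real N)) * real N) + c_path * (\<Sum>m=2..?n - 1. exp (- s m)))"
        by (simp add: sum.distrib sum_distrib_left) (simp add: numeral_2_eq_2)
      also have "\<dots> \<le> ?c * exp (- real N) + (real ?n * (2 * b * (?c * exp (- real N)) * real N) + A * K * (real ?n * exp (- R)))"
        unfolding c_path using b0 M(1) M'(1) A0 K0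
        by (intro add_mono order_refl mult_right_mono mult_left_mono sum_exp_le s) (auto intro!: mult_nonneg_nonneg)
      also have "A * K * (real ?n * exp (- R)) = (A * (real ?n * exp (- R))) * K" by simp
      also have "\<dots> \<le> (1 / 2) * K" by (intro mult_right_mono AR K0)
      finally show ?thesis by (simp add: d_def D_def mult_ac)
    qed
    have 1: "(\<lambda>N. exp (- real N)) \<longlonglongrightarrow> 0"
      by (intro filterlim_compose[OF exp_at_bot] filterlim_compose[OF filterlim_uminus_at_bot_at_top] filterlim_real_sequentially)
    have 2: "(\<lambda>N. real N * exp (- real N)) \<longlonglongrightarrow> 0"
      using filterlim_compose[OF tendsto_power_div_exp_0[of 1] filterlim_real_sequentially] by (simp add: exp_minus divide_inverse)
    have "(\<lambda>N. ?c * exp (- real N) + 2 * b * real ?n * (?c * (real N * exp (- real N))) + K / 2)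
        \<longlonglongrightarrow> ?c * 0 + 2 * b * real ?n * (?c * 0) + K / 2"
      by (intro tendsto_intros 1 2)
    moreover have "\<forall>\<^sub>F N in sequentially. N \<ge> N0 \<and> L \<le> real N \<and> L' \<le> real N"
      using filterlim_real_sequentially by (intro eventually_conj) (auto simp: filterlim_at_top eventually_ge_at_top)
    ultimately have "d s \<le> ?c * 0 + 2 * b * real ?n * (?c * 0) + K / 2"
      by (intro tendsto_lowerbound[where F = sequentially]) (auto elim!: eventually_mono intro: bound)
    then show ?thesis by simp
  qed
  have ne: "corner ?n (nat \<lceil>R\<rceil>) \<in> region ?n R" using real_nat_ceiling_ge[of R] by (auto simp: corner_def region_def)
  have "K \<le> K / 2" unfolding K_def[of] by (rule cSUP_least) (use ne half in \<open>auto simp: K_def\<close>)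
  then have "d (corner ?n (nat \<lceil>R\<rceil>)) \<le> 0" using dK[OF ne] by linarith
  then have "\<Psi> (pt (corner ?n (nat \<lceil>R\<rceil>))) = \<Phi> (pt (corner ?n (nat \<lceil>R\<rceil>)))" by (simp add: d_def)
  from solution_on_unique[OF \<Psi>(1) \<Phi>(1) convex_U_id order_refl pt_in_U_id this v] show ?thesis .
qed

theorem theorem1p1:
  assumes "2 \<le> CARD('n::{finite,linorder})"
  shows "(\<forall>\<Phi> :: real^'n::{finite,linorder} \<Rightarrow> 'n cmat. herm_isomonodromy_solution \<Phi> \<longrightarrow>
            (\<exists>!\<Phi>\<^sub>0. hermitian \<Phi>\<^sub>0 \<and> has_gap_asymptotics \<Phi> \<Phi>\<^sub>0)) \<and>
         (\<forall>\<Phi>\<^sub>0 :: 'n cmat. hermitian \<Phi>\<^sub>0 \<longrightarrow>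
            (\<exists>\<Phi>. herm_isomonodromy_solution \<Phi> \<and> real_analytic_on \<Phi> U_id \<and> has_gap_asymptotics \<Phi> \<Phi>\<^sub>0 \<and>
               (\<forall>\<Psi>. herm_isomonodromy_solution \<Psi> \<and> real_analytic_on \<Psi> U_id \<and> has_gap_asymptotics \<Psi> \<Phi>\<^sub>0
                  \<longrightarrow> (\<forall>u\<in>U_id. \<Psi> u = \<Phi> u))))"
proof (intro conjI allI impI)
  fix \<Phi> :: "real^'n::{finite,linorder} \<Rightarrow> 'n cmat" assume \<Phi>: "herm_isomonodromy_solution \<Phi>"
  have sol: "solution_on U_id \<Phi>" by (rule isomonodromy_imp_solution_on[OF \<Phi>])
  have h: "\<And>u. u \<in> U_id \<Longrightarrow> hermitian (\<Phi> u)" using \<Phi> by (simp add: herm_isomonodromy_solution_def)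
  obtain Z where Z: "hermitian Z" "gap_asymptotic \<Phi> Z" using regularized_limit_exists[OF assms sol h] by blast
  show "\<exists>!\<Phi>\<^sub>0. hermitian \<Phi>\<^sub>0 \<and> has_gap_asymptotics \<Phi> \<Phi>\<^sub>0"
  proof (rule ex1I[of _ Z])
    show "hermitian Z \<and> has_gap_asymptotics \<Phi> Z" using Z gap_asymptoticI[OF assms Z(1) sol] by simp
    fix Z' assume "hermitian Z' \<and> has_gap_asymptotics \<Phi> Z'"
    then show "Z' = Z" using regularized_limit_unique[of Z' Z \<Phi>] gap_asymptoticD[OF assms, of Z' \<Phi>] Z by simp
  qed
next
  fix Z :: "'n cmat" assume Z: "hermitian Z"
  obtain \<Phi> where \<Phi>: "solution_on U_id \<Phi>" "\<forall>u\<in>U_id. hermitian (\<Phi> u)" "gap_asymptotic \<Phi> Z"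
    using solution_with_limit_exists[OF assms Z] by blast
  show "\<exists>\<Phi>. herm_isomonodromy_solution \<Phi> \<and> real_analytic_on \<Phi> U_id \<and> has_gap_asymptotics \<Phi> Z \<and>
      (\<forall>\<Psi>. herm_isomonodromy_solution \<Psi> \<and> real_analytic_on \<Psi> U_id \<and> has_gap_asymptotics \<Psi> Z \<longrightarrow> (\<forall>u\<in>U_id. \<Psi> u = \<Phi> u))"
  proof (intro exI[of _ \<Phi>] conjI allI impI ballI)
    show "herm_isomonodromy_solution \<Phi>"
      using solution_on_imp_isomonodromy[OF \<Phi>(1)] \<Phi>(2) by (simp add: herm_isomonodromy_solution_def)
    show "real_analytic_on \<Phi> U_id" by (rule solution_real_analytic[OF \<Phi>(1)])
    show "has_gap_asymptotics \<Phi> Z" by (rule gap_asymptoticI[OF assms Z \<Phi>(1,3)])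
    fix \<Psi> and u :: "real^'n::{finite,linorder}"
    assume \<Psi>: "herm_isomonodromy_solution \<Psi> \<and> real_analytic_on \<Psi> U_id \<and> has_gap_asymptotics \<Psi> Z" and u: "u \<in> U_id"
    show "\<Psi> u = \<Phi> u"
    proof (rule solution_determined_by_limit[OF \<Phi>(1) _ \<Phi>(3) _ _ _ u])
      show "solution_on U_id \<Psi>" using \<Psi> by (intro isomonodromy_imp_solution_on) simp
      show "gap_asymptotic \<Psi> Z" using \<Psi> by (intro gap_asymptoticD[OF assms Z]) simp
    qed (use \<Phi>(2) \<Psi> in \<open>auto simp: herm_isomonodromy_solution_def\<close>)
  qed
qed

end
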